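(* Let the two-phase problem (P9) satisfy the long-horizon assumption (A-long), where $l$ is chosen so that its derivative is larger than some $L_l>0$ on the domain of $\sigma$. Then for any $\epsilon>0$ there exist $t_s^*\in\mathbb{R}$ and $\delta>0$ such that for any perturbation $q\in\mathbb{R}^d$ with $\|q\|<\delta$ applied to (P9) generated by $t_s^*$, the resulting optimal control $u(q)=(u_1,\dots,u_N)$ and the propagated final state $\tilde x_{N+1}(q)$ satisfy: (1) $\|G(\tilde x_{N+1}(q))\|\le\epsilon$; (2) with probability one (for $q$ drawn uniformly at random from a cube $\{q:|q_i|\le\epsilon'\ \forall i\}$ contained in $\{\|q\|<\delta\}$), $g(u_i)\ge\rho_{\min}$ for all $i\in\{1,\dots,N\}$ except at most $n_x-1$ indices; (3) $g(u_i)<\rho_{\min}+\epsilon$ for all $i$; (4) $m(\tilde x_{N+1}(q))<m^*+\epsilon$, where $m^*$ is the optimal value of problem (P7).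
   Context: Data: $A_c\in\mathbb{R}^{n_x\times n_x}$, $B_c\in\mathbb{R}^{n_x\times n_u}$, $t_f>0$, $N\ge1$, $x_s\in\mathbb{R}^{n_x}$ (initial state), reals $\rho_{\min},\rho_{\max}$; convex $C^1$ functions $m:\mathbb{R}^{n_x}\to\mathbb{R}$, $g:\mathbb{R}^{n_u}\to\mathbb{R}$, $l:\mathbb{R}\to\mathbb{R}$; $G:\mathbb{R}^{n_x}\to\mathbb{R}^{n_G}$ affine; a fixed $u_s\in\mathbb{R}^{n_u}$ with $g(u_s)=\rho_{\min}$. For a switching time $t_s$ put $x_{\rm init}(t_s)=\exp(A_ct_s)x_s+\int_0^{t_s}\exp(A_c\tau)d\tau\,B_cu_s$, $A(t_s)=\exp(A_c\frac{t_f-t_s}{N})$, $B(t_s)=\int_0^{(t_f-t_s)/N}\exp(A_c\tau)d\tau\,B_c$. Problem (P9) generated by $t_s$: minimize $m(x_{N+1})+\sum_{i=1}^N l(\sigma_i)\frac{t_f-t_s}{N}+t_s\,l(\rho_{\min})$ over $x=(x_1,\dots,x_{N+1})$, $u=(u_1,\dots,u_N)$, $\sigma=(\sigma_1,\dots,\sigma_N)$ subject to $x_{i+1}=A(t_s)x_i+B(t_s)u_i$, $\rho_{\min}\le\sigma_i\le\rho_{\max}$, $g(u_i)\le\sigma_i$ for $i=1,\dots,N$, $x_1=x_{\rm init}(t_s)$, $G(x_{N+1})=0$. Its optimal value is $v(t_s)$. With $z=(x,u,\sigma)$, let $F(z,t_s)=0$ collect its affine equality constraints and let $\tilde V=\{z:\rho_{\min}\le\sigma_i\le\rho_{\max},\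 g(u_i)\le\sigma_i\ \forall i\}$. Problem (P7): minimize $m(x_{N+1})$ over $x_{N+1}\in\mathbb{R}^{n_x}$ subject to $G(x_{N+1})=0$; optimal value $m^*$. Problem (P4): minimize $m(x_{N+1})+\sum_{i=1}^N l_i(\sigma_i)$ subject to the constraints of (P9) with $t_s=0$, where $l_i:\mathbb{R}\to\mathbb{R}$ are the original convex $C^1$ stage costs, strictly increasing on $[\rho_{\min},\infty)$. It is in the long-horizon case if, for its optimal solution, $\sigma_i^*=\rho_{\min}$ for all $i$ and $x_{N+1}^*$ solves (P7). Assumption (A-long): (P4) is in the long-horizon case; there exists $t_b$ with $v(t_b)>m^*+t_f\,l(\rho_{\min})$; and for every $t_s\in[0,t_b]$ problem (P9) satisfies: (a) the stage cost is $C^1$ and strictly increasing on $[\rho_{\min},\infty)$, $m$ is $C^1$, $\{u:g(u_i)\le\rho_{\min}\ \forall i\}$ is nonempty and $\{u:g(u_i)\le\rho_{\max}\ \forall i\}$ is compact; (b) $\operatorname{rank}(B(t_s),A(t_s)B(t_s),\dots,A(t_s)^{n_x-1}B(t_s))=n_x$; (c) $\nabla_zF(\cdot,t_s)$ (constant in $z$) has full row rank; (d) there is $z$ in the interior of $\tilde V$ with $F(z,t_s)=0$. Perturbation: let $A(t_s^* )=Q^{-1}JQ$ be a Jordan decomposition and $\lambda_1,\dots,\lambda_d$ the distinct eigenvalues of $A(t_s^* )$. For $q\in\mathbb{R}^d$, $\tilde A(t_s^*,q)=Q^{-1}\tilde JQ$, where $\tilde J$ is obtained from $J$ by replacing, in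 every Jordan block belonging to $\lambda_i$, the diagonal entry $\lambda_i$ by $\lambda_i+q_i$, leaving everything else unchanged. Problems are posed over the reals, so $\tilde A(t_s^*,q)$ is taken to be a real matrix. The perturbed problem is (P9) generated by $t_s^*$ with $A(t_s^* )$ replaced by $\tilde A(t_s^*,q)$; $(x(q),u(q),\sigma(q))$ is its optimal solution. $\tilde x_{N+1}(q)$ is the final state obtained by applying $u(q)$ to the unperturbed dynamics: $\tilde x_1=x_{\rm init}(t_s^* )$, $\tilde x_{i+1}=A(t_s^* )\tilde x_i+B(t_s^* )u_i(q)$, $i=1,\dots,N$. *)

theory Defs
  imports
    "HOL-Analysis.Analysis"
    "Jordan_Normal_Form.Spectral_Radius"
begin

primrec mpow :: "real^'n^'n \<Rightarrow> nat \<Rightarrow> real^'n^'n" where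
  "mpow M 0 = Finite_Cartesian_Product.mat 1"
| "mpow M (Suc k) = M ** mpow M k"

text \<open>The product of the type class \<^class>\<open>times\<close> on \<open>real^'n^'n\<close> is componentwise, so \<^const>\<open>exp\<close> is
  not the matrix exponential.\<close>

definition mexp :: "real^'n^'n \<Rightarrow> real^'n^'n" where
  "mexp M = (\<Sum>k. (1 / fact k) *\<^sub>R mpow M k)"

definition mexp_int :: "real^'n^'n \<Rightarrow> real \<Rightarrow> real^'n^'n" where
  "mexp_int M h = (LBINT \<tau>=0..ereal h. mexp (\<tau> *\<^sub>R M))"

text \<open>The block matrix \<open>(B, A B, \<dots>, A^(n-1) B)\<close>: its columns are indexed by pairs \<open>(k, j)\<close>, where \<open>k\<close>
  runs through the \<open>n = CARD('n)\<close> exponents \<open>0, \<dots>, n-1\<close> via the bijection \<^const>\<open>to_nat_on\<close>.\<close>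

definition ctrb :: "real^'n^'n \<Rightarrow> real^'m^'n \<Rightarrow> real^('n \<times> 'm)^'n" where
  "ctrb A B = (\<chi> i p. vec_nth (vec_nth (mpow A (to_nat_on UNIV (fst p)) ** B) i) (snd p))"

definition C1 :: "('a::real_normed_vector \<Rightarrow> real) \<Rightarrow> bool" where
  "C1 f \<longleftrightarrow> (\<exists>f' :: 'a \<Rightarrow> 'a \<Rightarrow>\<^sub>L real.
     (\<forall>x. (f has_derivative blinfun_apply (f' x)) (at x)) \<and> continuous_on UNIV f')"

definition opt_value :: "('z \<Rightarrow> real) \<Rightarrow> 'z set \<Rightarrow> ereal" where
  "opt_value f S = (INF z\<in>S. ereal (f z))"

definition optimal_in :: "('z \<Rightarrow> real) \<Rightarrow> 'z set \<Rightarrow> 'z \<Rightarrow> bool" where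
  "optimal_in f S z \<longleftrightarrow> is_arg_min f (\<lambda>y. y \<in> S) z"

record ('x, 'u, 'g) two_phase =
  A_c :: "real^'x::finite^'x"
  B_c :: "real^'u::finite^'x"
  t_f :: real
  N_stages :: nat
  x_s :: "real^'x"
  rho_min :: real
  rho_max :: real
  m_cost :: "real^'x \<Rightarrow> real"
  g_con :: "real^'u \<Rightarrow> real"
  l_cost :: "real \<Rightarrow> real"
  G_term :: "real^'x \<Rightarrow> real^'g::finite"
  u_s :: "real^'u"

definition standing :: "('x::finite, 'u::finite, 'g::finite) two_phase \<Rightarrow> bool" where
  "standing P \<longleftrightarrow>
     t_f P > 0 \<and> N_stages P \<ge> 1 \<and>
     convex_on UNIV (m_cost P) \<and> C1 (m_cost P) \<and>
     convex_on UNIV (g_con P) \<and> C1 (g_con P) \<and>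
     convex_on UNIV (l_cost P) \<and> C1 (l_cost P) \<and>
     linear (\<lambda>x. G_term P x - G_term P 0) \<and>
     g_con P (u_s P) = rho_min P"

definition step_len :: "('x::finite, 'u::finite, 'g::finite) two_phase \<Rightarrow> real \<Rightarrow> real" where
  "step_len P ts = (t_f P - ts) / real (N_stages P)"

definition x_init :: "('x::finite, 'u::finite, 'g::finite) two_phase \<Rightarrow> real \<Rightarrow> real^'x" where
  "x_init P ts = mexp (ts *\<^sub>R A_c P) *v x_s P + mexp_int (A_c P) ts *v (B_c P *v u_s P)"

definition A_mat :: "('x::finite, 'u::finite, 'g::finite) two_phase \<Rightarrow> real \<Rightarrow> real^'x^'x" where
  "A_mat P ts = mexp (step_len P ts *\<^sub>R A_c P)"

definition B_mat :: "('x::finite, 'u::finite, 'g::finite) two_phase \<Rightarrow> real \<Rightarrow> real^'u^'x" where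
  "B_mat P ts = mexp_int (A_c P) (step_len P ts) ** B_c P"

text \<open>A point \<open>z = (x, u, \<sigma>)\<close> is a triple of sequences of which only \<open>x 1, \<dots>, x (N+1)\<close>,
  \<open>u 1, \<dots>, u N\<close> and \<open>\<sigma> 1, \<dots>, \<sigma> N\<close> are meaningful; constraints and costs never look at the other
  entries. In the product topology the interior of such a set is the cylinder over the interior of
  its projection to the meaningful entries.\<close>

type_synonym ('x, 'u) point = "(nat \<Rightarrow> real^'x) \<times> (nat \<Rightarrow> real^'u) \<times> (nat \<Rightarrow> real)"

definition V_tilde :: "('x::finite, 'u::finite, 'g::finite) two_phase \<Rightarrow> ('x, 'u) point set" where
  "V_tilde P = {(x, u, \<sigma>). \<forall>i\<in>{1..N_stages P}.
     rho_min P \<le> \<sigma> i \<and> \<sigma> i \<le> rho_max P \<and> g_con P (u i) \<le> \<sigma> i}"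

text \<open>The components of \<open>F(z, ts)\<close>, with the transition matrix \<open>A\<close> as a parameter: \<open>Inl (1, k)\<close> is
  component \<open>k\<close> of the initial condition, \<open>Inl (i+1, k)\<close> that of the \<open>i\<close>-th transition, \<open>Inr k\<close> that of
  the terminal condition.\<close>

type_synonym ('x, 'g) row = "nat \<times> 'x + 'g"

fun F_res :: "('x::finite, 'u::finite, 'g::finite) two_phase \<Rightarrow> real \<Rightarrow> real^'x^'x
    \<Rightarrow> ('x, 'u) point \<Rightarrow> ('x, 'g) row \<Rightarrow> real" where
  "F_res P ts A (x, u, \<sigma>) (Inl (i, k)) =
     (if i = 1 then vec_nth (x 1 - x_init P ts) k
      else vec_nth (x i - (A *v x (i - 1) + B_mat P ts *v u (i - 1))) k)"
| "F_res P ts A (x, u, \<sigma>) (Inr k) = vec_nth (G_term P (x (N_stages P + 1))) k"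

definition F_rows :: "('x::finite, 'u::finite, 'g::finite) two_phase \<Rightarrow> ('x, 'g) row set" where
  "F_rows P = ({1..N_stages P + 1} \<times> UNIV) <+> UNIV"

definition F_zero :: "('x::finite, 'u::finite, 'g::finite) two_phase \<Rightarrow> real \<Rightarrow> real^'x^'x
    \<Rightarrow> ('x, 'u) point set" where
  "F_zero P ts A = {z. \<forall>r\<in>F_rows P. F_res P ts A z r = 0}"

text \<open>Scalar coordinates of \<open>z\<close>, and the displacement of \<open>z\<close> by \<open>h\<close> along one of them.\<close>

type_synonym ('x, 'u) coord = "nat \<times> 'x + nat \<times> 'u + nat"

definition z_coords :: "('x::finite, 'u::finite, 'g::finite) two_phase \<Rightarrow> ('x, 'u) coord set" where
  "z_coords P = ({1..N_stages P + 1} \<times> UNIV) <+> ({1..N_stages P} \<times> UNIV) <+> {1..N_stages P}"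

fun displace :: "('x::finite, 'u::finite) coord \<Rightarrow> real \<Rightarrow> ('x, 'u) point \<Rightarrow> ('x, 'u) point" where
  "displace (Inl (i, k)) h (x, u, \<sigma>) = (x(i := x i + axis k h), u, \<sigma>)"
| "displace (Inr (Inl (i, k))) h (x, u, \<sigma>) = (x, u(i := u i + axis k h), \<sigma>)"
| "displace (Inr (Inr i)) h (x, u, \<sigma>) = (x, u, \<sigma>(i := \<sigma> i + h))"

definition F_jac :: "('x::finite, 'u::finite, 'g::finite) two_phase \<Rightarrow> real
    \<Rightarrow> ('x, 'u) point \<Rightarrow> ('x, 'g) row \<Rightarrow> ('x, 'u) coord \<Rightarrow> real" where
  "F_jac P ts z r c = deriv (\<lambda>h. F_res P ts (A_mat P ts) (displace c h z) r) 0"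

definition F_full_row_rank :: "('x::finite, 'u::finite, 'g::finite) two_phase \<Rightarrow> real \<Rightarrow> bool" where
  "F_full_row_rank P ts \<longleftrightarrow> (\<forall>z. \<forall>w :: ('x, 'g) row \<Rightarrow> real.
     (\<forall>c\<in>z_coords P. (\<Sum>r\<in>F_rows P. w r * F_jac P ts z r c) = 0) \<longrightarrow> (\<forall>r\<in>F_rows P. w r = 0))"

definition feasible :: "('x::finite, 'u::finite, 'g::finite) two_phase \<Rightarrow> real \<Rightarrow> real^'x^'x
    \<Rightarrow> ('x, 'u) point set" where
  "feasible P ts A = V_tilde P \<inter> F_zero P ts A"

fun P9_cost :: "('x::finite, 'u::finite, 'g::finite) two_phase \<Rightarrow> real \<Rightarrow> ('x, 'u) point \<Rightarrow> real" where
  "P9_cost P ts (x, u, \<sigma>) =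
     m_cost P (x (N_stages P + 1)) + (\<Sum>i=1..N_stages P. l_cost P (\<sigma> i) * step_len P ts) + ts * l_cost P (rho_min P)"

definition P9_value :: "('x::finite, 'u::finite, 'g::finite) two_phase \<Rightarrow> real \<Rightarrow> ereal" where
  "P9_value P ts = opt_value (P9_cost P ts) (feasible P ts (A_mat P ts))"

definition P7_feasible :: "('x::finite, 'u::finite, 'g::finite) two_phase \<Rightarrow> (real^'x) set" where
  "P7_feasible P = {y. G_term P y = 0}"

definition P7_value :: "('x::finite, 'u::finite, 'g::finite) two_phase \<Rightarrow> ereal" where
  "P7_value P = opt_value (m_cost P) (P7_feasible P)"

fun P4_cost :: "('x::finite, 'u::finite, 'g::finite) two_phase \<Rightarrow> (nat \<Rightarrow> real \<Rightarrow> real)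
    \<Rightarrow> ('x, 'u) point \<Rightarrow> real" where
  "P4_cost P li (x, u, \<sigma>) = m_cost P (x (N_stages P + 1)) + (\<Sum>i=1..N_stages P. li i (\<sigma> i))"

definition P4_stage_costs :: "('x::finite, 'u::finite, 'g::finite) two_phase
    \<Rightarrow> (nat \<Rightarrow> real \<Rightarrow> real) \<Rightarrow> bool" where
  "P4_stage_costs P li \<longleftrightarrow>
     (\<forall>i\<in>{1..N_stages P}. convex_on UNIV (li i) \<and> C1 (li i) \<and> strict_mono_on {rho_min P..} (li i))"

definition long_horizon :: "('x::finite, 'u::finite, 'g::finite) two_phase
    \<Rightarrow> (nat \<Rightarrow> real \<Rightarrow> real) \<Rightarrow> bool" where
  "long_horizon P li \<longleftrightarrow> (\<exists>x u \<sigma>.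
     optimal_in (P4_cost P li) (feasible P 0 (A_mat P 0)) (x, u, \<sigma>) \<and>
     (\<forall>i\<in>{1..N_stages P}. \<sigma> i = rho_min P) \<and>
     optimal_in (m_cost P) (P7_feasible P) (x (N_stages P + 1)))"

text \<open>The set of controls bounded by \<open>\<rho>\<close> lives in the \<open>N\<close>-fold power of \<open>real^'u\<close>, represented by the
  sequences with the conventional value \<^const>\<open>undefined\<close> outside \<open>{1..N}\<close>; without that restriction
  it could not be compact.\<close>

definition control_set :: "('x::finite, 'u::finite, 'g::finite) two_phase \<Rightarrow> real
    \<Rightarrow> (nat \<Rightarrow> real^'u) set" where
  "control_set P \<rho> = {u \<in> extensional {1..N_stages P}. \<forall>i\<in>{1..N_stages P}. g_con P (u i) \<le> \<rho>}"

definition P9_regular :: "('x::finite, 'u::finite, 'g::finite) two_phase \<Rightarrow> real \<Rightarrow> bool" where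
  "P9_regular P ts \<longleftrightarrow>
     C1 (\<lambda>s. l_cost P s * step_len P ts) \<and>
     strict_mono_on {rho_min P..} (\<lambda>s. l_cost P s * step_len P ts) \<and>
     C1 (m_cost P) \<and>
     control_set P (rho_min P) \<noteq> {} \<and>
     compact (control_set P (rho_max P)) \<and>
     rank (ctrb (A_mat P ts) (B_mat P ts)) = CARD('x) \<and>
     F_full_row_rank P ts \<and>
     interior (V_tilde P) \<inter> F_zero P ts (A_mat P ts) \<noteq> {}"

definition A_long :: "('x::finite, 'u::finite, 'g::finite) two_phase
    \<Rightarrow> (nat \<Rightarrow> real \<Rightarrow> real) \<Rightarrow> bool" where
  "A_long P li \<longleftrightarrow> long_horizon P li \<and>
     (\<exists>tb\<ge>0. P9_value P tb > P7_value P + ereal (t_f P * l_cost P (rho_min P)) \<and>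
       (\<forall>ts\<in>{0..tb}. P9_regular P ts))"

definition cmat_of :: "real^'n^'n \<Rightarrow> complex Matrix.mat" where
  "cmat_of A = Matrix.mat CARD('n) CARD('n)
     (\<lambda>(i, j). complex_of_real
        (vec_nth (vec_nth A (from_nat_into UNIV i)) (from_nat_into UNIV j)))"

definition Re_mat :: "complex Matrix.mat \<Rightarrow> real^'n^'n" where
  "Re_mat M = (\<chi> i j. Re (M $$ (to_nat_on UNIV i, to_nat_on UNIV j)))"

text \<open>\<open>A = Qi J Q\<close> with \<open>Qi\<close> the inverse of \<open>Q\<close> and \<open>J\<close> the Jordan matrix with the blocks \<open>bs\<close>
  (pairs of a positive size and an eigenvalue).\<close>

definition jordan_decomposition :: "real^'n^'n \<Rightarrow> complex Matrix.mat \<Rightarrow> (nat \<times> complex) list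
    \<Rightarrow> complex Matrix.mat \<Rightarrow> bool" where
  "jordan_decomposition A Qi bs Q \<longleftrightarrow>
     0 \<notin> fst ` set bs \<and> similar_mat_wit (cmat_of A) (jordan_matrix bs) Qi Q"

text \<open>A perturbation \<open>q\<close> is indexed by the distinct eigenvalues themselves: \<open>q a\<close> is added to the
  diagonal of every block belonging to the eigenvalue \<open>a\<close>.\<close>

definition perturbed :: "complex Matrix.mat \<Rightarrow> (nat \<times> complex) list \<Rightarrow> complex Matrix.mat
    \<Rightarrow> (complex \<Rightarrow> real) \<Rightarrow> complex Matrix.mat" where
  "perturbed Qi bs Q q =
     Qi * jordan_matrix (map (\<lambda>(n, a). (n, a + complex_of_real (q a))) bs) * Q"

text \<open>The perturbed matrix is required to be real, which for a real \<open>A\<close> with non-real eigenvalues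
  means that conjugate eigenvalues are shifted by the same amount. A vector \<open>q\<close> is turned into such an
  admissible one by letting the eigenvalue of a conjugate pair with positive imaginary part
  determine the shift of both. If all eigenvalues are real, nothing changes; in general it maps the
  uniform distribution on a cube to the uniform distribution on the admissible vectors in that cube
  (the coordinates with nonnegative imaginary part are free and stay independent and uniform).\<close>

definition tie_conjugates :: "(complex \<Rightarrow> real) \<Rightarrow> complex \<Rightarrow> real" where
  "tie_conjugates q a = (if Im a \<ge> 0 then q a else q (cnj a))"

definition cube :: "complex set \<Rightarrow> real \<Rightarrow> (complex \<Rightarrow> real) set" where
  "cube S e = (\<Pi>\<^sub>E a\<in>S. {-e..e})"

definition uniform_cube :: "complex set \<Rightarrow> real \<Rightarrow> (complex \<Rightarrow> real) measure" where
  "uniform_cube S e = uniform_measure (\<Pi>\<^sub>M a\<in>S. lborel) (cube S e)"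

definition P9_solution :: "('x::finite, 'u::finite, 'g::finite) two_phase \<Rightarrow> real \<Rightarrow> real^'x^'x
    \<Rightarrow> ('x, 'u) point \<Rightarrow> bool" where
  "P9_solution P ts A z \<longleftrightarrow> optimal_in (P9_cost P ts) (feasible P ts A) z"

text \<open>\<open>propagate P ts u k\<close> is the state with index \<open>k + 1\<close> of the unperturbed dynamics under \<open>u\<close>.\<close>

primrec propagate :: "('x::finite, 'u::finite, 'g::finite) two_phase \<Rightarrow> real
    \<Rightarrow> (nat \<Rightarrow> real^'u) \<Rightarrow> nat \<Rightarrow> real^'x" where
  "propagate P ts u 0 = x_init P ts"
| "propagate P ts u (Suc k) =
     A_mat P ts *v propagate P ts u k + B_mat P ts *v u (Suc k)"

end

theory Submission
  imports Defs
begin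

text \<open>No Lagrange multipliers are needed. Since \<open>l\<close> is strictly increasing, an optimal \<open>\<sigma>\<close> has
  \<open>\<sigma> i = max rho_min (g (u i))\<close>, so (P9) becomes a convex problem in \<open>u\<close> whose value is at least
  \<open>m* + t_f l(rho_min)\<close>, with equality for \<open>ts = 0\<close>. The value is lower semicontinuous by compactness
  and upper semicontinuous by the Slater and rank conditions, so some \<open>ts\<close> has a value strictly, but
  arbitrarily little, above this bound, and so have all problems with a transition matrix close to
  \<open>A(ts)\<close>. The smallness of the excess gives (1), (3) and (4). For (2), a generic perturbation makes
  any \<open>n\<close> of the matrices \<open>A\<^sup>k B\<close> jointly of full rank. If \<open>n\<close> controls lay strictly below
  \<open>rho_min\<close>, they could therefore be moved at no cost so as to steer the final state towards a solution
  of (P7) while the other controls move towards \<open>u_s\<close>; by convexity and positivity of the excess this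
  lowers the cost.\<close>

text \<open>The perturbation matters only for (2). If A is a rotation of the plane by a right angle,
  its even powers are multiples of the identity, so n stages that are not consecutive can be
  redundant although the pair is controllable. The determinant that detects redundancy is a
  polynomial in \<open>q\<close>: if it is nonzero at one point, however far outside the cube, it is
  nonzero almost everywhere inside. Shifting all eigenvalues by the same R supplies such a point,
  since this turns A into A + R whatever the Jordan structure is.

  The excess of the value over the lower bound must be small because it is the sum of a nonnegative
  terminal part and nonnegative stage parts, hence limits each of them; the slope
  \<open>L\<^sub>l\<close> converts a stage part into a bound on g. It must be positive because at
  excess zero nothing can be lowered: every stage costs l(rho_min) already, and controls may lie
  anywhere below \<open>rho_min\<close>.\<close>

no_notation Matrix.vec_index (infixl "$" 100)

section \<open>Continuity of the problem data\<close>

lemma bounded_bilinear_matrix_vector_mult: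
  "bounded_bilinear (\<lambda>(A::real^'n^'m) (x::real^'n). A *v x)"
  unfolding bilinear_conv_bounded_bilinear[symmetric] bilinear_def
  by (auto intro!: linearI
      simp: matrix_vector_right_distrib matrix_vector_mult_add_rdistrib matrix_vector_mult_scaleR
        scaleR_matrix_vector_assoc)

lemma bounded_bilinear_matrix_matrix_mult:
  "bounded_bilinear (\<lambda>(A::real^'n^'m) (B::real^'k^'n). A ** B)"
  unfolding bilinear_conv_bounded_bilinear[symmetric] bilinear_def
  by (auto intro!: linearI
      simp: matrix_add_ldistrib matrix_matrix_mult_def Finite_Cartesian_Product.vec_eq_iff sum.distrib distrib_right distrib_left
        sum_distrib_left mult_ac)

lemma bounded_bilinear_vector_matrix_mult:
  "bounded_bilinear (\<lambda>(x::real^'m) (A::real^'n^'m). x v* A)"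
  unfolding bilinear_conv_bounded_bilinear[symmetric] bilinear_def
  by (auto intro!: linearI
      simp: vector_matrix_mult_def Finite_Cartesian_Product.vec_eq_iff sum.distrib distrib_right
        distrib_left sum_distrib_left mult_ac)

lemmas tendsto_matrix_vector_mult [tendsto_intros] =
  bounded_bilinear.tendsto[OF bounded_bilinear_matrix_vector_mult]

lemmas continuous_on_matrix_vector_mult [continuous_intros] =
  bounded_bilinear.continuous_on[OF bounded_bilinear_matrix_vector_mult]

lemmas continuous_on_matrix_matrix_mult [continuous_intros] =
  bounded_bilinear.continuous_on[OF bounded_bilinear_matrix_matrix_mult]

lemma mpow_scaleR: "mpow (t *\<^sub>R M) k = t ^ k *\<^sub>R mpow M k"
  by (induction k)
    (auto simp: bounded_bilinear.scaleR_left[OF bounded_bilinear_matrix_matrix_mult]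
      bounded_bilinear.scaleR_right[OF bounded_bilinear_matrix_matrix_mult])

text \<open>A geometric bound suffices for comparison with the real exponential series, so the
  constant \<open>K\<close> of the bilinear product may go into the base \<open>b\<close>.\<close>

lemma norm_mpow_bound:
  fixes M :: "real^'n^'n"
  obtains b c where "\<And>k. norm (mpow M k) \<le> c * b ^ k"
proof -
  obtain K where K: "\<And>A B. norm ((A::real^'n^'n) ** (B::real^'n^'n)) \<le> norm A * norm B * K" "K > 0"
    using bounded_bilinear.pos_bounded[OF bounded_bilinear_matrix_matrix_mult] by metis
  have "norm (mpow M k) \<le> norm (mpow M 0) * (norm M * K) ^ k" for k
  proof (induction k)
    case (Suc k)
    have "norm (mpow M (Suc k)) \<le> norm M * norm (mpow M k) * K" using K(1) by simp
    also have "\<dots> \<le> norm M * (norm (mpow M 0) * (norm M * K) ^ k) * K"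
      by (intro mult_right_mono mult_left_mono Suc) (use K(2) in auto)
    finally show ?case by (simp add: mult_ac)
  qed simp
  then show ?thesis using that by blast
qed

lemma summable_mexp: "summable (\<lambda>k. (1 / fact k) *\<^sub>R mpow (M::real^'n^'n) k)"
proof -
  obtain b c where bc: "\<And>k. norm (mpow M k) \<le> c * b ^ k" using norm_mpow_bound by blast
  have "summable (\<lambda>k. c * (b ^ k /\<^sub>R fact k))"
    by (intro summable_mult) (rule sums_summable[OF exp_converges])
  then show ?thesis
  proof (rule summable_comparison_test')
    show "norm ((1 / fact k) *\<^sub>R mpow M k) \<le> c * (b ^ k /\<^sub>R fact k)" for k
      using bc[of k] by (simp add: divide_right_mono field_simps)
  qed
qed

text \<open>Each entry of \<open>mexp (t *\<^sub>R M)\<close> is a power series in \<open>t\<close>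
  that converges everywhere.\<close>

lemma continuous_mexp: "continuous_on UNIV (\<lambda>t. mexp (t *\<^sub>R (M::real^'n^'n)))"
proof -
  have lin: "bounded_linear (\<lambda>X::real^'n^'n. X $ i $ j)" for i j
    by (rule bounded_linear_compose[OF bounded_linear_vec_nth bounded_linear_vec_nth])
  define c where "c = (\<lambda>i j k. (1 / fact k) * mpow M k $ i $ j)"
  have *: "(1 / fact k) *\<^sub>R mpow (t *\<^sub>R M) k $ i $ j = c i j k * t ^ k" for t i j k
    by (simp add: c_def mpow_scaleR)
  have sm: "summable (\<lambda>k. c i j k * t ^ k)" for i j t
    using bounded_linear.summable[OF lin[of i j] summable_mexp[of "t *\<^sub>R M"]] *[of _ t i j] by simp
  have "mexp (t *\<^sub>R M) $ i $ j = (\<Sum>k. c i j k * t ^ k)" for t i j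
    using bounded_linear.suminf[OF lin[of i j] summable_mexp[of "t *\<^sub>R M"]] *[of _ t i j]
    by (simp add: mexp_def)
  then have eq: "(\<lambda>t. mexp (t *\<^sub>R M)) = (\<lambda>t. \<chi> i j. \<Sum>k. c i j k * t ^ k)"
    by (simp add: fun_eq_iff Finite_Cartesian_Product.vec_eq_iff)
  have "continuous_on UNIV (\<lambda>t. \<Sum>k. c i j k * t ^ k)" for i j
    by (simp add: continuous_on_eq_continuous_at isCont_powser_converges_everywhere sm)
  then show ?thesis unfolding eq by (intro continuous_on_vec_lambda)
qed

lemma continuous_mexp_int: "continuous_on UNIV (\<lambda>h. mexp_int (M::real^'n^'n) h)"
proof -
  have "isCont (mexp_int M) h" for h
  proof -
    \<comment> \<open>The fundamental theorem is applied on a compact interval; this one has both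
      \<open>0\<close> and \<open>h\<close> in its interior.\<close>
    define r where "r = \<bar>h\<bar> + 1"
    have "((\<lambda>u. LBINT y=ereal 0..ereal u. mexp (y *\<^sub>R M)) has_vector_derivative mexp (h *\<^sub>R M))
        (at h within {- r..r})"
      by (rule interval_integral_FTC2)
        (auto simp: r_def intro: continuous_on_subset[OF continuous_mexp])
    then have "continuous (at h within {-r..r}) (\<lambda>u. LBINT y=ereal 0..ereal u. mexp (y *\<^sub>R M))"
      by (rule has_vector_derivative_continuous)
    then have "continuous (at h within {-r..r}) (mexp_int M)"
      by (simp add: mexp_int_def[abs_def] zero_ereal_def)
    then show ?thesis
      using continuous_within_subset[of h "{-r..r}" "mexp_int M" "{-r<..<r}"]
        continuous_within_open[of h "{-r<..<r}" "mexp_int M"] by (force simp: r_def)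
  qed
  then show ?thesis by (simp add: continuous_on_eq_continuous_at)
qed

lemma continuous_step_len: "continuous_on UNIV (step_len P)"
  unfolding step_len_def[abs_def] divide_inverse by (intro continuous_intros)

lemma continuous_A_mat: "continuous_on UNIV (A_mat P)"
  unfolding A_mat_def[abs_def]
  by (rule continuous_on_compose2[OF continuous_mexp continuous_step_len]) auto

lemma continuous_B_mat: "continuous_on UNIV (B_mat P)"
  unfolding B_mat_def[abs_def]
  by (intro continuous_intros continuous_on_compose2[OF continuous_mexp_int continuous_step_len]) auto

lemma continuous_x_init: "continuous_on UNIV (x_init P)"
  unfolding x_init_def[abs_def]
  by (intro continuous_intros continuous_mexp continuous_mexp_int)

section \<open>Shifting the eigenvalues of a Jordan decomposition\<close>

text \<open>Every diagonal entry of a Jordan matrix is the eigenvalue of its block, so the shift can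
  be read off the matrix itself, without reference to block boundaries.\<close>

lemma jordan_matrix_shift_index:
  fixes f :: "'a::comm_ring_1 \<Rightarrow> 'a"
  assumes "i < sum_list (map fst bs)" "j < sum_list (map fst bs)"
  shows "jordan_matrix (map (\<lambda>(n, a). (n, a + f a)) bs) $$ (i, j) =
    jordan_matrix bs $$ (i, j) + (if i = j then f (jordan_matrix bs $$ (i, i)) else 0)"
  using assms
proof (induction bs arbitrary: i j)
  case (Cons b bs)
  obtain n a where b: "b = (n, a)" by force
  show ?case using Cons.prems Cons.IH[of "i - n" "j - n"]
    by (auto simp: b jordan_matrix_Cons comp_def case_prod_unfold)
qed simp

text \<open>Following the superdiagonal never changes the eigenvalue; this carries the inequality of
  eigenvalues through the induction in \<open>jordan_intertwiner_index\<close>.\<close>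

lemma jordan_matrix_offdiag:
  fixes bs :: "(nat \<times> 'a::{zero,one}) list"
  assumes "i < sum_list (map fst bs)" "j < sum_list (map fst bs)"
    and "i \<noteq> j" "jordan_matrix bs $$ (i, j) \<noteq> 0"
  shows "j = Suc i \<and> jordan_matrix bs $$ (i, i) = jordan_matrix bs $$ (j, j)"
  using assms
proof (induction bs arbitrary: i j)
  case (Cons b bs)
  obtain n a where b: "b = (n, a)" by force
  show ?case using Cons.prems Cons.IH[of "i - n" "j - n"]
    by (auto simp: b jordan_matrix_Cons eq_diff_iff Suc_diff_le[symmetric] not_less split: if_splits)
qed simp

lemma index_mult_mat_sum:
  assumes "A \<in> carrier_mat n n" "B \<in> carrier_mat n n" "i < n" "j < n"
  shows "(A * B) $$ (i, j) = (\<Sum>k<n. A $$ (i, k) * B $$ (k, j))"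
  using assms by (simp add: scalar_prod_def atLeast0LessThan)

text \<open>Uniqueness for the Sylvester equation in entries: an intertwiner cannot connect
  generalized eigenspaces of different eigenvalues. By induction only the diagonal factor survives
  in entry \<open>(r, c)\<close> of either product.\<close>

lemma jordan_intertwiner_index:
  fixes T :: "'a::idom mat"
  assumes dim: "sum_list (map fst bs) = n" "sum_list (map fst bs') = n"
    and T: "T \<in> carrier_mat n n"
    and comm: "jordan_matrix bs * T = T * jordan_matrix bs'"
    and "r < n" "c < n"
    and "jordan_matrix bs $$ (r, r) \<noteq> jordan_matrix bs' $$ (c, c)"
  shows "T $$ (r, c) = 0"
  using assms(5-)
\<comment> \<open>The superdiagonals lead to the entries \<open>(r + 1, c)\<close> and
  \<open>(r, c - 1)\<close>, both of smaller measure.\<close>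
proof (induction "n - r + c" arbitrary: r c rule: less_induct)
  case less
  define J where "J = jordan_matrix bs"
  define J' where "J' = jordan_matrix bs'"
  have J: "J \<in> carrier_mat n n" "J' \<in> carrier_mat n n" unfolding J_def J'_def using dim by auto
  have "(J * T) $$ (r, c) = (\<Sum>k<n. J $$ (r, k) * T $$ (k, c))"
    using J T less.prems by (intro index_mult_mat_sum)
  also have "\<dots> = (\<Sum>k\<in>{r}. J $$ (r, k) * T $$ (k, c))"
  proof (rule sum.mono_neutral_right)
    show "\<forall>k\<in>{..<n} - {r}. J $$ (r, k) * T $$ (k, c) = 0"
    proof
      fix k assume k: "k \<in> {..<n} - {r}"
      show "J $$ (r, k) * T $$ (k, c) = 0"
      proof (cases "J $$ (r, k) = 0")
        case False
        then have "k = Suc r" "J $$ (r, r) = J $$ (k, k)"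
          using jordan_matrix_offdiag[of r bs k] k less.prems dim unfolding J_def by auto
        then have "T $$ (k, c) = 0" using less k by (intro less.hyps) (auto simp: J_def)
        then show ?thesis by simp
      qed simp
    qed
  qed (use less.prems in auto)
  finally have 1: "(J * T) $$ (r, c) = J $$ (r, r) * T $$ (r, c)" by simp
  have "(T * J') $$ (r, c) = (\<Sum>k<n. T $$ (r, k) * J' $$ (k, c))"
    using J T less.prems by (intro index_mult_mat_sum)
  also have "\<dots> = (\<Sum>k\<in>{c}. T $$ (r, k) * J' $$ (k, c))"
  proof (rule sum.mono_neutral_right)
    show "\<forall>k\<in>{..<n} - {c}. T $$ (r, k) * J' $$ (k, c) = 0"
    proof
      fix k assume k: "k \<in> {..<n} - {c}"
      show "T $$ (r, k) * J' $$ (k, c) = 0"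
      proof (cases "J' $$ (k, c) = 0")
        case False
        then have "c = Suc k" "J' $$ (k, k) = J' $$ (c, c)"
          using jordan_matrix_offdiag[of k bs' c] k less.prems dim unfolding J'_def by auto
        then have "T $$ (r, k) = 0" using less k by (intro less.hyps) (auto simp: J'_def)
        then show ?thesis by simp
      qed simp
    qed
  qed (use less.prems in auto)
  finally have "(T * J') $$ (r, c) = T $$ (r, c) * J' $$ (c, c)" by simp
  with 1 comm have "(J $$ (r, r) - J' $$ (c, c)) * T $$ (r, c) = 0"
    by (simp add: J_def J'_def algebra_simps)
  then show ?case using less.prems by (simp add: J_def J'_def)
qed

definition diag_shift :: "nat \<Rightarrow> complex Matrix.mat \<Rightarrow> (complex \<Rightarrow> real) \<Rightarrow> complex Matrix.mat" where
  "diag_shift n J q = Matrix.mat n n (\<lambda>(i, j). if i = j then complex_of_real (q (J $$ (i, i))) else 0)"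

lemma diag_shift_carrier [simp]: "diag_shift n J q \<in> carrier_mat n n"
  by (simp add: diag_shift_def)

lemma jordan_decompositionD:
  fixes A :: "real^'n^'n"
  assumes "jordan_decomposition A Qi bs Q"
  shows "sum_list (map fst bs) = CARD('n)" "Qi \<in> carrier_mat CARD('n) CARD('n)"
    "Q \<in> carrier_mat CARD('n) CARD('n)" "Qi * Q = 1\<^sub>m CARD('n)" "Q * Qi = 1\<^sub>m CARD('n)"
    "cmat_of A = Qi * jordan_matrix bs * Q"
proof -
  have w: "similar_mat_wit (cmat_of A) (jordan_matrix bs) Qi Q"
    and dA: "dim_row (cmat_of A) = CARD('n)" 
    using assms by (auto simp: jordan_decomposition_def cmat_of_def)
  from similar_mat_witD[OF dA[symmetric] w]
  show "sum_list (map fst bs) = CARD('n)" "Qi \<in> carrier_mat CARD('n) CARD('n)"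
    "Q \<in> carrier_mat CARD('n) CARD('n)" "Qi * Q = 1\<^sub>m CARD('n)" "Q * Qi = 1\<^sub>m CARD('n)"
    "cmat_of A = Qi * jordan_matrix bs * Q" by auto
qed

lemma perturbed_eq:
  fixes A :: "real^'n^'n"
  assumes jd: "jordan_decomposition A Qi bs Q"
  shows "perturbed Qi bs Q q = cmat_of A + Qi * diag_shift CARD('n) (jordan_matrix bs) q * Q"
proof -
  define n where "n = CARD('n)"
  note D = jordan_decompositionD[OF jd, folded n_def]
  have sizes: "(\<Sum>(n, a)\<leftarrow>bs. n) = n" using D(1) by (simp add: case_prod_unfold)
  have "jordan_matrix (map (\<lambda>(n, a). (n, a + complex_of_real (q a))) bs) =
      jordan_matrix bs + diag_shift n (jordan_matrix bs) q"
    by (rule eq_matI)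
      (auto simp: jordan_matrix_shift_index[of _ _ _ "\<lambda>a. complex_of_real (q a)"] diag_shift_def D(1) sizes)
  moreover have "jordan_matrix bs \<in> carrier_mat n n" using D(1) by auto
  ultimately show ?thesis
    using D(2,3) by (simp add: perturbed_def D(6) n_def[symmetric] mult_add_distrib_mat[of _ n n]
      add_mult_distrib_mat[of _ n n])
qed

text \<open>The independence of the decomposition is what allows \<open>\<delta>\<close> to be chosen before it.\<close>

lemma perturbed_unique:
  fixes A :: "real^'n^'n"
  assumes jd: "jordan_decomposition A Qi bs Q" and jd': "jordan_decomposition A Qi' bs' Q'"
  shows "perturbed Qi bs Q q = perturbed Qi' bs' Q' q"
proof -
  define n where "n = CARD('n)"
  note D = jordan_decompositionD[OF jd, folded n_def]
  note D' = jordan_decompositionD[OF jd', folded n_def]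
  define J where "J = jordan_matrix bs"
  define J' where "J' = jordan_matrix bs'"
  define X where "X = diag_shift n J q"
  define X' where "X' = diag_shift n J' q"
  \<comment> \<open>The transition matrix between the two Jordan bases intertwines \<open>J\<close>
    and \<open>J'\<close>. As its entries between different eigenvalues vanish, it also intertwines
    diagonal matrices whose entries depend on the eigenvalue alone.\<close>
  define T where "T = Q * Qi'"
  have J: "J \<in> carrier_mat n n" "J' \<in> carrier_mat n n" using D(1) D'(1) by (auto simp: J_def J'_def)
  have X: "X \<in> carrier_mat n n" "X' \<in> carrier_mat n n" by (auto simp: X_def X'_def)
  have T: "T \<in> carrier_mat n n" using D D' by (auto simp: T_def)
  note C = D(2,3) D'(2,3) J X T
  note asc = assoc_mult_mat[of _ n n _ n _ n]
  have inv: "Q * (Qi * Y) = Y" "Qi' * (Q' * Y) = Y" "Q' * (Qi' * Y) = Y" "Qi * (Q * Y) = Y"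
    if "Y \<in> carrier_mat n n" for Y
    using that C D D' by (simp_all add: asc[symmetric])
  have "J * T = Q * cmat_of A * Qi'"
    using C by (simp add: D(6) T_def J_def[symmetric] asc inv)
  also have "\<dots> = T * J'"
    using C by (simp add: D'(6) T_def J'_def[symmetric] asc inv D'(5))
  finally have comm: "J * T = T * J'" .
  have "X * T = T * X'"
  proof (rule eq_matI)
    fix r c assume "r < dim_row (T * X')" "c < dim_col (T * X')"
    then have rc: "r < n" "c < n" using T X by auto
    have "(X * T) $$ (r, c) = (\<Sum>k<n. X $$ (r, k) * T $$ (k, c))"
      using X T rc by (intro index_mult_mat_sum)
    also have "\<dots> = (\<Sum>k<n. if k = r then complex_of_real (q (J $$ (r, r))) * T $$ (r, c) else 0)"
      using rc by (intro sum.cong) (auto simp: X_def diag_shift_def)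
    also have "\<dots> = complex_of_real (q (J $$ (r, r))) * T $$ (r, c)" using rc by simp
    also have "\<dots> = complex_of_real (q (J' $$ (c, c))) * T $$ (r, c)"
      using jordan_intertwiner_index[OF D(1) D'(1) T comm[unfolded J_def J'_def] rc]
      unfolding J_def J'_def by force
    also have "\<dots> = (\<Sum>k<n. if k = c then complex_of_real (q (J' $$ (c, c))) * T $$ (r, c) else 0)"
      using rc by simp
    also have "\<dots> = (\<Sum>k<n. T $$ (r, k) * X' $$ (k, c))"
      using rc by (intro sum.cong) (auto simp: X'_def diag_shift_def)
    also have "\<dots> = (T * X') $$ (r, c)"
      using X T rc by (intro index_mult_mat_sum[symmetric])
    finally show "(X * T) $$ (r, c) = (T * X') $$ (r, c)" .
  qed (use T X in auto)
  moreover have "Qi * X * Q = Qi * (X * T) * Q'"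
    using C D' by (simp add: T_def asc)
  moreover have "Qi * (T * X') * Q' = Qi' * X' * Q'"
    using C by (simp add: T_def asc inv)
  ultimately show ?thesis
    unfolding perturbed_eq[OF jd] perturbed_eq[OF jd'] by (simp add: X_def X'_def J_def J'_def n_def)
qed

text \<open>Similar matrices share the characteristic polynomial, whose roots for a triangular
  matrix are the diagonal entries. This lets sums over rows be grouped by elements of the
  spectrum.\<close>

lemma jordan_matrix_diag_spectrum:
  assumes jd: "jordan_decomposition (A::real^'n^'n) Qi bs Q" and r: "r < CARD('n)"
  shows "jordan_matrix bs $$ (r, r) \<in> spectrum (cmat_of A)"
proof -
  note D = jordan_decompositionD[OF jd]
  have cA: "cmat_of A \<in> carrier_mat CARD('n) CARD('n)" by (simp add: cmat_of_def)
  have cJ: "jordan_matrix bs \<in> carrier_mat CARD('n) CARD('n)" using D(1) by auto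
  have "similar_mat (cmat_of A) (jordan_matrix bs)"
    using jd by (auto simp: jordan_decomposition_def similar_mat_def)
  then have "char_poly (cmat_of A) = char_poly (jordan_matrix bs)" by (rule char_poly_similar)
  also have "\<dots> = (\<Prod>a\<leftarrow>diag_mat (jordan_matrix bs). [:- a, 1:])"
    by (rule char_poly_upper_triangular[OF cJ])
      (auto simp: D(1) upper_triangular_def intro: jordan_matrix_upper_triangular)
  finally have "poly (char_poly (cmat_of A)) (jordan_matrix bs $$ (r, r)) = 0"
    using r D(1) by (auto simp: poly_prod_list prod_list_zero_iff diag_mat_def image_iff)
  then show ?thesis unfolding spectrum_def using eigenvalue_root_char_poly[OF cA] by auto
qed

lemma perturbed_index:
  fixes A :: "real^'n^'n"
  assumes jd: "jordan_decomposition A Qi bs Q" and ij: "i < CARD('n)" "j < CARD('n)"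
  shows "perturbed Qi bs Q q $$ (i, j) = cmat_of A $$ (i, j) +
    (\<Sum>r<CARD('n). Qi $$ (i, r) * complex_of_real (q (jordan_matrix bs $$ (r, r))) * Q $$ (r, j))"
proof -
  define n where "n = CARD('n)"
  note D = jordan_decompositionD[OF jd, folded n_def]
  define X where "X = diag_shift n (jordan_matrix bs) q"
  have X: "X \<in> carrier_mat n n" by (simp add: X_def)
  have "(Qi * X) $$ (i, r) = Qi $$ (i, r) * complex_of_real (q (jordan_matrix bs $$ (r, r)))" if "r < n" for r
  proof -
    have "(Qi * X) $$ (i, r) = (\<Sum>k<n. Qi $$ (i, k) * X $$ (k, r))"
      using D X ij that by (simp add: scalar_prod_def atLeast0LessThan n_def)
    also have "\<dots> = (\<Sum>k<n. if k = r then
        Qi $$ (i, r) * complex_of_real (q (jordan_matrix bs $$ (r, r))) else 0)"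
      using that by (intro sum.cong) (auto simp: X_def diag_shift_def)
    finally show ?thesis using that by simp
  qed
  then have "(Qi * X * Q) $$ (i, j) =
      (\<Sum>r<n. Qi $$ (i, r) * complex_of_real (q (jordan_matrix bs $$ (r, r))) * Q $$ (r, j))"
    using D X ij by (subst index_mult_mat_sum[of _ n]) (auto simp: n_def)
  moreover have "(cmat_of A + Qi * X * Q) $$ (i, j) = cmat_of A $$ (i, j) + (Qi * X * Q) $$ (i, j)"
    using D(2,3) X ij by (intro index_add_mat) (auto simp: n_def)
  ultimately show ?thesis unfolding perturbed_eq[OF jd] by (simp add: X_def n_def)
qed

lemma to_nat_on_UNIV_less: "to_nat_on (UNIV::'n::finite set) i < CARD('n)"
  using to_nat_on_finite[of "UNIV::'n set"] by (auto simp: bij_betw_def)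

text \<open>\<open>E a\<close> is the entrywise real part of the spectral projection onto the
  generalized eigenspace of \<open>a\<close>; these projections add up to the identity. By
  \<open>perturbed_unique\<close> one family \<open>E\<close> serves all decompositions.\<close>

lemma perturbed_affine:
  fixes A :: "real^'n^'n"
  obtains E :: "complex \<Rightarrow> real^'n^'n"
  where "\<And>Qi bs Q q. jordan_decomposition A Qi bs Q \<Longrightarrow>
      Re_mat (perturbed Qi bs Q q) = A + (\<Sum>a\<in>spectrum (cmat_of A). q a *\<^sub>R E a)"
    and "\<And>Qi bs Q. jordan_decomposition A Qi bs Q \<Longrightarrow>
      (\<Sum>a\<in>spectrum (cmat_of A). E a) = Finite_Cartesian_Product.mat 1"
proof (cases "\<exists>Qi bs Q. jordan_decomposition A Qi bs Q")
  \<comment> \<open>Without any decomposition both claims are vacuous and \<open>E\<close> is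
    arbitrary.\<close>
  case True
  then obtain Qi bs Q where jd: "jordan_decomposition A Qi bs Q" by blast
  define S where "S = spectrum (cmat_of A)"
  define n where "n = CARD('n)"
  define J where "J = jordan_matrix bs"
  note D = jordan_decompositionD[OF jd, folded n_def]
  have "finite S" unfolding S_def
    by (rule card_finite_spectrum(1)[of _ n]) (simp add: cmat_of_def n_def)
  have JS: "J $$ (r, r) \<in> S" if "r < n" for r
    using jordan_matrix_diag_spectrum[OF jd] that by (simp add: S_def n_def J_def)
  define t :: "'n \<Rightarrow> nat" where "t = to_nat_on UNIV"
  have t: "t i < n" for i by (simp add: t_def n_def to_nat_on_UNIV_less)
  have t_inv: "from_nat_into UNIV (t i) = i" for i by (simp add: t_def)
  define E :: "complex \<Rightarrow> real^'n^'n" where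
    "E = (\<lambda>a. \<chi> i j. Re (\<Sum>r\<in>{r\<in>{..<n}. J $$ (r, r) = a}. Qi $$ (t i, r) * Q $$ (r, t j)))"
  have E: "(\<Sum>a\<in>S. q a * E a $ i $ j) =
      Re (\<Sum>r<n. Qi $$ (t i, r) * complex_of_real (q (J $$ (r, r))) * Q $$ (r, t j))" for q i j
  proof -
    have "(\<Sum>a\<in>S. q a * E a $ i $ j) = (\<Sum>a\<in>S. \<Sum>r\<in>{r\<in>{..<n}. J $$ (r, r) = a}.
        q (J $$ (r, r)) * Re (Qi $$ (t i, r) * Q $$ (r, t j)))"
      unfolding E_def by (simp add: sum_distrib_left)
    also have "\<dots> = (\<Sum>r<n. q (J $$ (r, r)) * Re (Qi $$ (t i, r) * Q $$ (r, t j)))"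
      using JS \<open>finite S\<close> by (intro sum.group) auto
    also have "\<dots> = Re (\<Sum>r<n. Qi $$ (t i, r) * complex_of_real (q (J $$ (r, r))) * Q $$ (r, t j))"
      unfolding Re_sum by (intro sum.cong) (auto simp: algebra_simps)
    finally show ?thesis .
  qed
  show ?thesis
  proof
    fix Qi' bs' Q' q assume "jordan_decomposition A Qi' bs' Q'"
    then have eq: "perturbed Qi' bs' Q' q = perturbed Qi bs Q q" using jd by (rule perturbed_unique)
    show "Re_mat (perturbed Qi' bs' Q' q) = A + (\<Sum>a\<in>spectrum (cmat_of A). q a *\<^sub>R E a)"
      unfolding eq S_def[symmetric]
      using E[of q] t t_inv perturbed_index[OF jd, folded n_def J_def, of "t _" "t _" q]
      by (simp add: Finite_Cartesian_Product.vec_eq_iff Re_mat_def t_def[symmetric] cmat_of_def n_def[symmetric])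
  next
    have "(\<Sum>a\<in>S. E a $ i $ j) = (Finite_Cartesian_Product.mat 1 :: real^'n^'n) $ i $ j" for i j
    proof -
      have "(\<Sum>a\<in>S. E a $ i $ j) = Re (\<Sum>r<n. Qi $$ (t i, r) * Q $$ (r, t j))"
        using E[of "\<lambda>_. 1" i j] by simp
      also have "\<dots> = Re ((Qi * Q) $$ (t i, t j))"
        using D t by (subst index_mult_mat_sum[of _ n]) auto
      also have "\<dots> = (if t i = t j then 1 else 0)" using t by (simp add: D(4))
      also have "(t i = t j) = (i = j)" by (metis t_inv)
      finally show ?thesis by (simp add: Finite_Cartesian_Product.mat_def)
    qed
    then show "(\<Sum>a\<in>spectrum (cmat_of A). E a) = Finite_Cartesian_Product.mat 1"
      by (simp add: Finite_Cartesian_Product.vec_eq_iff S_def)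
  qed
qed blast

lemma spectrum_cmat_of:
  fixes A :: "real^'n^'n"
  shows "finite (spectrum (cmat_of A))" "spectrum (cmat_of A) \<noteq> {}"
  using card_finite_spectrum(1)[of "cmat_of A" "CARD('n)"] spectrum_non_empty[of "cmat_of A" "CARD('n)"]
  by (auto simp: cmat_of_def)

text \<open>Conjugating an eigenvector of a real matrix gives one for the conjugate eigenvalue.
  Hence on the spectrum \<open>tie_conjugates q\<close> reads only coordinates of \<open>q\<close>
  that belong to the spectrum.\<close>

lemma cnj_spectrum:
  fixes A :: "real^'n^'n"
  assumes "a \<in> spectrum (cmat_of A)"
  shows "cnj a \<in> spectrum (cmat_of A)"
proof -
  define n where "n = CARD('n)"
  have cA: "cmat_of A \<in> carrier_mat n n" by (simp add: cmat_of_def n_def)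
  obtain v where v: "v \<in> carrier_vec n" "v \<noteq> 0\<^sub>v n" "cmat_of A *\<^sub>v v = a \<cdot>\<^sub>v v"
    using assms cA by (auto simp: spectrum_def eigenvalue_def eigenvector_def)
  define w where "w = map_vec cnj v"
  have "w \<in> carrier_vec n" using v by (simp add: w_def)
  moreover have "w \<noteq> 0\<^sub>v n"
  proof
    assume w0: "w = 0\<^sub>v n"
    have "v = 0\<^sub>v n"
    proof (rule eq_vecI)
      fix i assume "i < dim_vec (0\<^sub>v n :: complex vec)"
      then have "cnj (vec_index v i) = 0" using w0 v unfolding w_def
        by (metis carrier_vecD dim_vec index_map_vec(1) index_zero_vec(1) zero_vec_def)
      then show "vec_index v i = vec_index (0\<^sub>v n) i" using \<open>i < dim_vec (0\<^sub>v n :: complex vec)\<close> by simp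
    qed (use v in auto)
    with v show False by simp
  qed
  moreover have "cmat_of A *\<^sub>v w = cnj a \<cdot>\<^sub>v w"
  proof (rule eq_vecI)
    fix i assume "i < dim_vec (cnj a \<cdot>\<^sub>v w)"
    then have i: "i < n" using v by (simp add: w_def)
    have real: "cnj (cmat_of A $$ (i, j)) = cmat_of A $$ (i, j)" if "j < n" for j
      using that i by (simp add: cmat_of_def n_def)
    have "vec_index (cmat_of A *\<^sub>v w) i = (\<Sum>j<n. cmat_of A $$ (i, j) * cnj (vec_index v j))"
      using cA v i by (simp add: w_def scalar_prod_def atLeast0LessThan)
    also have "\<dots> = cnj (\<Sum>j<n. cmat_of A $$ (i, j) * vec_index v j)"
      using real by simp
    also have "(\<Sum>j<n. cmat_of A $$ (i, j) * vec_index v j) = vec_index (cmat_of A *\<^sub>v v) i"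
      using cA v(1) i by (simp add: scalar_prod_def atLeast0LessThan)
    finally show "vec_index (cmat_of A *\<^sub>v w) i = vec_index (cnj a \<cdot>\<^sub>v w) i"
      using v(1,3) i by (simp add: w_def)
  qed (use cA v in \<open>auto simp: w_def\<close>)
  ultimately show ?thesis
    using cA by (auto simp: spectrum_def eigenvalue_def eigenvector_def)
qed

section \<open>Generic rank of powers\<close>

inductive poly_fun :: "'i set \<Rightarrow> (('i \<Rightarrow> real) \<Rightarrow> real) \<Rightarrow> bool" for S where
  const: "poly_fun S (\<lambda>_. c)"
| coord: "a \<in> S \<Longrightarrow> poly_fun S (\<lambda>q. q a)"
| add: "poly_fun S f \<Longrightarrow> poly_fun S g \<Longrightarrow> poly_fun S (\<lambda>q. f q + g q)"
| mult: "poly_fun S f \<Longrightarrow> poly_fun S g \<Longrightarrow> poly_fun S (\<lambda>q. f q * g q)"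

lemma poly_fun_sum: "(\<And>i. i \<in> I \<Longrightarrow> poly_fun S (f i)) \<Longrightarrow> poly_fun S (\<lambda>q. \<Sum>i\<in>I. f i q)"
  by (induction I rule: infinite_finite_induct) (auto intro: poly_fun.intros)

lemma poly_fun_prod: "(\<And>i. i \<in> I \<Longrightarrow> poly_fun S (f i)) \<Longrightarrow> poly_fun S (\<lambda>q. \<Prod>i\<in>I. f i q)"
  by (induction I rule: infinite_finite_induct) (auto intro: poly_fun.intros)

lemma poly_fun_det:
  "(\<And>i j. poly_fun S (\<lambda>q. M q $ i $ j)) \<Longrightarrow> poly_fun S (\<lambda>q. Determinants.det (M q))"
  unfolding Determinants.det_def by (intro poly_fun_sum poly_fun_prod poly_fun.intros)

lemma poly_fun_matrix_mult:
  assumes "\<And>i j. poly_fun S (\<lambda>q. M q $ i $ j)" "\<And>i j. poly_fun S (\<lambda>q. L q $ i $ j)"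
  shows "poly_fun S (\<lambda>q. (M q ** L q) $ i $ j)"
  unfolding matrix_matrix_mult_def using assms by (auto intro!: poly_fun_sum poly_fun.intros)

lemma poly_fun_mpow:
  assumes "\<And>i j. poly_fun S (\<lambda>q. M q $ i $ j)"
  shows "poly_fun S (\<lambda>q. mpow (M q) k $ i $ j)"
proof (induction k arbitrary: i j)
  case 0
  show ?case by (simp add: poly_fun.const)
next
  case (Suc k)
  show ?case using poly_fun_matrix_mult[OF assms Suc] by simp
qed

lemma poly_fun_measurable: "poly_fun S f \<Longrightarrow> f \<in> borel_measurable (Pi\<^sub>M S (\<lambda>_. lborel))"
proof (induction rule: poly_fun.induct)
  case (coord a)
  then have "(\<lambda>q. q a) \<in> measurable (Pi\<^sub>M S (\<lambda>_. lborel)) (lborel :: real measure)"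
    by (rule measurable_component_singleton)
  then show ?case by simp
qed auto

lemma poly_fun_slice: "poly_fun S f \<Longrightarrow> \<exists>p. \<forall>t. f (x(a := t)) = poly p t"
proof (induction rule: poly_fun.induct)
  case (const c)
  show ?case by (rule exI[of _ "[:c:]"]) simp
next
  case (coord b)
  show ?case by (cases "b = a") (auto intro: exI[of _ "[:0, 1:]"] exI[of _ "[:x b:]"])
next
  case (add f g)
  then obtain p p' where "\<forall>t. f (x(a := t)) = poly p t" "\<forall>t. g (x(a := t)) = poly p' t" by blast
  then show ?case by (metis poly_add)
next
  case (mult f g)
  then obtain p p' where "\<forall>t. f (x(a := t)) = poly p t" "\<forall>t. g (x(a := t)) = poly p' t" by blast
  then show ?case by (metis poly_mult)
qed

lemma poly_fun_fix_coord: "poly_fun (insert a S) f \<Longrightarrow> poly_fun S (\<lambda>x. f (x(a := t)))"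
proof (induction rule: poly_fun.induct)
  case (coord b)
  then show ?case by (cases "b = a") (auto intro: poly_fun.intros)
qed (auto intro: poly_fun.intros)

text \<open>Induction over the coordinates with Fubini: for almost all values of the other
  coordinates the slice in direction \<open>a\<close> is a nonzero polynomial in one variable, hence
  has finitely many roots.\<close>

lemma poly_fun_AE_nonzero:
  assumes "finite S" "poly_fun S f" "x \<in> extensional S" "f x \<noteq> 0"
  shows "AE q in Pi\<^sub>M S (\<lambda>_. lborel). f q \<noteq> 0"
  using assms
proof (induction S arbitrary: f x rule: finite_induct)
  case empty
  have "AE q in Pi\<^sub>M {} (\<lambda>_. lborel). q = x"
    using empty.prems by (intro AE_I2) (auto simp: space_PiM)
  then show ?case by eventually_elim (use empty.prems in simp)
next
  case (insert a S)
  interpret product_sigma_finite "\<lambda>_. lborel :: real measure" by standard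
  have "AE y in Pi\<^sub>M S (\<lambda>_. lborel). f (y(a := x a)) \<noteq> 0"
    using insert.prems insert.hyps
    by (intro insert.IH[where x="x(a := undefined)"] poly_fun_fix_coord)
      (auto simp: extensional_def fun_upd_idem_iff simp del: fun_upd_apply, auto)
  then have slice: "AE y in Pi\<^sub>M S (\<lambda>_. lborel).
      (\<integral>\<^sup>+ t. indicator {q. f q = 0} (y(a := t)) \<partial>lborel) = 0"
  proof (eventually_elim)
    case (elim y)
    obtain p where p: "\<And>t. f (y(a := t)) = poly p t"
      using poly_fun_slice[OF insert.prems(1)] by blast
    with elim have "p \<noteq> 0" by auto
    then have "countable {t. poly p t = 0}"
      using poly_roots_finite countable_finite by blast
    then have "AE t in lborel. t \<notin> {t. poly p t = 0}"
      by (intro AE_not_in countable_imp_null_set_lborel)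
    then have "AE t in lborel. indicator {q. f q = 0} (y(a := t)) = (0::ennreal)"
      by eventually_elim (simp add: p)
    then show ?case using nn_integral_cong_AE[of _ "\<lambda>_. 0"] by fastforce
  qed
  have meas: "(\<lambda>q. indicator {q. f q = 0} q) \<in> borel_measurable (Pi\<^sub>M (insert a S) (\<lambda>_. lborel))"
    using poly_fun_measurable[OF insert.prems(1)] by measurable
  have "(\<integral>\<^sup>+ q. indicator {q. f q = 0} q \<partial>Pi\<^sub>M (insert a S) (\<lambda>_. lborel)) = 0"
    using product_nn_integral_insert[OF insert.hyps meas] nn_integral_cong_AE[OF slice] by simp
  then have "AE q in Pi\<^sub>M (insert a S) (\<lambda>_. lborel). indicator {q. f q = 0} q = (0::ennreal)"
    using nn_integral_0_iff_AE[OF meas] by simp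
  then show ?case by eventually_elim (auto split: split_indicator_asm)
qed

section \<open>The Gram matrix as a test for joint full rank\<close>

definition gram :: "'i set \<Rightarrow> ('i \<Rightarrow> real^'u^'x) \<Rightarrow> real^'x^'x" where
  "gram K M = (\<Sum>k\<in>K. M k ** Finite_Cartesian_Product.transpose (M k))"

lemma gram_mult:
  "gram K M *v z =
    (\<Sum>k\<in>K. M k *v (Finite_Cartesian_Product.transpose (M k) *v z))"
proof (cases "finite K")
  case True
  then show ?thesis unfolding gram_def
    by (induction K) (auto simp: matrix_vector_mult_add_rdistrib matrix_vector_mul_assoc simp del: transpose_matrix_vector)
qed (simp add: gram_def)

text \<open>The quadratic form of the Gram matrix is the sum of the squared norms of the vectors
  \<open>transpose (M k) *v z\<close>, so its kernel is their common kernel. One determinant thus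
  replaces the maximal minors of the block matrix.\<close>

lemma gram_det_nonzero:
  assumes "finite K"
    and "\<And>z. (\<And>k. k \<in> K \<Longrightarrow> Finite_Cartesian_Product.transpose (M k) *v z = 0) \<Longrightarrow> z = 0"
  shows "Determinants.det (gram K M) \<noteq> 0"
proof -
  have "z = 0" if z: "gram K M *v z = 0" for z
  proof (rule assms(2))
    fix k assume k: "k \<in> K"
    let ?T = "\<lambda>k. Finite_Cartesian_Product.transpose (M k)"
    have "0 = z \<bullet> (gram K M *v z)" using z by simp
    also have "\<dots> = (\<Sum>k\<in>K. (?T k *v z) \<bullet> (?T k *v z))"
      unfolding gram_mult inner_sum_right
      by (intro sum.cong refl) (metis dot_lmul_matrix inner_commute vector_transpose_matrix transpose_matrix_vector)
    finally have "(\<Sum>k\<in>K. (?T k *v z) \<bullet> (?T k *v z)) = 0" by simp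
    then show "?T k *v z = 0"
      using k assms(1) by (subst (asm) sum_nonneg_eq_0_iff) auto
  qed
  then have "invertible (gram K M)"
    unfolding invertible_left_inverse matrix_left_invertible_ker by auto
  then show ?thesis by (simp add: invertible_det_nz)
qed

text \<open>If \<open>z\<close> is the preimage of \<open>y\<close> under the Gram matrix, the
  vectors \<open>transpose (M k) *v z\<close> form the least-norm solution.\<close>

lemma gram_surj:
  assumes "Determinants.det (gram K M) \<noteq> 0"
  obtains v where "(\<Sum>k\<in>K. M k *v v k) = y"
proof -
  obtain z where "gram K M *v z = y"
    using assms unfolding invertible_det_nz[symmetric] invertible_right_inverse
      matrix_right_invertible_surjective by (metis surjD)
  then show ?thesis using that[of "\<lambda>k. Finite_Cartesian_Product.transpose (M k) *v z"]
    by (simp add: gram_mult)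
qed

section \<open>Powers of a shifted matrix and binomial combinations\<close>

lemma mpow_add_scaleR_mat1:
  "mpow (A + R *\<^sub>R Finite_Cartesian_Product.mat 1) k =
    (\<Sum>l\<le>k. (real (k choose l) * R ^ (k - l)) *\<^sub>R mpow A l)"
proof (induction k)
  case (Suc k)
  \<comment> \<open>The coefficients are extended by zero beyond \<open>l = k\<close>, so that
    Pascal's rule holds for the top term as well.\<close>
  define c where "c k l = (if l \<le> k then real (k choose l) * R ^ (k - l) else 0)" for k l
  have c: "(\<Sum>l\<le>k. (real (k choose l) * R ^ (k - l)) *\<^sub>R mpow A l) = (\<Sum>l\<le>k. c k l *\<^sub>R mpow A l)" for k
    by (intro sum.cong) (auto simp: c_def)
  have A: "A ** (\<Sum>l\<le>k. c k l *\<^sub>R mpow A l) = (\<Sum>l\<le>k. c k l *\<^sub>R mpow A (Suc l))"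
    by (simp add: bounded_bilinear.sum_right[OF bounded_bilinear_matrix_matrix_mult]
        bounded_bilinear.scaleR_right[OF bounded_bilinear_matrix_matrix_mult])
  have "mpow (A + R *\<^sub>R Finite_Cartesian_Product.mat 1) (Suc k) =
      (A + R *\<^sub>R Finite_Cartesian_Product.mat 1) ** (\<Sum>l\<le>k. c k l *\<^sub>R mpow A l)"
    using Suc c by simp
  also have "\<dots> = (\<Sum>l\<le>k. c k l *\<^sub>R mpow A (Suc l)) + (\<Sum>l\<le>k. (R * c k l) *\<^sub>R mpow A l)"
    by (simp add: bounded_bilinear.add_left[OF bounded_bilinear_matrix_matrix_mult]
        bounded_bilinear.scaleR_left[OF bounded_bilinear_matrix_matrix_mult] A scaleR_sum_right)
  also have "(\<Sum>l\<le>k. (R * c k l) *\<^sub>R mpow A l) = (\<Sum>l\<le>Suc k. (R * c k l) *\<^sub>R mpow A l)"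
    by (simp add: c_def)
  also have "\<dots> = (R * c k 0) *\<^sub>R mpow A 0 + (\<Sum>l\<le>k. (R * c k (Suc l)) *\<^sub>R mpow A (Suc l))"
    by (rule sum.atMost_Suc_shift)
  also have "(\<Sum>l\<le>k. c k l *\<^sub>R mpow A (Suc l)) + \<dots> =
      (R * c k 0) *\<^sub>R mpow A 0 + (\<Sum>l\<le>k. (c k l + R * c k (Suc l)) *\<^sub>R mpow A (Suc l))"
    by (simp add: sum.distrib scaleR_left_distrib)
  also have "R * c k 0 = c (Suc k) 0" by (simp add: c_def)
  also have "(\<Sum>l\<le>k. (c k l + R * c k (Suc l)) *\<^sub>R mpow A (Suc l)) =
      (\<Sum>l\<le>k. c (Suc k) (Suc l) *\<^sub>R mpow A (Suc l))"
  proof (intro sum.cong refl)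
    fix l assume "l \<in> {..k}"
    then consider "l = k" | "Suc l \<le> k" by force
    then have "c k l + R * c k (Suc l) = c (Suc k) (Suc l)"
    proof cases
      case 2
      then have "k - l = Suc (k - Suc l)" by simp
      with 2 show ?thesis by (simp add: c_def algebra_simps)
    qed (simp add: c_def)
    then show "(c k l + R * c k (Suc l)) *\<^sub>R mpow A (Suc l) = c (Suc k) (Suc l) *\<^sub>R mpow A (Suc l)"
      by simp
  qed
  also have "c (Suc k) 0 *\<^sub>R mpow A 0 + \<dots> = (\<Sum>l\<le>Suc k. c (Suc k) l *\<^sub>R mpow A l)"
    by (rule sum.atMost_Suc_shift[symmetric])
  finally show ?case by (simp only: c)
qed simp

text \<open>As a function of \<open>k\<close> the combination is a polynomial of degree below
  \<open>n\<close> in Newton form, and it has the \<open>n\<close> roots \<open>K\<close>. The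
  points of \<open>K\<close> need not be consecutive.\<close>

lemma binomial_combination_zero:
  fixes w :: "nat \<Rightarrow> real"
  assumes "finite K" "card K = n" and zero: "\<And>k. k \<in> K \<Longrightarrow> (\<Sum>l<n. real (k choose l) * w l) = 0"
    and "l < n"
  shows "w l = 0"
proof -
  define p where "p = (\<Sum>l<n. Polynomial.smult (w l / fact l) (\<Prod>i=0..<l. [:- real i, 1:]))"
  have p: "poly p (real k) = (\<Sum>l<n. real (k choose l) * w l)" for k
    unfolding p_def poly_sum
    by (intro sum.cong)
      (auto simp: poly_prod binomial_gbinomial gbinomial_prod_rev field_simps)
  have "degree p \<le> n - 1" unfolding p_def
  proof (intro degree_sum_le)
    fix l assume "l \<in> {..<n}"
    have "degree (Polynomial.smult (w l / fact l) (\<Prod>i=0..<l. [:- real i, 1:])) \<le> degree (\<Prod>i=0..<l. [:- real i, 1:])"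
      by (rule degree_smult_le)
    also have "\<dots> \<le> (\<Sum>i=0..<l. degree [:- real i, 1:])" using degree_prod_sum_le[of "{0..<l}" "\<lambda>i. [:- real i, 1:]"] by (simp add: comp_def)
    finally show "degree (Polynomial.smult (w l / fact l) (\<Prod>i=0..<l. [:- real i, 1:])) \<le> n - 1"
      using \<open>l \<in> {..<n}\<close> by simp
  qed simp
  have "p = 0"
  proof (rule ccontr)
    assume "p \<noteq> 0"
    have "real ` K \<subseteq> {x. poly p x = 0}" using zero p by auto
    then have "card (real ` K) \<le> card {x. poly p x = 0}"
      using poly_roots_finite[OF \<open>p \<noteq> 0\<close>] by (intro card_mono)
    also have "\<dots> \<le> degree p" by (rule poly_roots_degree[OF \<open>p \<noteq> 0\<close>])
    finally have "n \<le> degree p" using assms(2) by (simp add: card_image)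
    with \<open>degree p \<le> n - 1\<close> \<open>l < n\<close> show False by simp
  qed
  \<comment> \<open>The zero polynomial also vanishes at \<open>0\<close>, ...,
    \<open>n - 1\<close>, where the system for \<open>w\<close> is unitriangular.\<close>
  show ?thesis using \<open>l < n\<close>
  proof (induction l rule: less_induct)
    case (less l)
    have "0 = (\<Sum>l'<n. real (l choose l') * w l')" using p[of l] \<open>p = 0\<close> by simp
    also have "\<dots> = (\<Sum>l'\<in>{l}. real (l choose l') * w l')"
    proof (rule sum.mono_neutral_right)
      show "\<forall>i\<in>{..<n} - {l}. real (l choose i) * w i = 0"
      proof
        fix i assume i: "i \<in> {..<n} - {l}"
        show "real (l choose i) * w i = 0"
        proof (cases "i < l")
          case True with less i show ?thesis by simp
        next
          case False with i have "l < i" by auto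
          then show ?thesis by (simp add: binomial_eq_0)
        qed
      qed
    qed (use less in auto)
    finally show ?case by simp
  qed
qed

lemma to_nat_on_from_nat_into:
  "l < CARD('n) \<Longrightarrow> to_nat_on (UNIV::'n::finite set) (from_nat_into UNIV l) = l"
  using to_nat_on_finite[of "UNIV::'n set"]
  by (simp add: bij_betw_def)

text \<open>Quantitative form of the preceding uniqueness: the square matrix of binomial
  coefficients is injective, hence bounded below. It is applied to combinations that are only small
  because a tail has been cut off.\<close>

lemma binomial_combination_bound:
  assumes K: "finite K" "card K = CARD('x::finite)"
  obtains C where "C \<ge> 0" "\<And>w e l. l < CARD('x) \<Longrightarrow>
    (\<And>k. k \<in> K \<Longrightarrow> \<bar>\<Sum>l<CARD('x). real (k choose l) * w l\<bar> \<le> e) \<Longrightarrow> \<bar>w l\<bar> \<le> C * e"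
proof -
  let ?n = "CARD('x)"
  define t :: "'x \<Rightarrow> nat" where "t = to_nat_on UNIV"
  have bij: "bij_betw t UNIV {..<?n}"
    using to_nat_on_finite[of "UNIV::'x set"] by (simp add: t_def atLeast0LessThan)
  obtain h where h: "bij_betw h (UNIV::'x set) K"
    using finite_same_card_bij[of "UNIV::'x set" K] K by auto
  define M :: "real^'x^'x" where "M = (\<chi> i j. real (h i choose t j))"
  have reidx: "(\<Sum>j\<in>UNIV. f (t j)) = (\<Sum>l<?n. f l)" for f :: "nat \<Rightarrow> real"
    by (rule sum.reindex_bij_betw[OF bij])
  define s where "s = the_inv_into UNIV t"
  have st: "s (t j) = j" for j
    using bij by (simp add: s_def bij_betw_def the_inv_into_f_f)
  have M: "(M *v v) $ i = (\<Sum>l<?n. real (h i choose l) * v $ s l)" for v i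
    using reidx[of "\<lambda>l. real (h i choose l) * v $ s l"]
    by (simp add: M_def matrix_vector_mult_def st)
  have "v = 0" if "M *v v = 0" for v
  proof -
    have "v $ s l = 0" if "l < ?n" for l
    proof (rule binomial_combination_zero[OF K _ that])
      fix k assume "k \<in> K"
      then obtain i where "k = h i" using h by (metis bij_betw_imp_surj_on imageE)
      then show "(\<Sum>l<?n. real (k choose l) * v $ s l) = 0"
        using M[of v i] \<open>M *v v = 0\<close> by simp
    qed
    then have "v $ j = 0" for j
      using bij_betwE[OF bij] st[of j] by (metis UNIV_I lessThan_iff)
    then show ?thesis by (simp add: Finite_Cartesian_Product.vec_eq_iff)
  qed
  then have "inj ((*v) M)"
    by (metis matrix_left_invertible_injective matrix_left_invertible_ker)
  then obtain B where B: "B > 0" "\<And>v. B * norm v \<le> norm (M *v v)"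
    using linear_inj_bounded_below_pos[of "(*v) M"] by auto
  show ?thesis
  \<comment> \<open>Here \<open>1 / B\<close> bounds the inverse, and the norm of the image is at
    most the sum of its \<open>?n\<close> entries, each at most \<open>e\<close>.\<close>
  proof (rule that[of "real ?n / B"])
    fix w e l
    assume l: "l < ?n" and e: "\<And>k. k \<in> K \<Longrightarrow> \<bar>\<Sum>l<?n. real (k choose l) * w l\<bar> \<le> e"
    define v :: "real^'x" where "v = (\<chi> j. w (t j))"
    obtain j where j: "l = t j" using l bij by (metis bij_betw_imp_surj_on imageE lessThan_iff)
    have vs: "v $ s l = w l" if "l < ?n" for l
      using that bij st unfolding v_def by (metis bij_betw_imp_surj_on imageE lessThan_iff vec_lambda_beta)
    have "B * \<bar>w l\<bar> \<le> B * norm v"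
      using component_le_norm_cart[of v j] B(1) j by (simp add: v_def)
    also have "\<dots> \<le> norm (M *v v)" by (rule B(2))
    also have "\<dots> \<le> (\<Sum>i\<in>UNIV. \<bar>(M *v v) $ i\<bar>)" by (rule norm_le_l1_cart)
    also have "\<dots> \<le> (\<Sum>i\<in>(UNIV::'x set). e)"
    proof (intro sum_mono)
      fix i
      have "(M *v v) $ i = (\<Sum>l<?n. real (h i choose l) * w l)"
        unfolding M by (intro sum.cong refl) (simp add: vs)
      then show "\<bar>(M *v v) $ i\<bar> \<le> e" using e[of "h i"] h by (auto simp: bij_betw_def)
    qed
    finally show "\<bar>w l\<bar> \<le> real ?n / B * e" using B(1) by (simp add: field_simps)
  qed (use B(1) in simp)
qed

text \<open>For large \<open>R\<close> the eigenvalues of \<open>A + R\<close> have nearly the same argument, and \<open>n\<close> powers of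
  \<open>A + R\<close>, suitably rescaled, are a perturbation of an invertible binomial combination of
  \<open>1, A, \<dots>, A^(n-1)\<close>. So any \<open>n\<close> powers, not only consecutive ones, inherit controllability.\<close>

lemma ex_shift_gram_det_nonzero:
  fixes A :: "real^'x^'x" and B :: "real^'u^'x"
  assumes ctrl: "\<And>z. (\<And>l. l < CARD('x) \<Longrightarrow>
      Finite_Cartesian_Product.transpose (mpow A l ** B) *v z = 0) \<Longrightarrow> z = 0"
    and K: "finite K" "card K = CARD('x)"
  shows "\<exists>R. Determinants.det (gram K (\<lambda>k. mpow (A + R *\<^sub>R Finite_Cartesian_Product.mat 1) k ** B)) \<noteq> 0"
proof -
  let ?n = "CARD('x)"
  define Y where "Y z l = Finite_Cartesian_Product.transpose (mpow A l ** B) *v z" for z l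
  define N where "N = Max K"
  have N: "k \<le> N" if "k \<in> K" for k using that K(1) by (simp add: N_def)
  have linY: "linear (\<lambda>z. Y z l)" for l unfolding Y_def by (rule matrix_vector_mul_linear)
  \<comment> \<open>\<open>F\<close> stacks the first \<open>?n\<close> vectors
    \<open>Y z l\<close>. Controllability makes it injective, and \<open>b\<close> is the resulting
    lower bound.\<close>
  define F :: "real^'x \<Rightarrow> real^'u^'x" where "F z = (\<chi> i. Y z (to_nat_on UNIV i))" for z
  have "linear F"
    by (rule linearI)
      (simp_all add: F_def Finite_Cartesian_Product.vec_eq_iff linear_add[OF linY] linear_cmul[OF linY])
  moreover have "inj F"
  proof -
    have "z = 0" if "F z = 0" for z
    proof (rule ctrl)
      fix l assume "l < ?n"
      then have "F z $ from_nat_into UNIV l = Finite_Cartesian_Product.transpose (mpow A l ** B) *v z"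
        using to_nat_on_from_nat_into[of l, where 'n='x] by (simp add: F_def Y_def)
      then show "Finite_Cartesian_Product.transpose (mpow A l ** B) *v z = 0" using that by simp
    qed
    then show ?thesis using \<open>linear F\<close> linear_injective_0 by blast
  qed
  ultimately obtain b where b: "b > 0" "\<And>z. b * norm z \<le> norm (F z)"
    using linear_inj_bounded_below_pos by blast
  have bij: "bij_betw (to_nat_on UNIV) (UNIV::'x set) {..<?n}"
    using to_nat_on_finite[of "UNIV::'x set"] by (simp add: atLeast0LessThan)
  have normF: "b * norm z \<le> (\<Sum>l<?n. norm (Y z l))" for z
  proof -
    have "norm (F z) \<le> (\<Sum>i\<in>UNIV. norm (F z $ i))"
      by (simp add: norm_vec_def L2_set_le_sum)
    also have "\<dots> = (\<Sum>l<?n. norm (Y z l))"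
      using sum.reindex_bij_betw[OF bij, of "\<lambda>l. norm (Y z l)"] by (simp add: F_def)
    finally show ?thesis using b(2)[of z] by simp
  qed
  \<comment> \<open>Powers with exponents in \<open>K\<close> involve all \<open>l\<close> up to
    \<open>N\<close>, so the maps \<open>Y\<close> need a common bound beyond the first
    \<open>?n\<close> as well.\<close>
  define D where "D = (\<Sum>l\<le>N. onorm (\<lambda>z. Y z l))"
  have blY: "bounded_linear (\<lambda>z. Y z l)" for l using linY linear_conv_bounded_linear by blast
  have D: "norm (Y z l) \<le> D * norm z" if "l \<le> N" for z l
  proof -
    have "norm (Y z l) \<le> onorm (\<lambda>z. Y z l) * norm z" by (rule onorm[OF blY])
    also have "\<dots> \<le> D * norm z" unfolding D_def
      using that by (intro mult_right_mono member_le_sum) (auto intro: onorm_pos_le[OF blY])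
    finally show ?thesis .
  qed
  have "D \<ge> 0" unfolding D_def by (intro sum_nonneg onorm_pos_le[OF blY])
  obtain C where C: "C \<ge> 0" "\<And>w e l. l < ?n \<Longrightarrow>
    (\<And>k. k \<in> K \<Longrightarrow> \<bar>\<Sum>l<?n. real (k choose l) * w l\<bar> \<le> e) \<Longrightarrow> \<bar>w l\<bar> \<le> C * e"
    using binomial_combination_bound[OF K] by blast
  \<comment> \<open>This constant comes from the estimate \<open>m \<le> c / R * m\<close> reached
    at the end; \<open>R > c\<close> then forces \<open>m = 0\<close>.\<close>
  define c where "c = real ?n * real CARD('u) * C * (2 ^ N * D / b)"
  have "c \<ge> 0" using C(1) \<open>D \<ge> 0\<close> b(1) by (simp add: c_def)
  define R where "R = c + 1"
  have R: "R \<ge> 1" "R > c" using \<open>c \<ge> 0\<close> by (auto simp: R_def)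
  have "z = 0" if z: "\<And>k. k \<in> K \<Longrightarrow> Finite_Cartesian_Product.transpose
      (mpow (A + R *\<^sub>R Finite_Cartesian_Product.mat 1) k ** B) *v z = 0" for z
  proof -
    \<comment> \<open>With this scaling the expansion of the \<open>k\<close>-th power of
      \<open>A + R\<close>, divided by \<open>R ^ k\<close>, has pure binomial coefficients that no
      longer contain \<open>R\<close>.\<close>
    define w where "w l = (1 / R ^ l) *\<^sub>R Y z l" for l
    define m where "m = (\<Sum>l<?n. norm (w l))"
    have "m \<ge> 0" unfolding m_def by (intro sum_nonneg) auto
    have sum0: "(\<Sum>l\<le>k. real (k choose l) *\<^sub>R w l) = 0" if "k \<in> K" for k
    proof -
      have "0 = (\<Sum>l\<le>k. (real (k choose l) * R ^ (k - l)) *\<^sub>R Y z l)"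
        using z[OF that] unfolding mpow_add_scaleR_mat1 Y_def
        by (simp add: bounded_bilinear.sum_left[OF bounded_bilinear_matrix_matrix_mult]
            bounded_bilinear.scaleR_left[OF bounded_bilinear_matrix_matrix_mult]
            bounded_bilinear.sum_right[OF bounded_bilinear_matrix_vector_mult]
            vec.scale_sum_right bounded_bilinear.sum_right[OF bounded_bilinear_vector_matrix_mult]
            bounded_bilinear.scaleR_right[OF bounded_bilinear_vector_matrix_mult])
      also have "\<dots> = (\<Sum>l\<le>k. R ^ k *\<^sub>R (real (k choose l) *\<^sub>R w l))"
        using R(1) by (intro sum.cong refl) (simp add: w_def power_diff field_simps)
      also have "\<dots> = R ^ k *\<^sub>R (\<Sum>l\<le>k. real (k choose l) *\<^sub>R w l)" by (rule scaleR_sum_right[symmetric])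
      finally show ?thesis using R(1) by auto
    qed
    have znorm: "b * norm z \<le> R ^ (?n - 1) * m"
    proof -
      have "(\<Sum>l<?n. norm (Y z l)) \<le> (\<Sum>l<?n. R ^ (?n - 1) * norm (w l))"
      proof (intro sum_mono)
        fix l assume "l \<in> {..<?n}"
        then have "R ^ l \<le> R ^ (?n - 1)" using R(1) by (intro power_increasing) auto
        moreover have "norm (Y z l) = R ^ l * norm (w l)" using R(1) by (simp add: w_def)
        ultimately show "norm (Y z l) \<le> R ^ (?n - 1) * norm (w l)" by (simp add: mult_right_mono)
      qed
      then show ?thesis using normF[of z] by (simp add: m_def sum_distrib_left)
    qed
    define e where "e = 2 ^ N * D / b * m / R"
    \<comment> \<open>The first \<open>?n\<close> vectors control \<open>z\<close> at the price of
      \<open>R ^ (?n - 1)\<close>, whereas a tail vector carries at least \<open>?n\<close> factors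
      \<open>1 / R\<close>; one factor \<open>1 / R\<close> is gained.\<close>
    have tail: "norm (w l) \<le> D / b * m / R" if "?n \<le> l" "l \<le> N" for l
    proof -
      have "norm (w l) = norm (Y z l) / R ^ l" using R(1) by (simp add: w_def)
      also have "\<dots> \<le> norm (Y z l) / R ^ ?n"
        using R(1) that(1) by (intro divide_left_mono power_increasing) auto
      also have "\<dots> \<le> D * norm z / R ^ ?n" using D[OF that(2)] R(1) by (intro divide_right_mono) auto
      also have "\<dots> \<le> D * (R ^ (?n - 1) * m / b) / R ^ ?n"
        using znorm b(1) R(1) \<open>D \<ge> 0\<close>
        by (intro divide_right_mono mult_left_mono) (auto simp: field_simps)
      also have "R ^ ?n = R * R ^ (?n - 1)" by (metis power_eq_if zero_less_card_finite less_not_refl)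
      also have "D * (R ^ (?n - 1) * m / b) / (R * R ^ (?n - 1)) = D / b * m / R"
        using R(1) by simp
      finally show ?thesis .
    qed
    have small: "\<bar>w l $ j\<bar> \<le> C * e" if "l < ?n" for l j
    \<comment> \<open>The full combination vanishes by \<open>sum0\<close>, so its first
      \<open>?n\<close> terms are as small as the tail.\<close>
    proof (rule C(2)[OF that])
      fix k assume k: "k \<in> K"
      have "(\<Sum>l<?n. real (k choose l) *\<^sub>R w l) = (\<Sum>l<max ?n (Suc k). real (k choose l) *\<^sub>R w l)
          - (\<Sum>l\<in>{?n..<max ?n (Suc k)}. real (k choose l) *\<^sub>R w l)"
        by (simp add: lessThan_atLeast0 sum.atLeastLessThan_concat[symmetric, of 0 ?n "max ?n (Suc k)"])
      also have "(\<Sum>l<max ?n (Suc k). real (k choose l) *\<^sub>R w l) = (\<Sum>l\<le>k. real (k choose l) *\<^sub>R w l)"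
        by (rule sum.mono_neutral_right) auto
      finally have "norm (\<Sum>l<?n. real (k choose l) *\<^sub>R w l) \<le>
          (\<Sum>l\<in>{?n..<max ?n (Suc k)}. real (k choose l) * norm (w l))"
        using sum0[OF k] sum_norm_le[of _ "\<lambda>l. real (k choose l) *\<^sub>R w l" "\<lambda>l. real (k choose l) * norm (w l)"]
        by simp
      also have "\<dots> \<le> (\<Sum>l\<in>{?n..<max ?n (Suc k)}. real (k choose l) * (D / b * m / R))"
        using N[OF k] by (intro sum_mono mult_left_mono tail) auto
      also have "\<dots> \<le> (\<Sum>l\<le>k. real (k choose l) * (D / b * m / R))"
        using \<open>D \<ge> 0\<close> b(1) \<open>m \<ge> 0\<close> R(1) by (intro sum_mono2) auto
      also have "\<dots> = 2 ^ k * (D / b * m / R)"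
        unfolding sum_distrib_right[symmetric]
        by (metis choose_row_sum of_nat_numeral of_nat_power of_nat_sum)
      also have "\<dots> \<le> 2 ^ N * (D / b * m / R)"
        using \<open>D \<ge> 0\<close> b(1) \<open>m \<ge> 0\<close> R(1) N[OF k] by (intro mult_right_mono power_increasing) auto
      finally have "norm (\<Sum>l<?n. real (k choose l) *\<^sub>R w l) \<le> e" by (simp add: e_def)
      then show "\<bar>\<Sum>l<?n. real (k choose l) * w l $ j\<bar> \<le> e"
        using component_le_norm_cart[of "\<Sum>l<?n. real (k choose l) *\<^sub>R w l" j] by simp
    qed
    have "norm (w l) \<le> real CARD('u) * (C * e)" if "l < ?n" for l
    proof -
      have "norm (w l) \<le> (\<Sum>j\<in>UNIV. \<bar>w l $ j\<bar>)" by (rule norm_le_l1_cart)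
      also have "\<dots> \<le> (\<Sum>j\<in>(UNIV::'u set). C * e)" using small[OF that] by (intro sum_mono)
      finally show ?thesis by simp
    qed
    then have "m \<le> (\<Sum>l<?n. real CARD('u) * (C * e))" unfolding m_def by (intro sum_mono) auto
    also have "\<dots> = c / R * m" by (simp add: c_def e_def)
    finally have "m * (R - c) \<le> 0" using R(1) by (simp add: field_simps)
    then have "m = 0" using \<open>m \<ge> 0\<close> R(2) by (simp add: mult_le_0_iff)
    then have "norm z \<le> 0" using znorm b(1) by (simp add: mult_le_0_iff)
    then show ?thesis by simp
  qed
  then show ?thesis
    using gram_det_nonzero[OF K(1), of "\<lambda>k. mpow (A + R *\<^sub>R Finite_Cartesian_Product.mat 1) k ** B"]
    by blast
qed

text \<open>Tying conjugates leaves a constant vector on \<open>S\<close> unchanged, and the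
  \<open>E a\<close> sum to the identity, so the vector with all entries \<open>R\<close> produces
  exactly \<open>A + R\<close>. This witnesses that the polynomial is not zero, for each of the
  finitely many \<open>K\<close>.\<close>

lemma AE_gram_det_nonzero:
  fixes A :: "real^'x^'x" and B :: "real^'u^'x" and E :: "complex \<Rightarrow> real^'x^'x"
  assumes ctrl: "\<And>z. (\<And>l. l < CARD('x) \<Longrightarrow>
      Finite_Cartesian_Product.transpose (mpow A l ** B) *v z = 0) \<Longrightarrow> z = 0"
    and S: "finite S" "\<And>a. a \<in> S \<Longrightarrow> cnj a \<in> S" and E: "(\<Sum>a\<in>S. E a) = Finite_Cartesian_Product.mat 1"
  shows "AE q in Pi\<^sub>M S (\<lambda>_. lborel). \<forall>K. K \<subseteq> {..<N} \<and> card K = CARD('x) \<longrightarrow>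
    Determinants.det (gram K (\<lambda>k. mpow (A + (\<Sum>a\<in>S. tie_conjugates q a *\<^sub>R E a)) k ** B)) \<noteq> 0"
proof -
  have ae: "AE q in Pi\<^sub>M S (\<lambda>_. lborel).
      Determinants.det (gram K (\<lambda>k. mpow (A + (\<Sum>a\<in>S. tie_conjugates q a *\<^sub>R E a)) k ** B)) \<noteq> 0"
    if K: "K \<subseteq> {..<N}" "card K = CARD('x)" for K
  proof -
    have "finite K" using K(1) finite_subset by blast
    then obtain R where
      R: "Determinants.det (gram K (\<lambda>k. mpow (A + R *\<^sub>R Finite_Cartesian_Product.mat 1) k ** B)) \<noteq> 0"
      using ex_shift_gram_det_nonzero[OF ctrl _ K(2)] by blast
    have tie: "poly_fun S (\<lambda>q. tie_conjugates q a)" if "a \<in> S" for a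
      using that S(2) by (cases "Im a \<ge> 0") (auto simp: tie_conjugates_def intro: poly_fun.coord)
    have ent: "poly_fun S (\<lambda>q. (A + (\<Sum>a\<in>S. tie_conjugates q a *\<^sub>R E a)) $ i $ j)" for i j
      by (auto intro!: poly_fun.add poly_fun_sum poly_fun.mult poly_fun.const tie)
    have "poly_fun S (\<lambda>q. gram K (\<lambda>k. mpow (A + (\<Sum>a\<in>S. tie_conjugates q a *\<^sub>R E a)) k ** B) $ i $ j)" for i j
      unfolding gram_def sum_component
      by (intro poly_fun_sum poly_fun_matrix_mult)
        (auto simp: Finite_Cartesian_Product.transpose_def
          intro!: poly_fun_matrix_mult poly_fun_mpow ent poly_fun.const)
    then have pf: "poly_fun S
        (\<lambda>q. Determinants.det (gram K (\<lambda>k. mpow (A + (\<Sum>a\<in>S. tie_conjugates q a *\<^sub>R E a)) k ** B)))"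
      by (rule poly_fun_det)
    have "tie_conjugates (restrict (\<lambda>_. R) S) a = R" if "a \<in> S" for a
      using that S(2) by (simp add: tie_conjugates_def)
    then have "(\<Sum>a\<in>S. tie_conjugates (restrict (\<lambda>_. R) S) a *\<^sub>R E a) =
        R *\<^sub>R Finite_Cartesian_Product.mat 1"
      by (simp add: E[symmetric] scaleR_sum_right)
    with R show ?thesis
      by (intro poly_fun_AE_nonzero[OF S(1) pf, of "restrict (\<lambda>_. R) S"]) auto
  qed
  have "AE q in Pi\<^sub>M S (\<lambda>_. lborel). \<forall>K\<in>{K. K \<subseteq> {..<N} \<and> card K = CARD('x)}.
      Determinants.det (gram K (\<lambda>k. mpow (A + (\<Sum>a\<in>S. tie_conjugates q a *\<^sub>R E a)) k ** B)) \<noteq> 0"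
    by (rule AE_finite_allI) (use ae in auto)
  then show ?thesis by eventually_elim auto
qed

section \<open>Trajectories and the equality constraints\<close>

primrec traj :: "real^'x^'x \<Rightarrow> real^'u^'x \<Rightarrow> real^'x \<Rightarrow> (nat \<Rightarrow> real^'u) \<Rightarrow> nat \<Rightarrow> real^'x" where
  "traj A B \<xi> u 0 = \<xi>"
| "traj A B \<xi> u (Suc k) = A *v traj A B \<xi> u k + B *v u (Suc k)"

lemma propagate_eq_traj: "propagate P ts u k = traj (A_mat P ts) (B_mat P ts) (x_init P ts) u k"
  by (induction k) auto

lemma traj_add: "traj A B (\<xi> + \<eta>) (\<lambda>i. u i + v i) k = traj A B \<xi> u k + traj A B \<eta> v k"
  by (induction k) (auto simp: matrix_vector_right_distrib algebra_simps)

lemma traj_scaleR: "traj A B (c *\<^sub>R \<xi>) (\<lambda>i. c *\<^sub>R u i) k = c *\<^sub>R traj A B \<xi> u k"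
  by (induction k) (auto simp: matrix_vector_mult_scaleR scaleR_right_distrib)

lemma traj_scaleR_0: "traj A B 0 (\<lambda>i. c *\<^sub>R u i) k = c *\<^sub>R traj A B 0 u k"
  using traj_scaleR[of A B c 0 u k] by simp

lemma traj_perturb: "traj A B \<xi> (\<lambda>i. u i + c *\<^sub>R v i) k = traj A B \<xi> u k + c *\<^sub>R traj A B 0 v k"
  using traj_add[of A B \<xi> 0 u "\<lambda>i. c *\<^sub>R v i" k] by (simp add: traj_scaleR_0)

lemma traj_0_sum: "traj A B 0 (\<lambda>i. \<Sum>j\<in>I. v j i) k = (\<Sum>j\<in>I. traj A B 0 (v j) k)"
proof (induction I rule: infinite_finite_induct)
  case (infinite I)
  show ?case using infinite traj_scaleR_0[of A B 0 "\<lambda>_. 0" k] by simp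
next
  case empty
  show ?case using traj_scaleR_0[of A B 0 "\<lambda>_. 0" k] by simp
next
  case (insert j I)
  then show ?case using traj_add[of A B 0 0 "v j" "\<lambda>i. \<Sum>j\<in>I. v j i" k] by simp
qed

lemma traj_0_eq: "traj A B 0 v k = (\<Sum>i=1..k. (mpow A (k - i) ** B) *v v i)"
proof (induction k)
  case (Suc k)
  have "A *v (\<Sum>i=1..k. (mpow A (k - i) ** B) *v v i) = (\<Sum>i=1..k. (mpow A (Suc k - i) ** B) *v v i)"
    unfolding bounded_bilinear.sum_right[OF bounded_bilinear_matrix_vector_mult]
    by (intro sum.cong) (auto simp: Suc_diff_le matrix_vector_mul_assoc matrix_mul_assoc)
  with Suc show ?case by simp
qed simp

lemma tendsto_traj:
  assumes "(Af \<longlongrightarrow> A) F" "(Bf \<longlongrightarrow> B) F" "(\<xi>f \<longlongrightarrow> \<xi>) F"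
    and "\<And>i. i \<in> {1..k} \<Longrightarrow> ((\<lambda>p. uf p i) \<longlongrightarrow> u i) F"
  shows "((\<lambda>p. traj (Af p) (Bf p) (\<xi>f p) (uf p) k) \<longlongrightarrow> traj A B \<xi> u k) F"
  using assms(4)
proof (induction k)
  case (Suc k)
  have "((\<lambda>p. traj (Af p) (Bf p) (\<xi>f p) (uf p) k) \<longlongrightarrow> traj A B \<xi> u k) F"
    by (rule Suc.IH) (use Suc.prems in auto)
  moreover have "((\<lambda>p. uf p (Suc k)) \<longlongrightarrow> u (Suc k)) F" using Suc.prems by auto
  ultimately show ?case by (auto intro!: tendsto_intros assms)
qed (use assms in simp)

lemma C1_isCont: "C1 f \<Longrightarrow> isCont f x"
  unfolding C1_def using has_derivative_continuous by blast

lemma C1_DERIV: "C1 f \<Longrightarrow> (f has_real_derivative deriv f x) (at x)" for f :: "real \<Rightarrow> real"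
  by (metis C1_def DERIV_imp_deriv has_field_derivative_def has_derivative_unique
      real_differentiable_def differentiableI real_differentiableE)

section \<open>Eliminating the states and the slack variables\<close>

definition final_state :: "('x::finite, 'u::finite, 'g::finite) two_phase \<Rightarrow> real \<Rightarrow> real^'x^'x
    \<Rightarrow> (nat \<Rightarrow> real^'u) \<Rightarrow> real^'x" where
  "final_state P ts A u = traj A (B_mat P ts) (x_init P ts) u (N_stages P)"

definition stage :: "('x::finite, 'u::finite, 'g::finite) two_phase \<Rightarrow> real^'u \<Rightarrow> real" where
  "stage P u = l_cost P (max (rho_min P) (g_con P u))"

definition admissible :: "('x::finite, 'u::finite, 'g::finite) two_phase \<Rightarrow> real \<Rightarrow> real^'x^'x
    \<Rightarrow> (nat \<Rightarrow> real^'u) set" where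
  "admissible P ts A = {u. (\<forall>i\<in>{1..N_stages P}. g_con P (u i) \<le> rho_max P) \<and>
     G_term P (final_state P ts A u) = 0}"

definition reduced_cost :: "('x::finite, 'u::finite, 'g::finite) two_phase \<Rightarrow> real \<Rightarrow> real^'x^'x
    \<Rightarrow> (nat \<Rightarrow> real^'u) \<Rightarrow> real" where
  "reduced_cost P ts A u = m_cost P (final_state P ts A u) +
     step_len P ts * (\<Sum>i=1..N_stages P. stage P (u i)) + ts * l_cost P (rho_min P)"

lemma F_zero_iff:
  "(x, u, \<sigma>) \<in> F_zero P ts A \<longleftrightarrow>
    x 1 = x_init P ts \<and> (\<forall>i\<in>{1..N_stages P}. x (Suc i) = A *v x i + B_mat P ts *v u i) \<and>
    G_term P (x (N_stages P + 1)) = 0" (is "?l \<longleftrightarrow> ?r")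
proof
  assume l: ?l
  then have row: "F_res P ts A (x, u, \<sigma>) r = 0" if "r \<in> F_rows P" for r
    using that by (simp add: F_zero_def)
  have "x 1 $ k = x_init P ts $ k" for k
    using row[of "Inl (1, k)"] by (auto simp: F_rows_def Plus_def)
  moreover have "x (Suc i) $ k = (A *v x i + B_mat P ts *v u i) $ k" if "i \<in> {1..N_stages P}" for i k
    using row[of "Inl (Suc i, k)"] that by (auto simp: F_rows_def Plus_def image_iff)
  moreover have "G_term P (x (N_stages P + 1)) $ k = 0" for k
    using row[of "Inr k"] by (auto simp: F_rows_def)
  ultimately show ?r by (simp add: Finite_Cartesian_Product.vec_eq_iff)
next
  assume r: ?r
  have "F_res P ts A (x, u, \<sigma>) (Inl (i, k)) = 0" if "i \<in> {1..N_stages P + 1}" for i k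
  proof (cases "i = 1")
    case False
    then have "i - 1 \<in> {1..N_stages P}" "i = Suc (i - 1)" using that by auto
    then have "x i = A *v x (i - 1) + B_mat P ts *v u (i - 1)" using r by metis
    with False show ?thesis by simp
  qed (use r in simp)
  moreover have "F_res P ts A (x, u, \<sigma>) (Inr k) = 0" for k using r by simp
  ultimately show ?l by (auto simp: F_zero_def F_rows_def)
qed

lemma F_zero_final_state:
  assumes "(x, u, \<sigma>) \<in> F_zero P ts A"
  shows "x (N_stages P + 1) = final_state P ts A u"
proof -
  have "x (Suc k) = traj A (B_mat P ts) (x_init P ts) u k" if "k \<le> N_stages P" for k
    using that
  proof (induction k)
    case (Suc k)
    then show ?case using assms unfolding F_zero_iff by auto
  qed (use assms in \<open>simp add: F_zero_iff\<close>)
  then show ?thesis by (simp add: final_state_def)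
qed

text \<open>Differentiability in each coordinate direction: it ensures that \<open>deriv\<close> in
  \<open>F_jac\<close> is a genuine derivative and not an unspecified value.\<close>

lemma F_res_affine:
  assumes G: "linear (\<lambda>x. G_term P x - G_term P 0)"
  shows "\<exists>a b. \<forall>h. F_res P ts A (displace c h z) r = a + h * b"
proof -
  obtain x u \<sigma> where z: "z = (x, u, \<sigma>)" by (metis prod_cases3)
  have ax: "axis k h = h *\<^sub>R axis k (1::real)" for k :: "'n::finite" and h
    by (simp add: axis_def Finite_Cartesian_Product.vec_eq_iff)
  have "\<exists>dx du d\<sigma>. \<forall>h. displace c h z = (\<lambda>i. x i + h *\<^sub>R dx i, \<lambda>i. u i + h *\<^sub>R du i, \<lambda>i. \<sigma> i + h * d\<sigma> i)"
  proof (cases c)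
    case (Inl ik)
    then show ?thesis
      by (intro exI[of _ "(\<lambda>_. 0)(fst ik := axis (snd ik) 1)"] exI[of _ "\<lambda>_. 0"] exI[of _ "\<lambda>_. 0"],
          cases ik) (auto simp: z fun_eq_iff intro: ax)
  next
    case (Inr c')
    show ?thesis
    proof (cases c')
      case (Inl ik)
      then show ?thesis using Inr
        by (intro exI[of _ "\<lambda>_. 0"] exI[of _ "(\<lambda>_. 0)(fst ik := axis (snd ik) 1)"] exI[of _ "\<lambda>_. 0"],
            cases ik) (auto simp: z fun_eq_iff intro: ax)
    next
      case (Inr i)
      then show ?thesis using \<open>c = Inr c'\<close>
        by (intro exI[of _ "\<lambda>_. 0"] exI[of _ "\<lambda>_. 0"] exI[of _ "(\<lambda>_. 0)(i := 1)"]) (auto simp: z)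
    qed
  qed
  then obtain dx du d\<sigma> where
    d: "\<And>h. displace c h z = (\<lambda>i. x i + h *\<^sub>R dx i, \<lambda>i. u i + h *\<^sub>R du i, \<lambda>i. \<sigma> i + h * d\<sigma> i)"
    by blast
  have Gd: "G_term P (y + h *\<^sub>R e) = G_term P y + h *\<^sub>R (G_term P e - G_term P 0)" for y h e
    using linear_add[OF G, of y "h *\<^sub>R e"] linear_cmul[OF G, of h e] by (simp add: algebra_simps)
  show ?thesis
    proof (cases r)
      case (Inl ik)
      obtain i k where ik: "ik = (i, k)" by force
      show ?thesis
      proof (cases "i = 1")
        case True
        then show ?thesis
          by (intro exI[of _ "(x 1 - x_init P ts) $ k"] exI[of _ "dx 1 $ k"]) (simp add: Inl ik d)
      next
        case False
        then show ?thesis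
          by (intro exI[of _ "(x i - (A *v x (i - 1) + B_mat P ts *v u (i - 1))) $ k"]
              exI[of _ "(dx i - (A *v dx (i - 1) + B_mat P ts *v du (i - 1))) $ k"])
            (simp add: Inl ik d matrix_vector_right_distrib matrix_vector_mult_scaleR algebra_simps)
      qed
    next
      case (Inr k)
      then show ?thesis
        by (intro exI[of _ "G_term P (x (N_stages P + 1)) $ k"]
            exI[of _ "(G_term P (dx (N_stages P + 1)) - G_term P 0) $ k"]) (simp add: d Gd)
    qed
qed

section \<open>Duality for the equality constraints\<close>

lemma mpow_Suc_right: "mpow A (Suc k) = mpow A k ** A"
  by (induction k) (auto simp: matrix_mul_assoc)

text \<open>The weights of the rows are those of an adjoint trajectory \<open>p\<close> with terminal value
  \<open>- transpose L *v \<nu>\<close>: the weighted sum of the rows of \<open>F\<close> telescopes to a constant.\<close>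

lemma full_row_rank_adjoint:
  fixes P :: "('x::finite, 'u::finite, 'g::finite) two_phase"
  assumes L: "\<And>x. G_term P x = G_term P 0 + L *v x"
    and rank: "F_full_row_rank P ts"
    and \<nu>: "\<And>i. i \<in> {1..N_stages P} \<Longrightarrow>
      Finite_Cartesian_Product.transpose (L ** (mpow (A_mat P ts) (N_stages P - i) ** B_mat P ts)) *v \<nu> = 0"
  shows "\<nu> = 0"
proof -
  define N where "N = N_stages P"
  define A where "A = A_mat P ts"
  define B where "B = B_mat P ts"
  define \<xi> where "\<xi> = x_init P ts"
  let ?T = "Finite_Cartesian_Product.transpose"
  \<comment> \<open>Closed form of the backward recursion
    \<open>p i = transpose A *v p (i + 1)\<close> that starts at index \<open>N + 1\<close>.\<close>
  define p where "p i = - (?T (mpow A (N + 1 - i)) *v (?T L *v \<nu>))" for i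
  define w where "w r = (case r of Inl (i, k) \<Rightarrow> p i $ k | Inr k \<Rightarrow> \<nu> $ k)" for r :: "('x, 'g) row"
  have tm: "(M *v x) \<bullet> y = x \<bullet> (?T M *v y)" for M :: "real^'a::finite^'b::finite" and x y
    by (metis dot_lmul_matrix inner_commute transpose_matrix_vector)
  have p_step: "?T A *v p (Suc i) = p i" if "i \<in> {1..N}" for i
  proof -
    have "N + 1 - i = Suc (N + 1 - Suc i)" using that by auto
    then show ?thesis
      by (simp add: p_def mpow_Suc_right matrix_transpose_mul matrix_vector_mul_assoc matrix_mul_assoc
          bounded_bilinear.minus_right[OF bounded_bilinear_matrix_vector_mult] del: mpow.simps transpose_matrix_vector)
  qed
  \<comment> \<open>The hypothesis on \<nu> says precisely that the adjoint trajectory does not see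
    the controls.\<close>
  have p_B: "?T B *v p (Suc i) = 0" if "i \<in> {1..N}" for i
    using \<nu>[of i] that
    by (simp add: p_def N_def A_def B_def matrix_transpose_mul matrix_vector_mul_assoc matrix_mul_assoc
        bounded_bilinear.minus_right[OF bounded_bilinear_matrix_vector_mult] del: transpose_matrix_vector)
  \<comment> \<open>Control terms vanish, state terms telescope, and what remains at
    \<open>N + 1\<close> cancels against the terminal row.\<close>
  have const: "(\<Sum>r\<in>F_rows P. w r * F_res P ts A z r) = - (p 1 \<bullet> \<xi>) + \<nu> \<bullet> G_term P 0" for z
  proof -
    obtain x u \<sigma> where z: "z = (x, u, \<sigma>)" by (metis prod_cases3)
    define res where "res i = (if i = 1 then x 1 - \<xi> else x i - (A *v x (i - 1) + B *v u (i - 1)))" for i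
    have "(\<Sum>r\<in>F_rows P. w r * F_res P ts A z r) =
        (\<Sum>ik\<in>{1..N+1} \<times> UNIV. w (Inl ik) * F_res P ts A z (Inl ik)) +
        (\<Sum>k\<in>UNIV. w (Inr k) * F_res P ts A z (Inr k))"
      unfolding F_rows_def N_def by (subst sum.Plus) auto
    also have "(\<Sum>ik\<in>{1..N+1} \<times> UNIV. w (Inl ik) * F_res P ts A z (Inl ik)) = (\<Sum>i=1..N+1. p i \<bullet> res i)"
      unfolding inner_vec_def sum.cartesian_product
      by (intro sum.cong) (auto simp: w_def z res_def \<xi>_def B_def)
    also have "(\<Sum>k\<in>UNIV. w (Inr k) * F_res P ts A z (Inr k)) = \<nu> \<bullet> G_term P (x (N + 1))"
      unfolding inner_vec_def by (intro sum.cong) (auto simp: w_def z N_def)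
    also have "(\<Sum>i=1..N+1. p i \<bullet> res i) = p 1 \<bullet> res 1 + (\<Sum>i=1..N. p (Suc i) \<bullet> res (Suc i))"
      using sum.atLeast_Suc_atMost[of 1 "N + 1" "\<lambda>i. p i \<bullet> res i"]
        sum.shift_bounds_cl_Suc_ivl[of "\<lambda>i. p i \<bullet> res i" 1 N] by simp
    also have "(\<Sum>i=1..N. p (Suc i) \<bullet> res (Suc i)) = (\<Sum>i=1..N. p (Suc i) \<bullet> x (Suc i) - p i \<bullet> x i)"
    proof (intro sum.cong refl)
      fix i assume i: "i \<in> {1..N}"
      have "p (Suc i) \<bullet> (A *v x i) = p i \<bullet> x i" "p (Suc i) \<bullet> (B *v u i) = 0"
        using tm[of A "x i" "p (Suc i)"] tm[of B "u i" "p (Suc i)"] p_step[OF i] p_B[OF i]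
        by (simp_all add: inner_commute)
      then show "p (Suc i) \<bullet> res (Suc i) = p (Suc i) \<bullet> x (Suc i) - p i \<bullet> x i"
        using i by (simp add: res_def inner_diff_right inner_add_right)
    qed
    also have "\<dots> = p (Suc N) \<bullet> x (Suc N) - p 1 \<bullet> x 1"
      using sum_Suc_diff[of 1 N "\<lambda>i. p i \<bullet> x i"] by simp
    also have "p (Suc N) \<bullet> x (Suc N) = - (\<nu> \<bullet> (L *v x (Suc N)))"
      using tm[of L "x (Suc N)" \<nu>] by (simp add: p_def inner_commute)
    also have "G_term P (x (N + 1)) = G_term P 0 + L *v x (Suc N)" by (simp add: L[of "x (Suc N)"])
    finally show ?thesis by (simp add: res_def inner_diff_right inner_add_right)
  qed
  have "G_term P x - G_term P 0 = L *v x" for x by (subst L) simp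
  then have "linear (\<lambda>x. G_term P x - G_term P 0)" by simp
  note aff = F_res_affine[OF this, of ts A]
  \<comment> \<open>A constant combination has zero derivative in every direction, so
    \<open>w\<close> lies in the left kernel of the Jacobian.\<close>
  have "(\<Sum>r\<in>F_rows P. w r * F_jac P ts z r c) = 0" for z c
  proof -
    have "((\<lambda>h. F_res P ts A (displace c h z) r) has_real_derivative F_jac P ts z r c) (at 0)" for r
    proof -
      obtain a b where ab: "\<And>h. F_res P ts A (displace c h z) r = a + h * b" using aff by blast
      have "((\<lambda>h. a + h * b) has_real_derivative b) (at 0)" by (auto intro!: derivative_eq_intros)
      then show ?thesis using DERIV_imp_deriv[of "\<lambda>h. a + h * b"]
        by (simp add: F_jac_def A_def[symmetric] ab)
    qed
    then have "((\<lambda>h. \<Sum>r\<in>F_rows P. w r * F_res P ts A (displace c h z) r) has_real_derivative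
        (\<Sum>r\<in>F_rows P. w r * F_jac P ts z r c)) (at 0)"
      by (intro DERIV_sum DERIV_cmult)
    moreover have "((\<lambda>h. \<Sum>r\<in>F_rows P. w r * F_res P ts A (displace c h z) r) has_real_derivative 0) (at 0)"
      unfolding const by (rule DERIV_const)
    ultimately show ?thesis by (rule DERIV_unique)
  qed
  then have "\<forall>r\<in>F_rows P. w r = 0" using rank unfolding F_full_row_rank_def by blast
  then have "\<nu> $ k = 0" for k by (force simp: F_rows_def w_def)
  then show ?thesis by (simp add: Finite_Cartesian_Product.vec_eq_iff)
qed

text \<open>Dual of the preceding lemma through the Gram matrix. It says that any residual of the
  terminal constraint can be corrected by controls alone.\<close>

lemma full_row_rank_surj:
  fixes P :: "('x::finite, 'u::finite, 'g::finite) two_phase"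
  assumes L: "\<And>x. G_term P x = G_term P 0 + L *v x"
    and rank: "F_full_row_rank P ts"
  obtains v where "L *v traj (A_mat P ts) (B_mat P ts) 0 v (N_stages P) = y"
proof -
  define M where "M i = L ** (mpow (A_mat P ts) (N_stages P - i) ** B_mat P ts)" for i
  have "Determinants.det (gram {1..N_stages P} M) \<noteq> 0"
    by (rule gram_det_nonzero) (auto intro: full_row_rank_adjoint[OF L rank] simp: M_def simp del: transpose_matrix_vector)
  from gram_surj[OF this, of y] obtain v where v: "(\<Sum>k\<in>{1..N_stages P}. M k *v v k) = y" by blast
  have "L *v traj (A_mat P ts) (B_mat P ts) 0 v (N_stages P) = y"
    unfolding traj_0_eq bounded_bilinear.sum_right[OF bounded_bilinear_matrix_vector_mult]
    using v by (simp add: M_def matrix_vector_mul_assoc)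
  then show ?thesis by (rule that)
qed

text \<open>Full row rank means that the transpose is injective; its block rows are the transposes
  of the matrices \<open>mpow A l ** B\<close>, with \<open>to_nat_on\<close> giving exponents below
  \<open>CARD('x)\<close>.\<close>

lemma ctrb_rank_observable:
  fixes A :: "real^'x^'x" and B :: "real^'u^'x"
  assumes rank: "rank (ctrb A B) = CARD('x)"
    and z: "\<And>l. l < CARD('x) \<Longrightarrow> Finite_Cartesian_Product.transpose (mpow A l ** B) *v z = 0"
  shows "z = 0"
proof -
  have "inj ((*v) (Finite_Cartesian_Product.transpose (ctrb A B)))"
    using rank full_rank_injective[of "Finite_Cartesian_Product.transpose (ctrb A B)"]
    by (simp add: rank_transpose del: transpose_matrix_vector)
  moreover have "Finite_Cartesian_Product.transpose (ctrb A B) *v z = 0"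
  proof -
    have "(Finite_Cartesian_Product.transpose (ctrb A B) *v z) $ (k, j) = 0" for k j
    proof -
      have "(Finite_Cartesian_Product.transpose (ctrb A B) *v z) $ (k, j) =
          (Finite_Cartesian_Product.transpose (mpow A (to_nat_on UNIV k) ** B) *v z) $ j"
        by (simp add: matrix_vector_mult_def Finite_Cartesian_Product.transpose_def ctrb_def
            del: transpose_matrix_vector)
      also have "\<dots> = 0"
      proof -
        have "to_nat_on (UNIV::'x set) k < CARD('x)"
          using to_nat_on_finite[of "UNIV::'x set"] by (auto simp: bij_betw_def)
        then show ?thesis using z by (simp del: transpose_matrix_vector)
      qed
      finally show ?thesis .
    qed
    then show ?thesis by (simp add: Finite_Cartesian_Product.vec_eq_iff split_paired_all del: transpose_matrix_vector)
  qed
  ultimately show ?thesis by (metis injD matrix_vector_mult_0_right)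
qed

text \<open>Turns compactness arguments with subsequences into neighbourhoods: a sequence of
  violations tending to \<open>a\<close> contradicts a premise that asks for only one good
  index.\<close>

lemma eventually_nhds_sequentiallyI:
  fixes a :: "'a::metric_space"
  assumes "\<And>f. f \<longlonglongrightarrow> a \<Longrightarrow> \<exists>n::nat. Q (f n)"
  shows "\<forall>\<^sub>F x in nhds a. Q x"
proof (rule ccontr)
  assume neg: "\<not> ?thesis"
  have "\<exists>x. dist x a < d \<and> \<not> Q x" if "d > 0" for d
    using neg that unfolding eventually_nhds_metric by blast
  moreover have "1 / real (Suc n) > 0" for n by simp
  ultimately have "\<exists>x. dist x a < 1 / real (Suc n) \<and> \<not> Q x" for n by blast
  then have "\<forall>n. \<exists>x. dist x a < 1 / real (Suc n) \<and> \<not> Q x" ..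
  from choice[OF this] obtain f where f: "\<And>n. dist (f n) a < 1 / real (Suc n)" "\<And>n. \<not> Q (f n)" by blast
  have "f \<longlonglongrightarrow> a"
  proof (rule iffD2[OF tendsto_dist_iff], rule tendsto_sandwich[OF _ _ tendsto_const LIMSEQ_Suc[OF lim_1_over_n]])
    show "\<forall>\<^sub>F n in sequentially. 0 \<le> dist (f n) a" by simp
    show "\<forall>\<^sub>F n in sequentially. dist (f n) a \<le> 1 / real (Suc n)"
      by (intro always_eventually allI less_imp_le f)
  qed
  from assms[OF this] f(2) show False by blast
qed

text \<open>Raising all \<sigma> i by a common amount is a continuous curve in the product topology,
  so it stays in the interior for a short time.\<close>

lemma interior_V_tilde_shift:
  assumes "(x, u, \<sigma>) \<in> interior (V_tilde P)"
  obtains h where "h > 0" "(x, u, \<lambda>i. \<sigma> i + h) \<in> V_tilde P"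
proof -
  define z where "z h = (x, u, \<lambda>i. \<sigma> i + h)" for h
  have "continuous_on UNIV z" unfolding z_def
    by (intro continuous_on_Pair continuous_on_const continuous_on_coordinatewise_then_product
        continuous_on_add continuous_on_id)
  then have "(z \<longlongrightarrow> z 0) (at 0)" unfolding continuous_on_def by blast
  then have "(z \<longlongrightarrow> z 0) (at_right 0)" by (rule tendsto_within_subset) simp
  moreover have "z 0 \<in> interior (V_tilde P)" using assms by (simp add: z_def)
  ultimately have "\<forall>\<^sub>F h in at_right 0. z h \<in> interior (V_tilde P)"
    by (rule topological_tendstoD[OF _ open_interior])
  moreover have "\<forall>\<^sub>F h::real in at_right 0. 0 < h"
    by (rule eventually_at_right_less)
  ultimately have "\<forall>\<^sub>F h in at_right 0. z h \<in> interior (V_tilde P) \<and> 0 < h"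
    by eventually_elim simp
  then obtain h where "z h \<in> interior (V_tilde P)" "0 < h"
    using eventually_happens'[OF trivial_limit_at_right_real] by blast
  moreover from this(1) have "z h \<in> V_tilde P" using interior_subset by blast
  ultimately show ?thesis using that by (simp add: z_def)
qed

text \<open>Room to raise \<sigma> i means that it is below \<open>rho_max\<close>, and so is
  \<open>g (u i)\<close>. This is the form that interiority takes once \<sigma> is
  eliminated.\<close>

lemma slater_point:
  assumes "interior (V_tilde P) \<inter> F_zero P ts A \<noteq> {}" and N: "N_stages P \<ge> 1"
  shows "rho_min P < rho_max P"
    and "\<exists>u\<in>admissible P ts A. \<forall>i\<in>{1..N_stages P}. g_con P (u i) < rho_max P"
proof -
  obtain z where "z \<in> interior (V_tilde P)" "z \<in> F_zero P ts A" using assms(1) by blast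
  moreover obtain x u \<sigma> where "z = (x, u, \<sigma>)" by (metis prod_cases3)
  ultimately have z: "(x, u, \<sigma>) \<in> interior (V_tilde P)" "(x, u, \<sigma>) \<in> F_zero P ts A" by simp_all
  obtain h where h: "h > 0" "(x, u, \<lambda>i. \<sigma> i + h) \<in> V_tilde P"
    using z(1) by (rule interior_V_tilde_shift)
  have "(x, u, \<sigma>) \<in> V_tilde P" using z(1) interior_subset by blast
  then have V: "rho_min P \<le> \<sigma> i" "\<sigma> i < rho_max P" "g_con P (u i) \<le> \<sigma> i" if "i \<in> {1..N_stages P}" for i
  proof -
    have "\<sigma> i + h \<le> rho_max P" using h(2) that by (simp add: V_tilde_def)
    with h(1) show "\<sigma> i < rho_max P" by linarith
    show "rho_min P \<le> \<sigma> i" "g_con P (u i) \<le> \<sigma> i"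
      using \<open>(x, u, \<sigma>) \<in> V_tilde P\<close> that by (simp_all add: V_tilde_def)
  qed
  show "rho_min P < rho_max P" using V(1,2)[of 1] N by simp
  have "G_term P (final_state P ts A u) = 0"
    using z(2) F_zero_final_state[OF z(2)] by (simp add: F_zero_iff)
  moreover have gu: "g_con P (u i) < rho_max P" if "i \<in> {1..N_stages P}" for i using V[OF that] by linarith
  ultimately have "u \<in> admissible P ts A" by (auto simp: admissible_def less_imp_le)
  with gu show "\<exists>u\<in>admissible P ts A. \<forall>i\<in>{1..N_stages P}. g_con P (u i) < rho_max P" by blast
qed

section \<open>The reduced convex problem\<close>

text \<open>\<open>y_opt\<close> is a solution of (P7); the long-horizon case supplies one as the
  final state of an optimal point of (P4).\<close>

locale long_horizon_problem =
  fixes P :: "('x::finite, 'u::finite, 'g::finite) two_phase" and y_opt :: "real^'x"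
  assumes data: "standing P"
    and l_mono: "strict_mono_on {rho_min P..} (l_cost P)"
    and rho_less: "rho_min P < rho_max P"
    and compact_controls: "compact (control_set P (rho_max P))"
    and y_opt: "G_term P y_opt = 0" "\<And>y. G_term P y = 0 \<Longrightarrow> m_cost P y_opt \<le> m_cost P y"
begin

abbreviation "N \<equiv> N_stages P"
abbreviation "l_min \<equiv> l_cost P (rho_min P)"
abbreviation "v_min \<equiv> m_cost P y_opt + t_f P * l_min"

definition "L = matrix (\<lambda>x. G_term P x - G_term P 0)"

lemma N_pos: "N \<ge> 1"
  and convex_m: "convex_on UNIV (m_cost P)" and convex_g: "convex_on UNIV (g_con P)"
  and convex_l: "convex_on UNIV (l_cost P)"
  and g_u_s: "g_con P (u_s P) = rho_min P"
  using data by (auto simp: standing_def)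

lemma isCont_m: "isCont (m_cost P) x" and isCont_g: "isCont (g_con P) u" and isCont_l: "isCont (l_cost P) s"
  using data by (auto simp: standing_def intro: C1_isCont)

lemma G_eq: "G_term P x = G_term P 0 + L *v x"
proof -
  have "linear (\<lambda>x. G_term P x - G_term P 0)" using data by (simp add: standing_def)
  from matrix_works[OF this[folded linear_matrix_vector_mul_eq], of x]
  show ?thesis by (simp add: L_def)
qed

lemma G_add: "G_term P (x + y) = G_term P x + L *v y"
  by (subst G_eq, subst (2) G_eq) (simp add: matrix_vector_right_distrib)

lemma isCont_G: "isCont (G_term P) x"
proof -
  have "G_term P = (\<lambda>x. G_term P 0 + L *v x)" using G_eq by (rule ext)
  moreover have "isCont (\<lambda>x. G_term P 0 + L *v x) x" by (intro continuous_intros)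
  ultimately show ?thesis by metis
qed

lemma l_le: "rho_min P \<le> s \<Longrightarrow> s \<le> t \<Longrightarrow> l_cost P s \<le> l_cost P t"
  using strict_mono_on_leD[OF l_mono, of s t] by simp

lemma stage_ge: "l_min \<le> stage P u"
  unfolding stage_def by (rule l_le) auto

lemma stage_eq: "g_con P u \<le> rho_min P \<Longrightarrow> stage P u = l_min"
  by (simp add: stage_def max_absorb1)

lemma isCont_stage: "isCont (stage P) u"
  unfolding stage_def
  by (rule isCont_o2[OF _ isCont_l]) (intro continuous_intros isCont_g)

lemma g_combination:
  assumes "0 \<le> \<alpha>" "\<alpha> \<le> 1"
  shows "g_con P (u + \<alpha> *\<^sub>R (v - u)) \<le> (1 - \<alpha>) * g_con P u + \<alpha> * g_con P v"
proof -
  have "u + \<alpha> *\<^sub>R (v - u) = (1 - \<alpha>) *\<^sub>R u + \<alpha> *\<^sub>R v" by (simp add: algebra_simps)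
  then show ?thesis using convex_onD[OF convex_g, of \<alpha> u v] assms by simp
qed

lemma stage_combination:
  assumes "0 \<le> \<alpha>" "\<alpha> \<le> 1"
  shows "stage P (u + \<alpha> *\<^sub>R (v - u)) \<le> (1 - \<alpha>) * stage P u + \<alpha> * stage P v"
proof -
  let ?r = "\<lambda>u. max (rho_min P) (g_con P u)"
  have "stage P (u + \<alpha> *\<^sub>R (v - u)) \<le> l_cost P ((1 - \<alpha>) * ?r u + \<alpha> * ?r v)"
    unfolding stage_def
  proof (rule l_le)
    have "rho_min P = (1 - \<alpha>) * rho_min P + \<alpha> * rho_min P" by (simp add: algebra_simps)
    also have "\<dots> \<le> (1 - \<alpha>) * ?r u + \<alpha> * ?r v"
      using assms by (intro add_mono mult_left_mono) auto
    finally have 1: "rho_min P \<le> (1 - \<alpha>) * ?r u + \<alpha> * ?r v" .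
    have "(1 - \<alpha>) * g_con P u + \<alpha> * g_con P v \<le> (1 - \<alpha>) * ?r u + \<alpha> * ?r v"
      using assms by (intro add_mono mult_left_mono) auto
    with 1 show "?r (u + \<alpha> *\<^sub>R (v - u)) \<le> (1 - \<alpha>) * ?r u + \<alpha> * ?r v"
      using g_combination[OF assms, of u v] by linarith
  qed simp
  also have "\<dots> \<le> (1 - \<alpha>) * l_cost P (?r u) + \<alpha> * l_cost P (?r v)"
    using convex_onD[OF convex_l, of \<alpha> "?r u" "?r v"] assms by simp
  finally show ?thesis by (simp add: stage_def)
qed

lemma final_state_add:
  "final_state P ts A (\<lambda>i. u i + \<alpha> *\<^sub>R v i) = final_state P ts A u + \<alpha> *\<^sub>R traj A (B_mat P ts) 0 v N"
  unfolding final_state_def by (rule traj_perturb)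

lemma final_state_diff:
  "traj A (B_mat P ts) 0 (\<lambda>i. v i - u i) N = final_state P ts A v - final_state P ts A u"
proof -
  have "(\<lambda>i. u i + 1 *\<^sub>R (v i - u i)) = v" by simp
  then show ?thesis using final_state_add[of ts A u 1 "\<lambda>i. v i - u i"] by simp
qed

lemma admissible_final: "u \<in> admissible P ts A \<Longrightarrow> m_cost P y_opt \<le> m_cost P (final_state P ts A u)"
  using y_opt(2) by (auto simp: admissible_def)

lemma step_len_total: "real N * step_len P ts = t_f P - ts"
  using N_pos by (simp add: step_len_def)

text \<open>The two phases together always last \<open>t_f P\<close>, so the lower bound is the same
  for every switching time.\<close>

lemma v_min_split: "v_min = m_cost P y_opt + step_len P ts * (\<Sum>i=1..N. l_min) + ts * l_min"
proof -
  have "step_len P ts * (\<Sum>i=1..N. l_min) = (real N * step_len P ts) * l_min" by simp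
  then show ?thesis unfolding step_len_total by (simp add: algebra_simps)
qed

text \<open>Splits the excess into a terminal part and stage parts. For admissible \<open>u\<close>
  and \<open>ts < t_f P\<close> all are nonnegative, so each is at most the total.\<close>

lemma reduced_cost_diff:
  "reduced_cost P ts A u - v_min = (m_cost P (final_state P ts A u) - m_cost P y_opt) +
     step_len P ts * (\<Sum>i=1..N. stage P (u i) - l_min)"
  unfolding v_min_split[of ts] reduced_cost_def by (simp add: sum_subtractf algebra_simps)

lemma
  assumes u: "u \<in> admissible P ts A" and ts: "ts < t_f P"
  shows v_min_le: "v_min \<le> reduced_cost P ts A u"
    and final_cost_le: "m_cost P (final_state P ts A u) - m_cost P y_opt \<le> reduced_cost P ts A u - v_min"
    and stage_cost_le: "i \<in> {1..N} \<Longrightarrow>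
      step_len P ts * (stage P (u i) - l_min) \<le> reduced_cost P ts A u - v_min"
proof -
  have h: "step_len P ts \<ge> 0" using ts N_pos by (simp add: step_len_def)
  have nn: "step_len P ts * (\<Sum>i=1..N. stage P (u i) - l_min) \<ge> 0"
    using h stage_ge by (intro mult_nonneg_nonneg sum_nonneg) auto
  show "v_min \<le> reduced_cost P ts A u"
    "m_cost P (final_state P ts A u) - m_cost P y_opt \<le> reduced_cost P ts A u - v_min"
    using reduced_cost_diff[of ts A u] nn admissible_final[OF u] by linarith+
  assume i: "i \<in> {1..N}"
  have "stage P (u i) - l_min \<le> (\<Sum>i=1..N. stage P (u i) - l_min)"
    using i stage_ge by (intro member_le_sum) auto
  then have "step_len P ts * (stage P (u i) - l_min) \<le> step_len P ts * (\<Sum>i=1..N. stage P (u i) - l_min)"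
    using h by (rule mult_left_mono)
  then show "step_len P ts * (stage P (u i) - l_min) \<le> reduced_cost P ts A u - v_min"
    using reduced_cost_diff[of ts A u] admissible_final[OF u] by linarith
qed

lemma feasible_reduced:
  assumes z: "(x, u, \<sigma>) \<in> feasible P ts A" and ts: "ts < t_f P"
  shows "u \<in> admissible P ts A" "reduced_cost P ts A u \<le> P9_cost P ts (x, u, \<sigma>)"
proof -
  have F: "(x, u, \<sigma>) \<in> F_zero P ts A" and V: "\<And>i. i \<in> {1..N} \<Longrightarrow>
      rho_min P \<le> \<sigma> i \<and> \<sigma> i \<le> rho_max P \<and> g_con P (u i) \<le> \<sigma> i"
    using z by (auto simp: feasible_def V_tilde_def)
  note fin = F_zero_final_state[OF F]
  show "u \<in> admissible P ts A"
    using V F unfolding admissible_def F_zero_iff fin by force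
  have h: "step_len P ts \<ge> 0" using ts N_pos by (simp add: step_len_def)
  have "step_len P ts * (\<Sum>i=1..N. stage P (u i)) \<le> (\<Sum>i=1..N. l_cost P (\<sigma> i) * step_len P ts)"
    unfolding sum_distrib_left
  proof (rule sum_mono)
    fix i assume "i \<in> {1..N}"
    then have "stage P (u i) \<le> l_cost P (\<sigma> i)" unfolding stage_def using V by (intro l_le) auto
    then show "step_len P ts * stage P (u i) \<le> l_cost P (\<sigma> i) * step_len P ts"
      using h by (simp add: mult.commute mult_left_mono)
  qed
  then show "reduced_cost P ts A u \<le> P9_cost P ts (x, u, \<sigma>)"
    unfolding reduced_cost_def P9_cost.simps fin by simp
qed

lemma reduced_feasible:
  assumes u: "u \<in> admissible P ts A"
  obtains x \<sigma> where "(x, u, \<sigma>) \<in> feasible P ts A" "P9_cost P ts (x, u, \<sigma>) = reduced_cost P ts A u"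
proof -
  define x where "x i = traj A (B_mat P ts) (x_init P ts) u (i - 1)" for i
  define \<sigma> where "\<sigma> i = max (rho_min P) (g_con P (u i))" for i
  have fin: "x (N + 1) = final_state P ts A u" by (simp add: x_def final_state_def)
  have "x (Suc i) = A *v x i + B_mat P ts *v u i" if i: "i \<in> {1..N}" for i
  proof -
    obtain k where "i = Suc k" using i by (cases i) auto
    then show ?thesis by (simp add: x_def)
  qed
  then have "(x, u, \<sigma>) \<in> F_zero P ts A"
    using u fin by (auto simp: F_zero_iff admissible_def x_def)
  moreover have "(x, u, \<sigma>) \<in> V_tilde P"
    using u rho_less by (auto simp: V_tilde_def \<sigma>_def admissible_def)
  moreover have "P9_cost P ts (x, u, \<sigma>) = reduced_cost P ts A u"
    using fin by (simp add: reduced_cost_def \<sigma>_def stage_def sum_distrib_left mult.commute)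
  ultimately show ?thesis using that by (auto simp: feasible_def)
qed

lemma P9_solution_reduced:
  assumes sol: "P9_solution P ts A (x, u, \<sigma>)" and ts: "ts < t_f P"
  shows "u \<in> admissible P ts A" "v \<in> admissible P ts A \<Longrightarrow> reduced_cost P ts A u \<le> reduced_cost P ts A v"
proof -
  have z: "(x, u, \<sigma>) \<in> feasible P ts A"
    and min: "\<And>y. y \<in> feasible P ts A \<Longrightarrow> P9_cost P ts (x, u, \<sigma>) \<le> P9_cost P ts y"
    using sol unfolding P9_solution_def optimal_in_def is_arg_min_linorder by auto
  show "u \<in> admissible P ts A" by (rule feasible_reduced(1)[OF z ts])
  assume "v \<in> admissible P ts A"
  then obtain x' \<sigma>' where "(x', v, \<sigma>') \<in> feasible P ts A" "P9_cost P ts (x', v, \<sigma>') = reduced_cost P ts A v"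
    by (rule reduced_feasible)
  with min[of "(x', v, \<sigma>')"] feasible_reduced(2)[OF z ts]
  show "reduced_cost P ts A u \<le> reduced_cost P ts A v" by simp
qed

lemma P9_solution_of_reduced:
  assumes u: "u \<in> admissible P ts A" and ts: "ts < t_f P"
    and min: "\<And>v. v \<in> admissible P ts A \<Longrightarrow> reduced_cost P ts A u \<le> reduced_cost P ts A v"
  shows "\<exists>z. P9_solution P ts A z"
proof -
  obtain x \<sigma> where z: "(x, u, \<sigma>) \<in> feasible P ts A" "P9_cost P ts (x, u, \<sigma>) = reduced_cost P ts A u"
    using u by (rule reduced_feasible)
  have "P9_cost P ts (x, u, \<sigma>) \<le> P9_cost P ts (x', u', \<sigma>')" if "(x', u', \<sigma>') \<in> feasible P ts A" for x' u' \<sigma>'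
    using feasible_reduced[OF that ts] min[of u'] z(2) by linarith
  with z(1) show ?thesis
    unfolding P9_solution_def optimal_in_def is_arg_min_linorder by (intro exI[of _ "(x, u, \<sigma>)"]) auto
qed

section \<open>Semicontinuity of the value and existence of solutions\<close>

lemma tendsto_final_state:
  assumes "(tf \<longlongrightarrow> ts) F" "(Af \<longlongrightarrow> A) F" "\<And>i. i \<in> {1..N} \<Longrightarrow> ((\<lambda>p. uf p i) \<longlongrightarrow> u i) F"
  shows "((\<lambda>p. final_state P (tf p) (Af p) (uf p)) \<longlongrightarrow> final_state P ts A u) F"
  unfolding final_state_def using continuous_B_mat[of P] continuous_x_init[of P]
  by (intro tendsto_traj assms)
    (auto simp: continuous_on_eq_continuous_at intro: isCont_tendsto_compose[OF _ assms(1)])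

lemma tendsto_reduced_cost:
  assumes "(tf \<longlongrightarrow> ts) F" "(Af \<longlongrightarrow> A) F" "\<And>i. i \<in> {1..N} \<Longrightarrow> ((\<lambda>p. uf p i) \<longlongrightarrow> u i) F"
  shows "((\<lambda>p. reduced_cost P (tf p) (Af p) (uf p)) \<longlongrightarrow> reduced_cost P ts A u) F"
proof -
  have "((\<lambda>p. step_len P (tf p)) \<longlongrightarrow> step_len P ts) F"
    using continuous_step_len[of P]
    by (auto simp: continuous_on_eq_continuous_at intro: isCont_tendsto_compose[OF _ assms(1)])
  then show ?thesis unfolding reduced_cost_def
    by (intro tendsto_intros isCont_tendsto_compose[OF isCont_m] isCont_tendsto_compose[OF isCont_stage]
        tendsto_final_state assms)
qed

lemma tendsto_G_final:
  assumes "(tf \<longlongrightarrow> ts) F" "(Af \<longlongrightarrow> A) F" "\<And>i. i \<in> {1..N} \<Longrightarrow> ((\<lambda>p. uf p i) \<longlongrightarrow> u i) F"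
  shows "((\<lambda>p. G_term P (final_state P (tf p) (Af p) (uf p))) \<longlongrightarrow> G_term P (final_state P ts A u)) F"
  by (intro isCont_tendsto_compose[OF isCont_G] tendsto_final_state assms)

text \<open>Restricting the controls to \<open>{1..N}\<close> places them in the compact
  \<open>control_set\<close>, so convergence is obtained on these indices only. The terminal
  constraint passes to the limit by joint continuity.\<close>

lemma admissible_subsequence:
  assumes "tf \<longlonglongrightarrow> ts" "Af \<longlonglongrightarrow> A" and adm: "\<And>k::nat. uf k \<in> admissible P (tf k) (Af k)"
  obtains r u where "strict_mono r" "u \<in> admissible P ts A"
    "\<And>i. i \<in> {1..N} \<Longrightarrow> (\<lambda>k. uf (r k) i) \<longlonglongrightarrow> u i"
proof -
  have "seq_compact (control_set P (rho_max P))"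
    using compact_controls compact_imp_seq_compact by blast
  moreover have "restrict (uf k) {1..N} \<in> control_set P (rho_max P)" for k
    using adm by (auto simp: control_set_def admissible_def)
  ultimately obtain u r where u: "u \<in> control_set P (rho_max P)" "strict_mono r"
    "((\<lambda>k. restrict (uf k) {1..N}) \<circ> r) \<longlonglongrightarrow> u"
    unfolding seq_compact_def by metis
  have lim: "(\<lambda>k. uf (r k) i) \<longlonglongrightarrow> u i" if "i \<in> {1..N}" for i
  proof -
    have "continuous_on UNIV (\<lambda>f::nat \<Rightarrow> real^'u. f i)" by (rule continuous_on_product_coordinates)
    then have "isCont (\<lambda>f::nat \<Rightarrow> real^'u. f i) u"
      unfolding continuous_on_eq_continuous_at[OF open_UNIV] by blast
    from isCont_tendsto_compose[OF this u(3)] show ?thesis using that by simp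
  qed
  have "(\<lambda>k. G_term P (final_state P (tf (r k)) (Af (r k)) (uf (r k)))) \<longlonglongrightarrow> G_term P (final_state P ts A u)"
    using LIMSEQ_subseq_LIMSEQ[OF assms(1) u(2), unfolded o_def]
      LIMSEQ_subseq_LIMSEQ[OF assms(2) u(2), unfolded o_def] lim
    by (rule tendsto_G_final)
  then have "G_term P (final_state P ts A u) = 0"
    using adm by (simp add: admissible_def LIMSEQ_const_iff)
  then have "u \<in> admissible P ts A" using u(1) by (auto simp: admissible_def control_set_def)
  with u(2) lim show ?thesis using that by blast
qed

text \<open>Lower semicontinuity of the value, phrased with witnesses so that no infimum over a
  possibly empty set occurs.\<close>

lemma reduced_cost_lsc:
  assumes "tf \<longlonglongrightarrow> ts" "Af \<longlonglongrightarrow> A" "c \<longlonglongrightarrow> c0" and adm: "\<And>k::nat. uf k \<in> admissible P (tf k) (Af k)"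
    and le: "\<And>k. reduced_cost P (tf k) (Af k) (uf k) \<le> c k"
  shows "\<exists>u\<in>admissible P ts A. reduced_cost P ts A u \<le> c0"
proof -
  obtain r u where r: "strict_mono r" "u \<in> admissible P ts A"
    "\<And>i. i \<in> {1..N} \<Longrightarrow> (\<lambda>k. uf (r k) i) \<longlonglongrightarrow> u i"
    using admissible_subsequence[OF assms(1,2) adm] by metis
  have "(\<lambda>k. reduced_cost P (tf (r k)) (Af (r k)) (uf (r k))) \<longlonglongrightarrow> reduced_cost P ts A u"
    using LIMSEQ_subseq_LIMSEQ[OF assms(1) r(1), unfolded o_def]
      LIMSEQ_subseq_LIMSEQ[OF assms(2) r(1), unfolded o_def] r(3)
    by (rule tendsto_reduced_cost)
  moreover have "(\<lambda>k. c (r k)) \<longlonglongrightarrow> c0" using LIMSEQ_subseq_LIMSEQ[OF assms(3) r(1)] by (simp add: o_def)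
  ultimately have "reduced_cost P ts A u \<le> c0" using le by (intro LIMSEQ_le) auto
  with r(2) show ?thesis by blast
qed

text \<open>The direct method: \<open>reduced_cost_lsc\<close> with constant data, applied to a
  minimizing sequence.\<close>

lemma ex_P9_solution:
  assumes ne: "admissible P ts A \<noteq> {}" and ts: "ts < t_f P"
  shows "\<exists>z. P9_solution P ts A z"
proof -
  let ?S = "reduced_cost P ts A ` admissible P ts A"
  have bdd: "bdd_below ?S" using v_min_le[OF _ ts] by (auto simp: bdd_below_def)
  have "\<exists>u\<in>admissible P ts A. reduced_cost P ts A u \<le> Inf ?S + 1 / real (Suc k)" for k
  proof -
    have "Inf ?S < Inf ?S + 1 / real (Suc k)" by simp
    from cInf_lessD[OF _ this] obtain s where "s \<in> ?S" "s < Inf ?S + 1 / real (Suc k)" using ne by blast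
    then show ?thesis by (blast intro: less_imp_le)
  qed
  then obtain uf where uf: "\<And>k. uf k \<in> admissible P ts A"
    "\<And>k. reduced_cost P ts A (uf k) \<le> Inf ?S + 1 / real (Suc k)" by metis
  have "(\<lambda>k. Inf ?S + 1 / real (Suc k)) \<longlonglongrightarrow> Inf ?S + 0"
    by (intro tendsto_intros LIMSEQ_Suc[OF lim_1_over_n])
  then have "(\<lambda>k. Inf ?S + 1 / real (Suc k)) \<longlonglongrightarrow> Inf ?S" by (simp only: add_0_right)
  from reduced_cost_lsc[where uf = uf, OF tendsto_const tendsto_const this uf]
  obtain u where "u \<in> admissible P ts A" "reduced_cost P ts A u \<le> Inf ?S"
    by blast
  moreover have "Inf ?S \<le> reduced_cost P ts A v" if "v \<in> admissible P ts A" for v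
    using that bdd by (intro cInf_lower) auto
  ultimately show ?thesis using P9_solution_of_reduced[OF _ ts] by fastforce
qed

text \<open>A feasible control is first moved towards the Slater point, where there is room to absorb the
  perturbed equality constraints by means of a fixed right inverse of the unperturbed ones.\<close>

lemma reduced_cost_usc:
  fixes F :: "'p filter"
  assumes lim: "(tf \<longlongrightarrow> ts) F" "(Af \<longlongrightarrow> A) F"
    and u0: "u0 \<in> admissible P ts A" and u1: "u1 \<in> admissible P ts A"
    and slater: "\<And>i. i \<in> {1..N} \<Longrightarrow> g_con P (u1 i) < rho_max P"
    and surj: "\<And>y. \<exists>v. L *v traj A (B_mat P ts) 0 v N = y"
    and c: "reduced_cost P ts A u0 < c"
  shows "\<forall>\<^sub>F p in F. \<exists>u\<in>admissible P (tf p) (Af p). reduced_cost P (tf p) (Af p) u < c"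
proof -
  define w where "w \<alpha> i = u0 i + \<alpha> *\<^sub>R (u1 i - u0 i)" for \<alpha> i
  have "((\<lambda>\<alpha>. w \<alpha> i) \<longlongrightarrow> u0 i + 0 *\<^sub>R (u1 i - u0 i)) (at_right 0)" for i
    unfolding w_def by (intro tendsto_intros)
  then have "((\<lambda>\<alpha>. reduced_cost P ts A (w \<alpha>)) \<longlongrightarrow> reduced_cost P ts A u0) (at_right 0)"
    by (intro tendsto_reduced_cost tendsto_const) simp
  then have "\<forall>\<^sub>F \<alpha> in at_right 0. reduced_cost P ts A (w \<alpha>) < c" using c by (rule order_tendstoD)
  moreover have "\<forall>\<^sub>F \<alpha>::real in at_right 0. 0 < \<alpha> \<and> \<alpha> < 1"
    by (rule eventually_at_rightI[of 0 1]) auto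
  ultimately have "\<forall>\<^sub>F \<alpha> in at_right 0. reduced_cost P ts A (w \<alpha>) < c \<and> 0 < \<alpha> \<and> \<alpha> < 1"
    by eventually_elim simp
  then obtain \<alpha> where \<alpha>: "reduced_cost P ts A (w \<alpha>) < c" "0 < \<alpha>" "\<alpha> < 1"
    using eventually_happens'[OF trivial_limit_at_right_real] by blast
  have gw: "g_con P (w \<alpha> i) < rho_max P" if i: "i \<in> {1..N}" for i
  proof -
    have "g_con P (w \<alpha> i) \<le> (1 - \<alpha>) * g_con P (u0 i) + \<alpha> * g_con P (u1 i)"
      unfolding w_def using \<alpha> by (intro g_combination) auto
    also have "\<dots> < (1 - \<alpha>) * rho_max P + \<alpha> * rho_max P"
      using \<alpha> slater[OF i] u0 i by (intro add_le_less_mono mult_left_mono mult_strict_left_mono)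
        (auto simp: admissible_def)
    finally show ?thesis by (simp add: algebra_simps)
  qed
  have Gw: "G_term P (final_state P ts A (w \<alpha>)) = 0"
  proof -
    have "L *v (final_state P ts A u1 - final_state P ts A u0) = 0"
      using G_add[of "final_state P ts A u0" "final_state P ts A u1 - final_state P ts A u0"] u0 u1
      by (simp add: admissible_def)
    then show ?thesis using u0
      unfolding w_def[abs_def] final_state_add final_state_diff
      by (simp add: G_add admissible_def matrix_vector_mult_scaleR)
  qed
  \<comment> \<open>Controls whose unperturbed responses are the unit vectors; their linear
    combinations \<open>R y\<close> form the right inverse.\<close>
  have "\<forall>k. \<exists>v. L *v traj A (B_mat P ts) 0 v N = axis k (1::real)" using surj by blast
  from choice[OF this] obtain v where v: "\<And>k. L *v traj A (B_mat P ts) 0 (v k) N = axis k (1::real)"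
    by blast
  define R where "R y i = (\<Sum>k\<in>UNIV. y $ k *\<^sub>R v k i)" for y :: "real^'g" and i
  define s where "s p k = L *v traj (Af p) (B_mat P (tf p)) 0 (v k) N" for p k
  \<comment> \<open>\<open>e p\<close> bounds the distance of the perturbed response
    \<open>S p\<close> from the identity. Below 1/2 it makes \<open>S p\<close> invertible with
    inverse of norm at most 2.\<close>
  define e where "e p = (\<Sum>k\<in>UNIV. norm (s p k - axis k 1))" for p
  have Bf: "((\<lambda>p. B_mat P (tf p)) \<longlongrightarrow> B_mat P ts) F"
    using continuous_B_mat[of P]
    by (auto simp: continuous_on_eq_continuous_at intro: isCont_tendsto_compose[OF _ lim(1)])
  have "(e \<longlongrightarrow> (\<Sum>k\<in>UNIV. norm (axis k (1::real) - axis k 1 :: real^'g))) F"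
    unfolding e_def s_def v[symmetric] by (intro tendsto_intros tendsto_traj lim Bf)
  then have "(e \<longlongrightarrow> 0) F" by simp
  then have e_small: "\<forall>\<^sub>F p in F. e p < 1 / 2" by (rule order_tendstoD) simp
  define S where "S p y = L *v traj (Af p) (B_mat P (tf p)) 0 (R y) N" for p y
  have S: "S p y = (\<Sum>k\<in>UNIV. y $ k *\<^sub>R s p k)" for p y
    unfolding S_def R_def s_def traj_0_sum traj_scaleR_0
    by (simp add: bounded_bilinear.sum_right[OF bounded_bilinear_matrix_vector_mult] matrix_vector_mult_scaleR)
  have S_diff: "norm (S p y - y) \<le> e p * norm y" for p y
  proof -
    have "y = (\<Sum>k\<in>UNIV. y $ k *\<^sub>R axis k 1)"
      using basis_expansion[of y] by (simp add: scalar_mult_eq_scaleR)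
    then have "S p y - y = (\<Sum>k\<in>UNIV. y $ k *\<^sub>R (s p k - axis k 1))"
      unfolding S by (simp add: sum_subtractf scaleR_diff_right)
    also have "norm \<dots> \<le> (\<Sum>k\<in>UNIV. norm y * norm (s p k - axis k 1))"
      by (intro sum_norm_le) (simp add: component_le_norm_cart mult_right_mono)
    finally show ?thesis by (simp add: e_def sum_distrib_left mult.commute[of _ "norm y"])
  qed
  \<comment> \<open>The condition on \<open>e p\<close> stays inside the existential, so that the
    correction can be chosen as a function of all \<open>p\<close>.\<close>
  have "\<exists>y. e p < 1 / 2 \<longrightarrow> S p y = - d \<and> norm y \<le> 2 * norm d" for p d
  proof (cases "e p < 1 / 2")
    case True
    have bound: "norm y \<le> 2 * norm (S p y)" for y
    proof -
      have "norm y \<le> norm (S p y) + norm (S p y - y)" using norm_triangle_sub[of y "S p y"] 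
        by (simp add: norm_minus_commute)
      also have "\<dots> \<le> norm (S p y) + 1 / 2 * norm y"
        using S_diff[of p y] True mult_right_mono[of "e p" "1 / 2" "norm y"] by simp
      finally show ?thesis by simp
    qed
    have "linear (S p)" by (rule linearI)
      (simp_all add: S scaleR_left_distrib sum.distrib scaleR_sum_right)
    moreover have "y = 0" if "S p y = 0" for y using bound[of y] that by simp
    then have "inj (S p)" using linear_injective_0[OF \<open>linear (S p)\<close>] by blast
    ultimately obtain y where "S p y = - d"
      using linear_injective_imp_surjective by (metis surjD)
    then show ?thesis using bound[of y] by (intro exI[of _ y]) simp
  qed simp
  then have "\<forall>p. \<exists>y. e p < 1 / 2 \<longrightarrow> S p y = - G_term P (final_state P (tf p) (Af p) (w \<alpha>)) \<and>
      norm y \<le> 2 * norm (G_term P (final_state P (tf p) (Af p) (w \<alpha>)))" by blast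
  from choice[OF this] obtain y where y: "\<And>p. e p < 1 / 2 \<Longrightarrow> S p (y p) = - G_term P (final_state P (tf p) (Af p) (w \<alpha>))"
    "\<And>p. e p < 1 / 2 \<Longrightarrow> norm (y p) \<le> 2 * norm (G_term P (final_state P (tf p) (Af p) (w \<alpha>)))" by blast
  have "((\<lambda>p. 2 * norm (G_term P (final_state P (tf p) (Af p) (w \<alpha>)))) \<longlongrightarrow>
      2 * norm (G_term P (final_state P ts A (w \<alpha>)))) F"
    by (intro tendsto_intros tendsto_G_final lim)
  then have "((\<lambda>p. 2 * norm (G_term P (final_state P (tf p) (Af p) (w \<alpha>)))) \<longlongrightarrow> 0) F"
    by (simp add: Gw)
  moreover have "\<forall>\<^sub>F p in F. norm (y p) \<le> 2 * norm (G_term P (final_state P (tf p) (Af p) (w \<alpha>)))"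
    using e_small by eventually_elim (rule y(2))
  ultimately have "(y \<longlongrightarrow> 0) F" by (rule Lim_null_comparison[rotated])
  define u where "u p i = w \<alpha> i + 1 *\<^sub>R R (y p) i" for p i
  have u_lim: "((\<lambda>p. u p i) \<longlongrightarrow> w \<alpha> i) F" for i
  proof -
    have "((\<lambda>p. u p i) \<longlongrightarrow> w \<alpha> i + 1 *\<^sub>R (\<Sum>k\<in>UNIV. 0 $ k *\<^sub>R v k i)) F"
      unfolding u_def R_def by (intro tendsto_intros \<open>(y \<longlongrightarrow> 0) F\<close>)
    then show ?thesis by simp
  qed
  have "\<forall>\<^sub>F p in F. \<forall>i\<in>{1..N}. g_con P (u p i) < rho_max P"
    using gw by (intro eventually_ball_finite ballI order_tendstoD(2)
        [OF isCont_tendsto_compose[OF isCont_g u_lim]]) auto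
  moreover have "\<forall>\<^sub>F p in F. reduced_cost P (tf p) (Af p) (u p) < c"
    by (rule order_tendstoD(2)[OF tendsto_reduced_cost[OF lim u_lim] \<alpha>(1)])
  ultimately show ?thesis using e_small
  proof eventually_elim
    case (elim p)
    have "G_term P (final_state P (tf p) (Af p) (u p)) = 0"
      using y(1)[OF elim(3)] unfolding u_def[abs_def] final_state_add by (simp add: G_add S_def)
    with elim show ?case by (intro bexI[of _ "u p"]) (auto simp: admissible_def less_imp_le)
  qed
qed

text \<open>If \<open>CARD('x)\<close> controls lay below \<open>rho_min\<close>, they could be moved at no cost so as to steer the
  final state towards the solution of (P7), while all others move towards \<open>u_s\<close>.\<close>

lemma card_below_rho_min:
  assumes u: "u \<in> admissible P ts A" and ts: "ts < t_f P"
    and min: "\<And>v. v \<in> admissible P ts A \<Longrightarrow> reduced_cost P ts A u \<le> reduced_cost P ts A v"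
    and gt: "v_min < reduced_cost P ts A u"
    and gram: "\<And>K. K \<subseteq> {..<N} \<Longrightarrow> card K = CARD('x) \<Longrightarrow>
      Determinants.det (gram K (\<lambda>k. mpow A k ** B_mat P ts)) \<noteq> 0"
  shows "card {i\<in>{1..N}. \<not> g_con P (u i) \<ge> rho_min P} \<le> CARD('x) - 1"
proof (rule ccontr)
  assume "\<not> ?thesis"
  then have "CARD('x) \<le> card {i\<in>{1..N}. \<not> g_con P (u i) \<ge> rho_min P}" by simp
  then obtain I where I: "I \<subseteq> {i\<in>{1..N}. \<not> g_con P (u i) \<ge> rho_min P}" "card I = CARD('x)" "finite I"
    by (rule obtain_subset_with_card_n)
  \<comment> \<open>Control \<open>i\<close> reaches the final state through
    \<open>mpow A (N - i) ** B_mat P ts\<close>; distinct stages give distinct exponents.\<close>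
  define K where "K = (\<lambda>i. N - i) ` I"
  have inj: "inj_on (\<lambda>i. N - i) I" 
  proof (rule inj_onI)
    fix i j assume "i \<in> I" "j \<in> I" "N - i = N - j"
    moreover from this have "i \<le> N" "j \<le> N" using I(1) by auto
    ultimately show "i = j" by linarith
  qed
  have "K \<subseteq> {..<N}" "card K = CARD('x)" using I inj by (auto simp: K_def card_image)
  from gram_surj[OF gram[OF this]] have surj: "\<exists>v. (\<Sum>k\<in>K. (mpow A k ** B_mat P ts) *v v k) = y" for y
    by metis
  define x where "x = final_state P ts A u"
  define w where "w i = (if i \<in> I then 0 else u_s P - u i)" for i
  \<comment> \<open>The controls in \<open>I\<close> both undo the effect of moving the others
    towards \<open>u_s\<close> and supply the displacement to \<open>y_opt\<close>.\<close>
  obtain v where v: "(\<Sum>k\<in>K. (mpow A k ** B_mat P ts) *v v k) = y_opt - x - traj A (B_mat P ts) 0 w N"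
    using surj by blast
  define v' where "v' i = (if i \<in> I then v (N - i) else 0)" for i
  have "traj A (B_mat P ts) 0 v' N = (\<Sum>i\<in>I. (mpow A (N - i) ** B_mat P ts) *v v' i)"
    unfolding traj_0_eq using I(1) by (intro sum.mono_neutral_right) (auto simp: v'_def)
  also have "\<dots> = (\<Sum>k\<in>K. (mpow A k ** B_mat P ts) *v v k)"
    unfolding K_def sum.reindex[OF inj] by (simp add: v'_def)
  finally have v'_traj: "traj A (B_mat P ts) 0 v' N = y_opt - x - traj A (B_mat P ts) 0 w N" using v by simp
  define d where "d i = w i + v' i" for i
  have d: "traj A (B_mat P ts) 0 d N = y_opt - x"
    using traj_add[of A "B_mat P ts" 0 0 w v' N] unfolding v'_traj d_def by simp
  have "((\<lambda>\<alpha>. g_con P (u i + \<alpha> *\<^sub>R d i)) \<longlongrightarrow> g_con P (u i + 0 *\<^sub>R d i)) (at_right 0)" for i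
    by (intro isCont_tendsto_compose[OF isCont_g] tendsto_intros)
  \<comment> \<open>The controls in \<open>I\<close> are strictly below \<open>rho_min\<close>, so a
    short step in any direction, however long \<open>d i\<close> is, leaves their stage cost at
    \<open>l_min\<close>.\<close>
  then have "\<forall>\<^sub>F \<alpha> in at_right 0. \<forall>i\<in>I. g_con P (u i + \<alpha> *\<^sub>R d i) < rho_min P"
    using I by (intro eventually_ball_finite ballI order_tendstoD(2)) auto
  moreover have "\<forall>\<^sub>F \<alpha>::real in at_right 0. 0 < \<alpha> \<and> \<alpha> < 1"
    by (rule eventually_at_rightI[of 0 1]) auto
  ultimately have "\<forall>\<^sub>F \<alpha> in at_right 0. (\<forall>i\<in>I. g_con P (u i + \<alpha> *\<^sub>R d i) < rho_min P) \<and> 0 < \<alpha> \<and> \<alpha> < 1"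
    by eventually_elim simp
  then obtain \<alpha> where \<alpha>: "\<And>i. i \<in> I \<Longrightarrow> g_con P (u i + \<alpha> *\<^sub>R d i) < rho_min P" "0 < \<alpha>" "\<alpha> < 1"
    using eventually_happens'[OF trivial_limit_at_right_real] by blast
  define u' where "u' i = u i + \<alpha> *\<^sub>R d i" for i
  have d_out: "d i = u_s P - u i" if "i \<notin> I" for i using that by (simp add: d_def w_def v'_def)
  have x': "final_state P ts A u' = x + \<alpha> *\<^sub>R (y_opt - x)"
    unfolding u'_def[abs_def] final_state_add d x_def ..
  have "G_term P x = 0" using u by (simp add: admissible_def x_def)
  then have "L *v (y_opt - x) = 0" using G_add[of x "y_opt - x"] y_opt(1) by simp
  then have "G_term P (final_state P ts A u') = 0"
    using \<open>G_term P x = 0\<close> by (simp add: x' G_add matrix_vector_mult_scaleR)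
  moreover have "g_con P (u' i) \<le> rho_max P" if i: "i \<in> {1..N}" for i
  proof (cases "i \<in> I")
    case True
    then show ?thesis using \<alpha>(1)[OF True] rho_less by (simp add: u'_def)
  next
    case False
    have "g_con P (u' i) \<le> (1 - \<alpha>) * g_con P (u i) + \<alpha> * rho_min P"
      using g_combination[of \<alpha> "u i" "u_s P"] \<alpha> g_u_s by (simp add: u'_def d_out[OF False])
    also have "\<dots> \<le> (1 - \<alpha>) * rho_max P + \<alpha> * rho_max P"
      using \<alpha> u i rho_less by (intro add_mono mult_left_mono) (auto simp: admissible_def)
    finally show ?thesis by (simp add: algebra_simps)
  qed
  ultimately have "u' \<in> admissible P ts A" by (simp add: admissible_def)
  from min[OF this] have le: "reduced_cost P ts A u - v_min \<le> reduced_cost P ts A u' - v_min" by simp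
  have "m_cost P (final_state P ts A u') \<le> (1 - \<alpha>) * m_cost P x + \<alpha> * m_cost P y_opt"
  proof -
    have "x + \<alpha> *\<^sub>R (y_opt - x) = (1 - \<alpha>) *\<^sub>R x + \<alpha> *\<^sub>R y_opt" by (simp add: algebra_simps)
    then show ?thesis unfolding x' using convex_onD[OF convex_m, of \<alpha> x y_opt] \<alpha> by simp
  qed
  then have m': "m_cost P (final_state P ts A u') - m_cost P y_opt \<le> (1 - \<alpha>) * (m_cost P x - m_cost P y_opt)"
    by (simp add: algebra_simps)
  have "stage P (u' i) - l_min \<le> (1 - \<alpha>) * (stage P (u i) - l_min)" for i
  proof (cases "i \<in> I")
    case True
    then show ?thesis using \<alpha>(1)[OF True] I(1) by (auto simp: u'_def stage_eq)
  next
    case False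
    then show ?thesis
      using stage_combination[of \<alpha> "u i" "u_s P"] \<alpha> g_u_s
      by (simp add: u'_def d_out[OF False] stage_eq algebra_simps)
  qed
  then have "(\<Sum>i=1..N. stage P (u' i) - l_min) \<le> (1 - \<alpha>) * (\<Sum>i=1..N. stage P (u i) - l_min)"
    unfolding sum_distrib_left by (intro sum_mono)
  moreover have "step_len P ts \<ge> 0" using ts N_pos by (simp add: step_len_def)
  ultimately have "step_len P ts * (\<Sum>i=1..N. stage P (u' i) - l_min) \<le>
      step_len P ts * ((1 - \<alpha>) * (\<Sum>i=1..N. stage P (u i) - l_min))" by (rule mult_left_mono)
  \<comment> \<open>Every part of the excess shrinks at least by the factor
    \<open>1 - \<alpha>\<close>, which contradicts optimality when the excess is positive.\<close>
  with m' have "reduced_cost P ts A u' - v_min \<le> (1 - \<alpha>) * (reduced_cost P ts A u - v_min)"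
    unfolding reduced_cost_diff x_def by (simp add: algebra_simps)
  also have "\<dots> < reduced_cost P ts A u - v_min" 
  proof -
    have "(1 - \<alpha>) * D < D" if "D > 0" for D :: real using that \<alpha>(2) by (simp add: algebra_simps)
    then show ?thesis using gt by (simp only: diff_gt_0_iff_gt)
  qed
  finally show False using le by simp
qed

text \<open>The first claim is upper semicontinuity. The others follow by compactness: violating
  controls for matrices tending to \<open>A\<close> would accumulate at an admissible control for
  \<open>A\<close>, where the excess is positive, the residual is zero and the two final costs
  agree.\<close>

lemma stable_neighbourhood:
  assumes u0: "u0 \<in> admissible P ts A" "reduced_cost P ts A u0 < c"
    and u1: "\<exists>u1\<in>admissible P ts A. \<forall>i\<in>{1..N}. g_con P (u1 i) < rho_max P"
    and surj: "\<And>y. \<exists>v. L *v traj A (B_mat P ts) 0 v N = y"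
    and above: "\<And>u. u \<in> admissible P ts A \<Longrightarrow> v_min < reduced_cost P ts A u"
    and \<epsilon>: "\<epsilon> > 0"
  shows "\<exists>r>0. \<forall>A'. dist A' A < r \<longrightarrow>
    (\<exists>u\<in>admissible P ts A'. reduced_cost P ts A' u < c) \<and>
    (\<forall>u\<in>admissible P ts A'. v_min < reduced_cost P ts A' u \<and>
      norm (G_term P (final_state P ts A u)) < \<epsilon> \<and>
      m_cost P (final_state P ts A u) < m_cost P (final_state P ts A' u) + \<epsilon>)"
proof -
  obtain u1 where u1: "u1 \<in> admissible P ts A" "\<And>i. i \<in> {1..N} \<Longrightarrow> g_con P (u1 i) < rho_max P"
    using u1 by blast
  have 1: "\<forall>\<^sub>F A' in nhds A. \<exists>u\<in>admissible P ts A'. reduced_cost P ts A' u < c"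
    by (rule reduced_cost_usc[OF tendsto_const _ u0(1) u1 surj u0(2)]) (rule filterlim_ident)
  have 2: "\<forall>\<^sub>F A' in nhds A. \<forall>u\<in>admissible P ts A'. v_min < reduced_cost P ts A' u"
  proof (rule eventually_nhds_sequentiallyI, rule ccontr)
    fix f assume f: "f \<longlonglongrightarrow> A"
      and "\<not> (\<exists>n. \<forall>u\<in>admissible P ts (f n). v_min < reduced_cost P ts (f n) u)"
    then have "\<forall>n. \<exists>u. u \<in> admissible P ts (f n) \<and> reduced_cost P ts (f n) u \<le> v_min"
      by (meson not_le_imp_less)
    then obtain uf where "\<And>n. uf n \<in> admissible P ts (f n)"
      "\<And>n. reduced_cost P ts (f n) (uf n) \<le> v_min" by metis
    from reduced_cost_lsc[where uf = uf, OF tendsto_const f tendsto_const this] above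
    show False by fastforce
  qed
  have 3: "\<forall>\<^sub>F A' in nhds A. \<forall>u\<in>admissible P ts A'.
      norm (G_term P (final_state P ts A u)) < \<epsilon> \<and>
      m_cost P (final_state P ts A u) < m_cost P (final_state P ts A' u) + \<epsilon>"
  proof (rule eventually_nhds_sequentiallyI, rule ccontr)
    fix f assume f: "f \<longlonglongrightarrow> A"
    let ?bad = "\<lambda>n u. \<not> (norm (G_term P (final_state P ts A u)) < \<epsilon> \<and>
      m_cost P (final_state P ts A u) < m_cost P (final_state P ts (f n) u) + \<epsilon>)"
    assume "\<not> (\<exists>n. \<forall>u\<in>admissible P ts (f n). norm (G_term P (final_state P ts A u)) < \<epsilon> \<and>
      m_cost P (final_state P ts A u) < m_cost P (final_state P ts (f n) u) + \<epsilon>)"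
    then have "\<forall>n. \<exists>u. u \<in> admissible P ts (f n) \<and> ?bad n u" by blast
    from choice[OF this] obtain uf where uf: "\<And>n. uf n \<in> admissible P ts (f n)" and bad: "\<And>n. ?bad n (uf n)"
      by blast
    obtain r u where r: "strict_mono r" and u: "u \<in> admissible P ts A"
      and lim: "\<And>i. i \<in> {1..N} \<Longrightarrow> (\<lambda>k. uf (r k) i) \<longlonglongrightarrow> u i"
      using admissible_subsequence[where uf = uf, OF tendsto_const f uf] by blast
    note fr = LIMSEQ_subseq_LIMSEQ[OF f r, unfolded o_def]
    have "(\<lambda>k. norm (G_term P (final_state P ts A (uf (r k))))) \<longlonglongrightarrow>
        norm (G_term P (final_state P ts A u))"
      by (intro tendsto_norm tendsto_G_final tendsto_const lim)
    then have "\<forall>\<^sub>F k in sequentially. norm (G_term P (final_state P ts A (uf (r k)))) < \<epsilon>"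
      by (rule order_tendstoD) (use u \<epsilon> in \<open>simp add: admissible_def\<close>)
    moreover
    have "(\<lambda>k. m_cost P (final_state P ts A (uf (r k))) - m_cost P (final_state P ts (f (r k)) (uf (r k))))
        \<longlonglongrightarrow> m_cost P (final_state P ts A u) - m_cost P (final_state P ts A u)"
      by (intro tendsto_diff isCont_tendsto_compose[OF isCont_m] tendsto_final_state tendsto_const fr lim)
    then have "\<forall>\<^sub>F k in sequentially.
        m_cost P (final_state P ts A (uf (r k))) - m_cost P (final_state P ts (f (r k)) (uf (r k))) < \<epsilon>"
      by (rule order_tendstoD) (use \<epsilon> in simp)
    ultimately have "\<forall>\<^sub>F k in sequentially. \<not> ?bad (r k) (uf (r k))"
      by eventually_elim auto
    then show False using bad by (simp add: eventually_False)
  qed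
  from 1 2 3 have "\<forall>\<^sub>F A' in nhds A. (\<exists>u\<in>admissible P ts A'. reduced_cost P ts A' u < c) \<and>
    (\<forall>u\<in>admissible P ts A'. v_min < reduced_cost P ts A' u \<and>
      norm (G_term P (final_state P ts A u)) < \<epsilon> \<and>
      m_cost P (final_state P ts A u) < m_cost P (final_state P ts A' u) + \<epsilon>)"
    by eventually_elim blast
  then show ?thesis unfolding eventually_nhds_metric .
qed

text \<open>The switching time is chosen just after the last one whose optimal value is still minimal.\<close>

lemma ex_switching_time:
  assumes tb: "0 \<le> tb"
    and start: "\<exists>u\<in>admissible P 0 (A_mat P 0). reduced_cost P 0 (A_mat P 0) u \<le> v_min"
    and stop: "\<And>u. u \<in> admissible P tb (A_mat P tb) \<Longrightarrow> v_min < reduced_cost P tb (A_mat P tb) u"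
    and slater: "\<And>ts. ts \<in> {0..tb} \<Longrightarrow>
      \<exists>u1\<in>admissible P ts (A_mat P ts). \<forall>i\<in>{1..N}. g_con P (u1 i) < rho_max P"
    and surj: "\<And>ts y. ts \<in> {0..tb} \<Longrightarrow> \<exists>v. L *v traj (A_mat P ts) (B_mat P ts) 0 v N = y"
    and c: "v_min < c"
  obtains ts where "ts \<in> {0..tb}"
    "\<exists>u\<in>admissible P ts (A_mat P ts). reduced_cost P ts (A_mat P ts) u < c"
    "\<And>u. u \<in> admissible P ts (A_mat P ts) \<Longrightarrow> v_min < reduced_cost P ts (A_mat P ts) u"
proof -
  \<comment> \<open>The times at which the value is still minimal. Lower semicontinuity makes the
    supremum belong to \<open>T\<close>, and \<open>stop\<close> keeps it below
    \<open>tb\<close>.\<close>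
  define T where "T = {ts \<in> {0..tb}. \<exists>u\<in>admissible P ts (A_mat P ts). reduced_cost P ts (A_mat P ts) u \<le> v_min}"
  define t0 where "t0 = Sup T"
  have "0 \<in> {0..tb}" using tb by simp
  with start have "0 \<in> T" unfolding T_def by blast
  have "T \<subseteq> {0..tb}" unfolding T_def by blast
  then have bdd: "bdd_above T" by (rule bdd_above_mono[rotated]) simp
  have A_lim: "(A_mat P \<longlongrightarrow> A_mat P t) (at t within S)" for t S
  proof -
    have "(A_mat P \<longlongrightarrow> A_mat P t) (at t)" using continuous_A_mat[of P] unfolding continuous_on_def by blast
    then show ?thesis by (rule tendsto_within_subset) simp
  qed
  have A_seq: "(\<lambda>k. A_mat P (tf k)) \<longlonglongrightarrow> A_mat P t" if "tf \<longlonglongrightarrow> t" for tf :: "nat \<Rightarrow> real" and t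
  proof -
    have "isCont (A_mat P) t"
      using continuous_A_mat[of P] unfolding continuous_on_eq_continuous_at[OF open_UNIV] by blast
    then show ?thesis using that by (rule isCont_tendsto_compose)
  qed
  have "\<exists>t\<in>T. t0 - 1 / real (Suc k) \<le> t" for k
  proof -
    have "t0 - 1 / real (Suc k) < Sup T" by (simp add: t0_def)
    then obtain t where "t \<in> T" "t0 - 1 / real (Suc k) < t"
      by (rule less_cSupE) (use \<open>0 \<in> T\<close> in blast)
    then show ?thesis by (blast intro: less_imp_le)
  qed
  then have "\<forall>k. \<exists>t. t \<in> T \<and> t0 - 1 / real (Suc k) \<le> t" by blast
  from choice[OF this] obtain tf where
    tf: "\<And>k. tf k \<in> T" "\<And>k. t0 - 1 / real (Suc k) \<le> tf k" by blast
  have tf_le: "tf k \<le> t0" for k unfolding t0_def by (rule cSup_upper[OF tf(1) bdd])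
  have "(\<lambda>k. t0 - 1 / real (Suc k)) \<longlonglongrightarrow> t0 - 0"
    by (intro tendsto_intros LIMSEQ_Suc[OF lim_1_over_n])
  then have low: "(\<lambda>k. t0 - 1 / real (Suc k)) \<longlonglongrightarrow> t0" by (simp only: diff_0_right)
  have "tf \<longlonglongrightarrow> t0"
    by (rule tendsto_sandwich[OF _ _ low tendsto_const]) (use tf(2) tf_le in auto)
  have "0 \<le> t0" unfolding t0_def by (rule cSup_upper[OF \<open>0 \<in> T\<close> bdd])
  moreover have "t0 \<le> tb" unfolding t0_def
    by (rule cSup_least) (use \<open>0 \<in> T\<close> \<open>T \<subseteq> {0..tb}\<close> in auto)
  ultimately have t0_mem: "t0 \<in> {0..tb}" by simp
  have "\<forall>k. \<exists>u. u \<in> admissible P (tf k) (A_mat P (tf k)) \<and>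
      reduced_cost P (tf k) (A_mat P (tf k)) u \<le> v_min"
    using tf(1) unfolding T_def by blast
  from choice[OF this] obtain uf where uf: "\<And>k. uf k \<in> admissible P (tf k) (A_mat P (tf k))"
    "\<And>k. reduced_cost P (tf k) (A_mat P (tf k)) (uf k) \<le> v_min" by blast
  obtain u0 where u0: "u0 \<in> admissible P t0 (A_mat P t0)" "reduced_cost P t0 (A_mat P t0) u0 \<le> v_min"
    using reduced_cost_lsc[where uf = uf, OF \<open>tf \<longlonglongrightarrow> t0\<close> A_seq[OF \<open>tf \<longlonglongrightarrow> t0\<close>] tendsto_const uf]
    by blast
  have "t0 \<noteq> tb"
  proof
    assume "t0 = tb"
    then show False using stop[of u0] u0 by simp
  qed
  with t0_mem have "t0 < tb" by simp
  obtain u1 where u1: "u1 \<in> admissible P t0 (A_mat P t0)" "\<And>i. i \<in> {1..N} \<Longrightarrow> g_con P (u1 i) < rho_max P"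
    using slater[OF t0_mem] by blast
  have u0_c: "reduced_cost P t0 (A_mat P t0) u0 < c" using u0(2) c by simp
  \<comment> \<open>Upper semicontinuity at the last minimal time keeps the value below
    \<open>c\<close> shortly afterwards, while leaving \<open>T\<close> makes it exceed
    \<open>v_min\<close>.\<close>
  have "\<forall>\<^sub>F t in at_right t0. \<exists>u\<in>admissible P t (A_mat P t). reduced_cost P t (A_mat P t) u < c"
    by (rule reduced_cost_usc[where tf = "\<lambda>t. t" and Af = "A_mat P" and F = "at_right t0",
        OF tendsto_ident_at A_lim u0(1) u1 surj[OF t0_mem] u0_c])
  moreover have "\<forall>\<^sub>F t in at_right t0. t0 < t \<and> t < tb"
    by (rule eventually_at_rightI[of t0 tb]) (use \<open>t0 < tb\<close> in auto)
  ultimately have "\<forall>\<^sub>F t in at_right t0.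
      (\<exists>u\<in>admissible P t (A_mat P t). reduced_cost P t (A_mat P t) u < c) \<and> t0 < t \<and> t < tb"
    by eventually_elim blast
  then obtain t where t: "\<exists>u\<in>admissible P t (A_mat P t). reduced_cost P t (A_mat P t) u < c" "t0 < t" "t < tb"
    using eventually_happens'[OF trivial_limit_at_right_real] by blast
  have t_mem: "t \<in> {0..tb}" using t(2,3) t0_mem by simp
  have "t \<notin> T"
  proof
    assume "t \<in> T"
    then have "t \<le> t0" unfolding t0_def by (rule cSup_upper[OF _ bdd])
    with t(2) show False by simp
  qed
  have "v_min < reduced_cost P t (A_mat P t) u" if u: "u \<in> admissible P t (A_mat P t)" for u
  proof (rule ccontr)
    assume "\<not> ?thesis"
    then have "reduced_cost P t (A_mat P t) u \<le> v_min" by (rule leI)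
    with u t_mem have "t \<in> T" unfolding T_def by blast
    with \<open>t \<notin> T\<close> show False by blast
  qed
  with t_mem t(1) show ?thesis by (rule that)
qed

end

section \<open>The perturbed problem\<close>

theorem theorem30:
  fixes P :: "('x::finite, 'u::finite, 'g::finite) two_phase"
    and li :: "nat \<Rightarrow> real \<Rightarrow> real"
    and L\<^sub>l \<epsilon> :: real
  assumes data: "standing P"
    and stage_costs: "P4_stage_costs P li"
    and long: "A_long P li"
    and L\<^sub>l_pos: "L\<^sub>l > 0"
    and slope: "\<And>s. s \<in> {rho_min P..rho_max P} \<Longrightarrow> deriv (l_cost P) s > L\<^sub>l"
    and eps: "\<epsilon> > 0"
  shows "\<exists>ts \<delta> :: real. \<delta> > 0 \<and>
    (\<forall>Qi bs Q. jordan_decomposition (A_mat P ts) Qi bs Q \<longrightarrow>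
      (let eigs = spectrum (cmat_of (A_mat P ts));
           At = (\<lambda>q. Re_mat (perturbed Qi bs Q q) :: real^'x^'x)
       in (\<forall>q. L2_set q eigs < \<delta> \<and> elements_mat (perturbed Qi bs Q q) \<subseteq> \<real> \<longrightarrow>
             (\<exists>z. P9_solution P ts (At q) z) \<and>
             (\<forall>x u \<sigma>. P9_solution P ts (At q) (x, u, \<sigma>) \<longrightarrow>
                norm (G_term P (propagate P ts u (N_stages P))) \<le> \<epsilon> \<and>
                (\<forall>i\<in>{1..N_stages P}. g_con P (u i) < rho_min P + \<epsilon>) \<and>
                ereal (m_cost P (propagate P ts u (N_stages P))) < P7_value P + ereal \<epsilon>)) \<and>
          (\<forall>e>0. (\<forall>q\<in>cube eigs e. L2_set q eigs < \<delta>) \<longrightarrow>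
             (AE q in uniform_cube eigs e.
                \<forall>x u \<sigma>. P9_solution P ts (At (tie_conjugates q)) (x, u, \<sigma>) \<longrightarrow>
                  card {i\<in>{1..N_stages P}. \<not> g_con P (u i) \<ge> rho_min P} \<le> CARD('x) - 1))))"
proof -
  obtain x0 u0 \<sigma>0 where opt0: "optimal_in (P4_cost P li) (feasible P 0 (A_mat P 0)) (x0, u0, \<sigma>0)"
    and \<sigma>0: "\<And>i. i \<in> {1..N_stages P} \<Longrightarrow> \<sigma>0 i = rho_min P"
    and opt7: "optimal_in (m_cost P) (P7_feasible P) (x0 (N_stages P + 1))"
    using long unfolding A_long_def long_horizon_def by blast
  obtain tb where tb: "tb \<ge> 0" "P9_value P tb > P7_value P + ereal (t_f P * l_cost P (rho_min P))"
    and reg: "\<And>ts. ts \<in> {0..tb} \<Longrightarrow> P9_regular P ts"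
    using long unfolding A_long_def by blast
  define y_opt where "y_opt = x0 (N_stages P + 1)"
  have z0: "(x0, u0, \<sigma>0) \<in> feasible P 0 (A_mat P 0)"
    using opt0 by (simp add: optimal_in_def is_arg_min_def)
  have y_feas: "G_term P y_opt = 0"
    using opt7 by (simp add: optimal_in_def is_arg_min_def y_opt_def P7_feasible_def)
  have y_min: "m_cost P y_opt \<le> m_cost P y" if "G_term P y = 0" for y
    using opt7 that unfolding optimal_in_def is_arg_min_linorder y_opt_def P7_feasible_def by blast
  have std: "t_f P > 0" "N_stages P \<ge> 1" using data by (simp_all add: standing_def)
  note reg' = reg[unfolded P9_regular_def]
  have h_pos: "step_len P ts > 0" if "ts < t_f P" for ts
    using that std by (simp add: step_len_def)
  have mono_step: "strict_mono_on {rho_min P..} (\<lambda>s. l_cost P s * step_len P ts)" if "ts \<in> {0..tb}" for ts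
    using reg'[OF that] by blast
  have l_mono: "strict_mono_on {rho_min P..} (l_cost P)"
  proof (rule strict_mono_onI)
    fix a b assume ab: "a \<in> {rho_min P..}" "b \<in> {rho_min P..}" "a < b"
    have "0 \<in> {0..tb}" using tb(1) by simp
    from strict_mono_onD[OF mono_step[OF this] ab]
    show "l_cost P a < l_cost P b" by (rule mult_right_less_imp_less) (simp add: h_pos less_imp_le std)
  qed
  \<comment> \<open>Both \<open>l\<close> and its multiple by the step length at \<open>tb\<close>
    are strictly increasing, so this step length is positive.\<close>
  have tb_less: "tb < t_f P"
  proof -
    have "l_cost P (rho_min P) * step_len P tb < l_cost P (rho_min P + 1) * step_len P tb"
      by (rule strict_mono_onD[OF mono_step[of tb]]) (use tb(1) in auto)
    moreover have "l_cost P (rho_min P) < l_cost P (rho_min P + 1)"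
      by (rule strict_mono_onD[OF l_mono]) auto
    ultimately have "step_len P tb > 0"
      using mult_right_mono_neg[of "l_cost P (rho_min P)" "l_cost P (rho_min P + 1)" "step_len P tb"] by linarith
    then show ?thesis using std by (simp add: step_len_def zero_less_divide_iff)
  qed
  have slater: "interior (V_tilde P) \<inter> F_zero P ts (A_mat P ts) \<noteq> {}" if "ts \<in> {0..tb}" for ts
    using reg'[OF that] by blast
  have "0 \<in> {0..tb}" using tb(1) by simp
  interpret long_horizon_problem P y_opt
  proof
    show "rho_min P < rho_max P" using slater_point(1)[OF slater[OF \<open>0 \<in> {0..tb}\<close>] std(2)] .
    show "compact (control_set P (rho_max P))" using reg'[OF \<open>0 \<in> {0..tb}\<close>] by blast
  qed (fact data l_mono y_feas y_min)+
  have P7: "P7_value P = ereal (m_cost P y_opt)"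
    unfolding P7_value_def opt_value_def P7_feasible_def
    by (intro antisym INF_lower INF_greatest) (use y_feas y_min in auto)
  \<comment> \<open>At \<open>ts = 0\<close> the constraints are those of (P4). The optimal point
    there has \<sigma> at \<open>rho_min\<close>, hence g at most \<open>rho_min\<close>, and its
    final state solves (P7): the excess is zero.\<close>
  have start: "\<exists>u\<in>admissible P 0 (A_mat P 0). reduced_cost P 0 (A_mat P 0) u \<le> v_min"
  proof (rule bexI)
    show "u0 \<in> admissible P 0 (A_mat P 0)" by (rule feasible_reduced(1)[OF z0 std(1)])
    have "final_state P 0 (A_mat P 0) u0 = y_opt"
      using F_zero_final_state[of x0 u0 \<sigma>0 P 0 "A_mat P 0"] z0 by (simp add: feasible_def y_opt_def)
    moreover have "stage P (u0 i) = l_min" if "i \<in> {1..N}" for i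
    proof (rule stage_eq)
      have "g_con P (u0 i) \<le> \<sigma>0 i" using z0 that by (simp add: feasible_def V_tilde_def)
      then show "g_con P (u0 i) \<le> rho_min P" using \<sigma>0[OF that] by simp
    qed
    ultimately have "reduced_cost P 0 (A_mat P 0) u0 - v_min = 0"
      unfolding reduced_cost_diff by simp
    then show "reduced_cost P 0 (A_mat P 0) u0 \<le> v_min" by simp
  qed
  have stop: "v_min < reduced_cost P tb (A_mat P tb) u" if u: "u \<in> admissible P tb (A_mat P tb)" for u
  proof -
    obtain x \<sigma> where z: "(x, u, \<sigma>) \<in> feasible P tb (A_mat P tb)"
      "P9_cost P tb (x, u, \<sigma>) = reduced_cost P tb (A_mat P tb) u"
      using u by (rule reduced_feasible)
    have "P9_value P tb \<le> ereal (P9_cost P tb (x, u, \<sigma>))"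
      unfolding P9_value_def opt_value_def by (rule INF_lower[OF z(1)])
    with tb(2) have "ereal v_min < ereal (reduced_cost P tb (A_mat P tb) u)"
      unfolding P7 z(2) by (simp only: plus_ereal.simps(1) less_le_trans)
    then show ?thesis by simp
  qed
  have surj: "\<exists>v. L *v traj (A_mat P ts) (B_mat P ts) 0 v N = y" if "ts \<in> {0..tb}" for ts y
  proof -
    have "F_full_row_rank P ts" using reg'[OF that] by blast
    from full_row_rank_surj[OF G_eq this] show ?thesis by metis
  qed
  \<comment> \<open>The step length decreases in \<open>ts\<close>, so its value at
    \<open>tb\<close> is a lower bound that is available before \<open>ts\<close> is chosen.\<close>
  define h where "h = step_len P tb"
  have "h > 0" unfolding h_def by (rule h_pos[OF tb_less])
  \<comment> \<open>One half of \<epsilon> is for the terminal excess, the other for propagating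
    with \<open>A\<close> in place of the perturbed matrix. The second bound makes a stage excess
    keep g within \<epsilon> of \<open>rho_min\<close>.\<close>
  define \<eta> where "\<eta> = min (\<epsilon> / 2) (h * L\<^sub>l * \<epsilon>)"
  have \<eta>: "\<eta> > 0" "\<eta> \<le> \<epsilon> / 2" "\<eta> \<le> h * L\<^sub>l * \<epsilon>"
    using eps L\<^sub>l_pos \<open>h > 0\<close> by (auto simp: \<eta>_def)
  obtain ts where ts: "ts \<in> {0..tb}"
    and below: "\<exists>u\<in>admissible P ts (A_mat P ts). reduced_cost P ts (A_mat P ts) u < v_min + \<eta>"
    and above: "\<And>u. u \<in> admissible P ts (A_mat P ts) \<Longrightarrow> v_min < reduced_cost P ts (A_mat P ts) u"
  proof (rule ex_switching_time[OF tb(1) start stop])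
    show "\<exists>u1\<in>admissible P ts (A_mat P ts). \<forall>i\<in>{1..N}. g_con P (u1 i) < rho_max P"
      if "ts \<in> {0..tb}" for ts
      by (rule slater_point(2)[OF slater[OF that] std(2)])
  qed (use surj \<eta>(1) in auto)
  have ts_less: "ts < t_f P" using ts tb_less by simp
  have h_le: "h \<le> step_len P ts"
    using ts std(2) by (simp add: h_def step_len_def divide_right_mono)
  define A where "A = A_mat P ts"
  obtain ub where ub: "ub \<in> admissible P ts A" "reduced_cost P ts A ub < v_min + \<eta>"
    using below unfolding A_def by blast
  have "\<epsilon> / 2 > 0" using eps by simp
  from stable_neighbourhood[OF ub[unfolded A_def]
      slater_point(2)[OF slater[OF ts] std(2)] surj[OF ts] above this, folded A_def]
  obtain r where r: "r > 0" and near: "\<forall>A'. dist A' A < r \<longrightarrow>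
    (\<exists>u\<in>admissible P ts A'. reduced_cost P ts A' u < v_min + \<eta>) \<and>
    (\<forall>u\<in>admissible P ts A'. v_min < reduced_cost P ts A' u \<and>
      norm (G_term P (final_state P ts A u)) < \<epsilon> / 2 \<and>
      m_cost P (final_state P ts A u) < m_cost P (final_state P ts A' u) + \<epsilon> / 2)"
    by blast
  define S where "S = spectrum (cmat_of A)"
  have S: "finite S" "S \<noteq> {}" "\<And>a. a \<in> S \<Longrightarrow> cnj a \<in> S"
    using spectrum_cmat_of[of A] cnj_spectrum[of _ A] by (auto simp: S_def)
  obtain E :: "complex \<Rightarrow> real^'x^'x" where
    E: "\<And>Qi bs Q q. jordan_decomposition A Qi bs Q \<Longrightarrow>
      Re_mat (perturbed Qi bs Q q) = A + (\<Sum>a\<in>S. q a *\<^sub>R E a)"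
    and E1: "\<And>Qi bs Q. jordan_decomposition A Qi bs Q \<Longrightarrow>
      (\<Sum>a\<in>S. E a) = Finite_Cartesian_Product.mat 1"
    unfolding S_def using perturbed_affine[of A] by blast
  \<comment> \<open>The summand 1 keeps the denominator positive and provides the strict inequality
    in \<open>close\<close>.\<close>
  define \<delta> where "\<delta> = r / (1 + (\<Sum>a\<in>S. norm (E a)))"
  have sumE: "(\<Sum>a\<in>S. norm (E a)) \<ge> 0" by (intro sum_nonneg) simp
  then have "\<delta> > 0" using r by (simp add: \<delta>_def)
  \<comment> \<open>Stated with coordinatewise bounds because tying conjugates preserves these,
    whereas it may increase the Euclidean norm.\<close>
  have close: "dist (A + (\<Sum>a\<in>S. q a *\<^sub>R E a)) A < r" if "\<And>a. a \<in> S \<Longrightarrow> \<bar>q a\<bar> \<le> \<delta>" for q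
  proof -
    have "norm (\<Sum>a\<in>S. q a *\<^sub>R E a) \<le> (\<Sum>a\<in>S. \<delta> * norm (E a))"
      using that by (intro sum_norm_le) (simp add: mult_right_mono)
    also have "\<dots> < \<delta> * (1 + (\<Sum>a\<in>S. norm (E a)))"
      using \<open>\<delta> > 0\<close> by (simp add: sum_distrib_left[symmetric] algebra_simps)
    also have "\<dots> = r" using sumE by (simp add: \<delta>_def)
    finally show ?thesis by (simp add: dist_norm)
  qed
  have sol: "u \<in> admissible P ts A' \<and> reduced_cost P ts A' u < v_min + \<eta>"
    if "P9_solution P ts A' (x, u, \<sigma>)" "dist A' A < r" for A' x u \<sigma>
    using P9_solution_reduced[OF that(1) ts_less] near that(2) by (meson order_le_less_trans)
  have g_bound: "g_con P (u i) < rho_min P + \<epsilon>"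
    if u: "u \<in> admissible P ts A'" "reduced_cost P ts A' u < v_min + \<eta>" and i: "i \<in> {1..N}" for A' u i
  proof (cases "g_con P (u i) > rho_min P")
    case True
    have g_max: "g_con P (u i) \<le> rho_max P" using u(1) i by (simp add: admissible_def)
    \<comment> \<open>The mean value theorem relates the stage excess to the excess of g;
      \<open>s\<close> lies in the interval on which the slope bound holds.\<close>
    obtain s where s: "rho_min P < s" "s < g_con P (u i)"
      "l_cost P (g_con P (u i)) - l_min = (g_con P (u i) - rho_min P) * deriv (l_cost P) s"
      using MVT2[OF True, of "l_cost P" "deriv (l_cost P)"] C1_DERIV[of "l_cost P"] data
      by (auto simp: standing_def)
    have "L\<^sub>l * (g_con P (u i) - rho_min P) \<le> stage P (u i) - l_min"
      using slope[of s] s g_max True by (simp add: stage_def max_absorb2 mult.commute mult_left_mono)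
    then have "h * (L\<^sub>l * (g_con P (u i) - rho_min P)) \<le> step_len P ts * (stage P (u i) - l_min)"
      using h_le \<open>h > 0\<close> L\<^sub>l_pos True by (intro mult_mono) auto
    also have "\<dots> \<le> reduced_cost P ts A' u - v_min" by (rule stage_cost_le[OF u(1) ts_less i])
    also have "\<dots> < h * L\<^sub>l * \<epsilon>" using u(2) \<eta>(3) by linarith
    finally have "h * L\<^sub>l * (g_con P (u i) - rho_min P) < h * L\<^sub>l * \<epsilon>" by (simp add: mult.assoc)
    then show ?thesis using \<open>h > 0\<close> L\<^sub>l_pos by (simp add: mult_less_cancel_left_pos)
  qed (use eps in simp)
  have propagate_eq: "propagate P ts u N = final_state P ts A u" for u
    by (simp add: propagate_eq_traj final_state_def A_def)
  have part1: "(\<exists>z. P9_solution P ts A' z) \<and>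
      (\<forall>x u \<sigma>. P9_solution P ts A' (x, u, \<sigma>) \<longrightarrow>
        norm (G_term P (propagate P ts u N)) \<le> \<epsilon> \<and>
        (\<forall>i\<in>{1..N}. g_con P (u i) < rho_min P + \<epsilon>) \<and>
        ereal (m_cost P (propagate P ts u N)) < P7_value P + ereal \<epsilon>)"
    if A': "dist A' A < r" for A'
  proof (intro conjI allI impI)
    have "admissible P ts A' \<noteq> {}" using near A' by blast
    then show "\<exists>z. P9_solution P ts A' z" using ts_less by (rule ex_P9_solution)
  next
    fix x u \<sigma> assume "P9_solution P ts A' (x, u, \<sigma>)"
    then have u: "u \<in> admissible P ts A'" "reduced_cost P ts A' u < v_min + \<eta>" using sol A' by blast+
    have nu: "norm (G_term P (final_state P ts A u)) < \<epsilon> / 2"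
      "m_cost P (final_state P ts A u) < m_cost P (final_state P ts A' u) + \<epsilon> / 2"
      using near A' u(1) by blast+
    show "norm (G_term P (propagate P ts u N)) \<le> \<epsilon>" using nu(1) eps by (simp add: propagate_eq)
    show "\<forall>i\<in>{1..N}. g_con P (u i) < rho_min P + \<epsilon>" using g_bound[OF u] by blast
    have "m_cost P (final_state P ts A u) < m_cost P y_opt + \<epsilon>"
      using nu(2) final_cost_le[OF u(1) ts_less] u(2) \<eta>(2) by linarith
    then show "ereal (m_cost P (propagate P ts u N)) < P7_value P + ereal \<epsilon>" by (simp add: propagate_eq P7)
  qed
  have part2: "AE q in uniform_cube S e. \<forall>x u \<sigma>.
      P9_solution P ts (Re_mat (perturbed Qi bs Q (tie_conjugates q))) (x, u, \<sigma>) \<longrightarrow>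
      card {i\<in>{1..N}. \<not> g_con P (u i) \<ge> rho_min P} \<le> CARD('x) - 1"
    if jd: "jordan_decomposition A Qi bs Q" and e: "e > 0" "\<forall>q\<in>cube S e. L2_set q S < \<delta>" for Qi bs Q e
  proof -
    \<comment> \<open>The corner of the cube with all coordinates \<open>e\<close> has Euclidean
      norm at least \<open>e\<close>, since the spectrum is nonempty.\<close>
    have "e < \<delta>"
    proof -
      obtain a where a: "a \<in> S" using S(2) by blast
      have "restrict (\<lambda>_. e) S \<in> cube S e" using e(1) by (auto simp: cube_def)
      then have "L2_set (restrict (\<lambda>_. e) S) S < \<delta>" using e(2) by blast
      moreover have "restrict (\<lambda>_. e) S a \<le> L2_set (restrict (\<lambda>_. e) S) S"
        using S(1) a e(1) by (intro member_le_L2_set) auto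
      ultimately show ?thesis using a by simp
    qed
    have ctrl: "z = 0" if "\<And>l. l < CARD('x) \<Longrightarrow>
        Finite_Cartesian_Product.transpose (mpow A l ** B_mat P ts) *v z = 0" for z
    proof (rule ctrb_rank_observable[OF _ that])
      show "rank (ctrb A (B_mat P ts)) = CARD('x)" using reg'[OF ts] unfolding A_def by blast
    qed
    have generic: "AE q in Pi\<^sub>M S (\<lambda>_. lborel). \<forall>K. K \<subseteq> {..<N} \<and> card K = CARD('x) \<longrightarrow>
        Determinants.det (gram K (\<lambda>k. mpow (A + (\<Sum>a\<in>S. tie_conjugates q a *\<^sub>R E a)) k ** B_mat P ts)) \<noteq> 0"
    proof (rule AE_gram_det_nonzero[OF _ S(1) _ E1[OF jd]])
      show "cnj a \<in> S" if "a \<in> S" for a by (rule S(3)[OF that])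
    qed (rule ctrl)
    have "cube S e \<in> sets (Pi\<^sub>M S (\<lambda>_. lborel))"
      unfolding cube_def using S(1) by (intro sets_PiM_I_finite) auto
    then show ?thesis unfolding uniform_cube_def
    proof (rule AE_uniform_measureI)
      show "AE q in Pi\<^sub>M S (\<lambda>_. lborel). q \<in> cube S e \<longrightarrow> (\<forall>x u \<sigma>.
          P9_solution P ts (Re_mat (perturbed Qi bs Q (tie_conjugates q))) (x, u, \<sigma>) \<longrightarrow>
          card {i\<in>{1..N}. \<not> g_con P (u i) \<ge> rho_min P} \<le> CARD('x) - 1)"
        using generic
      proof eventually_elim
        case (elim q)
        define A' where "A' = A + (\<Sum>a\<in>S. tie_conjugates q a *\<^sub>R E a)"
        show ?case unfolding E[OF jd] A'_def[symmetric]
        proof (intro impI allI)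
          fix x u \<sigma> assume q: "q \<in> cube S e" and s: "P9_solution P ts A' (x, u, \<sigma>)"
          have q_le: "\<bar>q a\<bar> \<le> \<delta>" if "a \<in> S" for a
            using q that \<open>e < \<delta>\<close> by (force simp: cube_def PiE_iff)
          have "\<bar>tie_conjugates q a\<bar> \<le> \<delta>" if "a \<in> S" for a
            using that S(3)[OF that] q_le by (simp add: tie_conjugates_def)
          then have A': "dist A' A < r" unfolding A'_def by (rule close)
          have u: "u \<in> admissible P ts A'" using sol[OF s A'] by blast
          show "card {i\<in>{1..N}. \<not> g_con P (u i) \<ge> rho_min P} \<le> CARD('x) - 1"
          proof (rule card_below_rho_min[OF u ts_less])
            show "reduced_cost P ts A' u \<le> reduced_cost P ts A' v" if "v \<in> admissible P ts A'" for v
              by (rule P9_solution_reduced(2)[OF s ts_less that])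
            show "v_min < reduced_cost P ts A' u" using near A' u by blast
            show "Determinants.det (gram K (\<lambda>k. mpow A' k ** B_mat P ts)) \<noteq> 0"
              if "K \<subseteq> {..<N}" "card K = CARD('x)" for K
              using elim that unfolding A'_def by blast
          qed
        qed
      qed
    qed
  qed
  show ?thesis
  proof (rule exI[of _ ts], rule exI[of _ \<delta>], intro conjI allI impI)
    show "\<delta> > 0" by fact
    fix Qi bs Q assume "jordan_decomposition (A_mat P ts) Qi bs Q"
    then have jd: "jordan_decomposition A Qi bs Q" by (simp add: A_def)
    have q_close: "dist (Re_mat (perturbed Qi bs Q q)) A < r" if "L2_set q S < \<delta>" for q
      unfolding E[OF jd]
    proof (rule close)
      fix a assume "a \<in> S"
      then have "\<bar>q a\<bar> \<le> L2_set (\<lambda>a. \<bar>q a\<bar>) S" using S(1) by (intro member_le_L2_set) auto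
      also have "\<dots> = L2_set q S" by (simp add: L2_set_def)
      finally show "\<bar>q a\<bar> \<le> \<delta>" using that by simp
    qed
    show "let eigs = spectrum (cmat_of (A_mat P ts));
           At = (\<lambda>q. Re_mat (perturbed Qi bs Q q) :: real^'x^'x)
       in (\<forall>q. L2_set q eigs < \<delta> \<and> elements_mat (perturbed Qi bs Q q) \<subseteq> \<real> \<longrightarrow>
             (\<exists>z. P9_solution P ts (At q) z) \<and>
             (\<forall>x u \<sigma>. P9_solution P ts (At q) (x, u, \<sigma>) \<longrightarrow>
                norm (G_term P (propagate P ts u (N_stages P))) \<le> \<epsilon> \<and>
                (\<forall>i\<in>{1..N_stages P}. g_con P (u i) < rho_min P + \<epsilon>) \<and>
                ereal (m_cost P (propagate P ts u (N_stages P))) < P7_value P + ereal \<epsilon>)) \<and>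
          (\<forall>e>0. (\<forall>q\<in>cube eigs e. L2_set q eigs < \<delta>) \<longrightarrow>
             (AE q in uniform_cube eigs e.
                \<forall>x u \<sigma>. P9_solution P ts (At (tie_conjugates q)) (x, u, \<sigma>) \<longrightarrow>
                  card {i\<in>{1..N_stages P}. \<not> g_con P (u i) \<ge> rho_min P} \<le> CARD('x) - 1))"
      unfolding Let_def A_def[symmetric] S_def[symmetric]
    proof (rule conjI; intro allI impI)
      fix q assume "L2_set q S < \<delta> \<and> elements_mat (perturbed Qi bs Q q) \<subseteq> \<real>"
      then show "(\<exists>z. P9_solution P ts (Re_mat (perturbed Qi bs Q q)) z) \<and>
          (\<forall>x u \<sigma>. P9_solution P ts (Re_mat (perturbed Qi bs Q q)) (x, u, \<sigma>) \<longrightarrow>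
            norm (G_term P (propagate P ts u N)) \<le> \<epsilon> \<and>
            (\<forall>i\<in>{1..N}. g_con P (u i) < rho_min P + \<epsilon>) \<and>
            ereal (m_cost P (propagate P ts u N)) < P7_value P + ereal \<epsilon>)"
        using part1[OF q_close] by blast
    next
      fix e :: real assume "e > 0" "\<forall>q\<in>cube S e. L2_set q S < \<delta>"
      then show "AE q in uniform_cube S e. \<forall>x u \<sigma>.
          P9_solution P ts (Re_mat (perturbed Qi bs Q (tie_conjugates q))) (x, u, \<sigma>) \<longrightarrow>
          card {i\<in>{1..N}. \<not> g_con P (u i) \<ge> rho_min P} \<le> CARD('x) - 1"
        by (rule part2[OF jd])
    qed
  qed
qed

end
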